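(* Let $0<p\le\infty$, $0<\alpha<\infty$, and let $(\varphi_t)$ be a non-trivial semigroup of analytic functions with Denjoy–Wolff point $b\in\mathbb{D}$, infinitesimal generator $G$, and associated g-symbol $\gamma(z)=\int_b^z\frac{\zeta-b}{G(\zeta)}\,d\zeta$. Then $$H(p,0,\alpha)=[\varphi_t,H(p,\infty,\alpha)]\iff\gamma\in\mathcal{B}_0.$$ Moreover, if $\gamma\notin\mathcal{B}_0$, then $[\varphi_t,H(p,\infty,\alpha)]$ contains a closed subspace isomorphic to $\ell_\infty$.
   Context: A semigroup of analytic functions is a family $\{\varphi_t:t\ge0\}$ of analytic self-maps of the unit disk $\mathbb{D}$ with $\varphi_0=\mathrm{id}$, $\varphi_{t+s}=\varphi_t\circ\varphi_s$, and $\varphi_t\to\varphi_0$ uniformly on compact sets as $t\to0^+$. Its infinitesimal generator is $G(z)=\lim_{t\to0^+}(\varphi_t(z)-z)/t$, which has the form $G(z)=(\bar bz-1)(z-b)P(z)$ with $P$ analytic, $\mathrm{Re}\,P\ge0$, where $b\in\overline{\mathbb{D}}$ is the common Denjoy–Wolff point of the $\varphi_t$. $M_p(r,f)=\left(\int_0^{2\pi}|f(re^{i\theta})|^p\frac{d\theta}{2\pi}\right)^{1/p}$ ($p<\infty$), $M_\infty(r,f)=\max_\theta|f(re^{i\theta})|$; $H(p,\infty,\alpha)$: analytic $f$ with $\sup_{0\le r<1}(1-r)^\alpha M_p(r,f)<\infty$ (this is the norm); $H(p,0,\alpha)$: its subspace where $(1-r)^\alpha M_p(r,f)\to0$. $[\varphi_t,X]=\{f\in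 X:\|f\circ\varphi_t-f\|_X\to0\text{ as }t\to0^+\}$. $\mathcal{B}_0$ is the little Bloch space: analytic $f$ with $(1-|z|^2)|f'(z)|\to0$ as $|z|\to1$. *)

theory Defs
  imports "HOL-Complex_Analysis.Complex_Analysis"
begin

abbreviation unit_disc :: "complex set" where
  "unit_disc \<equiv> ball 0 1"

definition analytic_semigroup :: "(real \<Rightarrow> complex \<Rightarrow> complex) \<Rightarrow> bool" where
  "analytic_semigroup phi \<longleftrightarrow>
     (\<forall>t\<ge>0. phi t holomorphic_on unit_disc \<and> phi t ` unit_disc \<subseteq> unit_disc) \<and>
     (\<forall>z\<in>unit_disc. phi 0 z = z) \<and>
     (\<forall>t\<ge>0. \<forall>s\<ge>0. \<forall>z\<in>unit_disc. phi (t + s) z = phi t (phi s z)) \<and>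
     (\<forall>K. compact K \<and> K \<subseteq> unit_disc \<longrightarrow> uniform_limit K phi (phi 0) (at_right 0))"

definition nontrivial_semigroup :: "(real \<Rightarrow> complex \<Rightarrow> complex) \<Rightarrow> bool" where
  "nontrivial_semigroup phi \<longleftrightarrow> (\<exists>t\<ge>0. \<exists>z\<in>unit_disc. phi t z \<noteq> z)"

definition is_generator :: "(real \<Rightarrow> complex \<Rightarrow> complex) \<Rightarrow> (complex \<Rightarrow> complex) \<Rightarrow> bool" where
  "is_generator phi G \<longleftrightarrow>
     (\<forall>z\<in>unit_disc. ((\<lambda>t. (phi t z - z) / of_real t) \<longlongrightarrow> G z) (at_right 0))"

definition interior_DW_point :: "(real \<Rightarrow> complex \<Rightarrow> complex) \<Rightarrow> complex \<Rightarrow> bool" where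
  "interior_DW_point phi b \<longleftrightarrow> b \<in> unit_disc \<and> (\<forall>t\<ge>0. phi t b = b)"

definition g_symbol :: "(complex \<Rightarrow> complex) \<Rightarrow> complex \<Rightarrow> complex \<Rightarrow> complex" where
  "g_symbol G b z = contour_integral (linepath b z) (\<lambda>w. (w - b) / G w)"

definition little_bloch :: "(complex \<Rightarrow> complex) set" where
  "little_bloch = {f. f holomorphic_on unit_disc \<and>
     (\<forall>e>0. \<exists>r<1. \<forall>z. r < norm z \<and> norm z < 1 \<longrightarrow>
        (1 - (norm z)\<^sup>2) * norm (deriv f z) < e)}"

definition Mp :: "ereal \<Rightarrow> real \<Rightarrow> (complex \<Rightarrow> complex) \<Rightarrow> real" where
  "Mp p r f =
     (if p = \<infinity> then (SUP \<theta>\<in>{0..2*pi}. norm (f (of_real r * cis \<theta>)))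
      else (integral {0..2*pi} (\<lambda>\<theta>. norm (f (of_real r * cis \<theta>)) powr real_of_ereal p) / (2*pi))
             powr (1 / real_of_ereal p))"

definition Hnorm :: "ereal \<Rightarrow> real \<Rightarrow> (complex \<Rightarrow> complex) \<Rightarrow> ennreal" where
  "Hnorm p \<alpha> f = (SUP r\<in>{0..<1}. ennreal ((1 - r) powr \<alpha> * Mp p r f))"

definition H_inf :: "ereal \<Rightarrow> real \<Rightarrow> (complex \<Rightarrow> complex) set" where
  "H_inf p \<alpha> = {f. f holomorphic_on unit_disc \<and> Hnorm p \<alpha> f < \<infinity>}"

definition H_zero :: "ereal \<Rightarrow> real \<Rightarrow> (complex \<Rightarrow> complex) set" where
  "H_zero p \<alpha> = {f. f \<in> H_inf p \<alpha> \<and>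
     ((\<lambda>r. (1 - r) powr \<alpha> * Mp p r f) \<longlongrightarrow> 0) (at_left 1)}"

definition strong_cont_space ::
    "(real \<Rightarrow> complex \<Rightarrow> complex) \<Rightarrow> ereal \<Rightarrow> real \<Rightarrow> (complex \<Rightarrow> complex) set" where
  "strong_cont_space phi p \<alpha> = {f. f \<in> H_inf p \<alpha> \<and>
     ((\<lambda>t. Hnorm p \<alpha> (\<lambda>z. f (phi t z) - f z)) \<longlongrightarrow> 0) (at_right 0)}"

definition linf :: "(nat \<Rightarrow> complex) set" where
  "linf = {x. bounded (range x)}"

definition linf_norm :: "(nat \<Rightarrow> complex) \<Rightarrow> real" where
  "linf_norm x = (SUP n. norm (x n))"

text \<open>The subspace X of H(p,infinity,alpha) contains a closed subspace isomorphic to l_infinity: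
  a linear map T from l_infinity into X, bounded above and below (an isomorphism onto its
  image), whose image is closed in H(p,infinity,alpha).  Functions are identified when
  they agree on the disc.\<close>
definition contains_closed_linf :: "ereal \<Rightarrow> real \<Rightarrow> (complex \<Rightarrow> complex) set \<Rightarrow> bool" where
  "contains_closed_linf p \<alpha> X \<longleftrightarrow>
    (\<exists>T :: (nat \<Rightarrow> complex) \<Rightarrow> complex \<Rightarrow> complex.
       (\<forall>x\<in>linf. T x \<in> X) \<and>
       (\<forall>x\<in>linf. \<forall>y\<in>linf. \<forall>a. T (\<lambda>n. a * x n + y n) = (\<lambda>z. a * T x z + T y z)) \<and>
       (\<exists>c C. 0 < c \<and> 0 < C \<and> (\<forall>x\<in>linf.
          ennreal (c * linf_norm x) \<le> Hnorm p \<alpha> (T x) \<and>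
          Hnorm p \<alpha> (T x) \<le> ennreal (C * linf_norm x))) \<and>
       (\<forall>s g. (\<forall>n. s n \<in> linf) \<longrightarrow> g \<in> H_inf p \<alpha> \<longrightarrow>
          ((\<lambda>n. Hnorm p \<alpha> (\<lambda>z. T (s n) z - g z)) \<longlonglongrightarrow> 0) \<longrightarrow>
          (\<exists>x\<in>linf. \<forall>z\<in>unit_disc. g z = T x z)))"

end

(* Strong continuity of f says that F s = f o phi s - f tends to 0 in norm as s tends to 0. Writing
   G z = - (z - b) * (1 - cnj b * z) * P z with Re P >= 0, Harnack's inequality shows that the flow crosses a
   hyperbolic disc around z in time comparable to (1 - |z|) / |P z|, and gamma is little Bloch iff this time
   tends to 0 at the boundary. In that case an average of |F s|^q over a fixed time interval controls
   (1 - |z|) |f' z|, hence the growth of the means of f is o of the allowed rate. Working with averages over time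
   rather than with the mean (1/t) * integral of f o phi s keeps the argument valid for p < 1.
   If gamma is not little Bloch, there are points a n tending rapidly to the boundary near which the flow is
   hyperbolically slow. Sums of kernels peaking at the a n, with bounded coefficients, are then strongly
   continuous and form the copy of l_infinity; coefficients 1 give a function outside H(p,0,alpha). *)
theory Submission
  imports Defs
begin

section \<open>Poisson kernel and subharmonicity of powers of the modulus\<close>

text \<open>For \<open>p < 1\<close> the integral means satisfy neither the triangle inequality nor
  Minkowski's. What survives for every exponent q is that \<open>|f|^q\<close> lies below its
  Poisson integral over a larger circle, while Poisson integrals obey Harnack's inequality and a
  mean value property under composition with self-maps of the disc. Hence the estimates run through
  q-th powers and compare values of a function with such Poisson integrals.

  The zero of \<open>G\<close> at \<open>b\<close> cancels against the numerator of the g-symbol,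
  leaving the derivative \<open>- 1 / ((1 - cnj b * z) * P z)\<close>; so only the ratio of
  \<open>1 - |z|\<close> to \<open>|P z|\<close> matters. Since \<open>b\<close> lies inside the
  disc, the flow shrinks the distance to the circle by at most a fixed factor, uniformly in time,
  and all composition operators share one norm bound.

  The step from derivatives to means compares the circles at distance \<delta> and 4/3 \<delta> from
  the boundary. The weight gains a power of 3/4, which beats a triangle inequality whose main
  constant is close to 1; iterating then removes the contribution of the a priori bound.\<close>

definition poisson :: "real \<Rightarrow> complex \<Rightarrow> real \<Rightarrow> real" where
  "poisson R w t = (R\<^sup>2 - (norm w)\<^sup>2) / (norm (of_real R * cis t - w))\<^sup>2"

lemma circle_ne:
  assumes "norm w < R" shows "of_real R * cis t \<noteq> w"
proof
  assume "of_real R * cis t = w"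
  hence "norm w = \<bar>R\<bar>" by (auto simp: norm_mult)
  thus False using assms by simp
qed

lemma poisson_nonneg: "norm w < R \<Longrightarrow> 0 \<le> poisson R w t"
  unfolding poisson_def by (intro divide_nonneg_nonneg) (auto intro: power_mono)

lemma continuous_on_poisson: "norm w < R \<Longrightarrow> continuous_on A (poisson R w)"
  unfolding poisson_def using circle_ne[of w R] by (intro continuous_intros) auto

lemma cauchy_circle:
  assumes "continuous_on (cball 0 R) f" "f holomorphic_on ball 0 R" "norm w < R"
  shows "((\<lambda>t. f (of_real R * cis t) * (of_real R * cis t) / (of_real R * cis t - w)) has_integral
           2 * of_real pi * f w) {0..2*pi}"
proof -
  have "((\<lambda>u. f u/(u-w)) has_contour_integral (2 * of_real pi * \<i> * f w)) (part_circlepath 0 R 0 (2*pi))"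
    using Cauchy_integral_circlepath[of 0 R f w] assms unfolding circlepath_def by simp
  hence "((\<lambda>t. f (0 + of_real R * cis t) / (0 + of_real R * cis t - w) * of_real R * \<i> * cis t)
           has_integral (2 * of_real pi * \<i> * f w)) {0..2*pi}"
    by (subst (asm) has_contour_integral_part_circlepath_iff) auto
  from has_integral_mult_right[OF this, of "-\<i>"] show ?thesis
    by (simp add: field_simps)
qed

lemma circle_mean_value:
  assumes "continuous_on (cball 0 R) f" "f holomorphic_on ball 0 R" "0 \<le> R"
  shows "((\<lambda>t. f (of_real R * cis t)) has_integral 2 * of_real pi * f 0) {0..2*pi}"
proof (cases "R = 0")
  case True
  show ?thesis using has_integral_const_real[of "f 0" 0 "2*pi"] True by (simp add: scaleR_conv_of_real)
next
  case False
  with assms cauchy_circle[OF assms(1,2), of 0] show ?thesis by simp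
qed

text \<open>Cauchy's formula is applied to \<open>k\<close>, which is \<open>f\<close> times a
  factor holomorphic near the closed disc and equal to 1 at \<open>w\<close>. On the circle R^2
  equals \<open>u * cnj u\<close>, and there this factor together with the Cauchy kernel is the
  Poisson kernel.\<close>

lemma poisson_formula:
  assumes "continuous_on (cball 0 R) f" "f holomorphic_on ball 0 R" "norm w < R"
  shows "((\<lambda>t. of_real (poisson R w t) * f (of_real R * cis t)) has_integral
           2 * of_real pi * f w) {0..2*pi}"
proof -
  have R: "R > 0" using assms(3) norm_ge_zero[of w] by linarith
  define k where "k u = f u * (of_real (R\<^sup>2 - (norm w)\<^sup>2) / (of_real (R\<^sup>2) - cnj w * u))" for u
  have ne: "of_real (R\<^sup>2) - cnj w * u \<noteq> 0" if "norm u \<le> R" for u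
  proof
    assume "of_real (R\<^sup>2) - cnj w * u = 0"
    hence "norm (of_real (R\<^sup>2) :: complex) = norm (cnj w * u)" by simp
    hence "R\<^sup>2 = norm w * norm u" by (simp add: norm_mult norm_power)
    also have "\<dots> \<le> norm w * R" using that by (intro mult_left_mono) auto
    also have "\<dots> < R * R" using assms(3) R by (intro mult_strict_right_mono) auto
    finally show False by (simp add: power2_eq_square)
  qed
  have "continuous_on (cball 0 R) k" unfolding k_def
    using ne by (intro continuous_intros assms) auto
  moreover have "k holomorphic_on ball 0 R" unfolding k_def
    using ne by (intro holomorphic_intros assms) auto
  ultimately have 1: "((\<lambda>t. k (of_real R * cis t) * (of_real R * cis t) / (of_real R * cis t - w)) has_integral
           2 * of_real pi * k w) {0..2*pi}"
    by (rule cauchy_circle) (rule assms)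
  have "k w = f w"
  proof -
    have "cnj w * w = of_real ((norm w)\<^sup>2)"
      by (metis complex_norm_square mult.commute of_real_power)
    thus ?thesis using ne[of w] assms(3) unfolding k_def by simp
  qed
  moreover have "k (of_real R * cis t) * (of_real R * cis t) / (of_real R * cis t - w) =
       of_real (poisson R w t) * f (of_real R * cis t)" for t
  proof -
    define u where "u = of_real R * cis t"
    have u: "norm u = R" using R by (simp add: u_def norm_mult)
    have uw: "u \<noteq> w" using circle_ne[OF assms(3)] by (simp add: u_def)
    have "of_real (R\<^sup>2) = u * cnj u" using u complex_norm_square[of u] by simp
    hence e1: "of_real (R\<^sup>2) - cnj w * u = u * cnj (u - w)" by (simp add: algebra_simps)
    have e2: "of_real ((norm (u-w))\<^sup>2) = (u - w) * cnj (u - w)" using complex_norm_square[of "u-w"] by simp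
    have u0: "u \<noteq> 0" using u R by auto
    have "k u * u / (u - w) = f u * (of_real (R\<^sup>2 - (norm w)\<^sup>2) / (u * cnj (u - w))) * u / (u - w)"
      unfolding k_def e1 ..
    also have "\<dots> = f u * (of_real (R\<^sup>2 - (norm w)\<^sup>2) / ((u-w) * cnj (u - w)))"
      using u0 by simp
    also have "\<dots> = of_real (poisson R w t) * f u"
      unfolding poisson_def u_def[symmetric] of_real_divide e2 by simp
    finally show ?thesis unfolding u_def .
  qed
  ultimately show ?thesis using 1 by simp
qed

lemma poisson_has_integral:
  assumes "norm w < R"
  shows "(poisson R w has_integral 2 * pi) {0..2*pi}"
proof -
  have "((\<lambda>t. of_real (poisson R w t) * 1) has_integral 2 * of_real pi * (1::complex)) {0..2*pi}"
    by (rule poisson_formula) (use assms in auto)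
  from has_integral_Re[OF this] show ?thesis by simp
qed

lemma poisson_norm_le:
  assumes "continuous_on (cball 0 R) f" "f holomorphic_on ball 0 R" "norm w < R"
  shows "2 * pi * norm (f w) \<le> integral {0..2*pi} (\<lambda>t. poisson R w t * norm (f (of_real R * cis t)))"
proof -
  have R: "R > 0" using assms(3) norm_ge_zero[of w] by linarith
  have 1: "((\<lambda>t. of_real (poisson R w t) * f (of_real R * cis t)) has_integral
           2 * of_real pi * f w) {0..2*pi}" by (rule poisson_formula) fact+
  have c: "continuous_on {0..2*pi} (\<lambda>t. f (of_real R * cis t))"
    by (rule continuous_on_compose2[OF assms(1)])
       (use R in \<open>auto intro!: continuous_intros simp: norm_mult\<close>)
  have "norm (2 * of_real pi * f w) = norm (integral {0..2*pi} (\<lambda>t. of_real (poisson R w t) * f (of_real R * cis t)))"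
    using integral_unique[OF 1] by simp
  also have "\<dots> \<le> integral {0..2*pi} (\<lambda>t. poisson R w t * norm (f (of_real R * cis t)))"
  proof (rule integral_norm_bound_integral)
    show "(\<lambda>t. of_real (poisson R w t) * f (of_real R * cis t)) integrable_on {0..2*pi}"
      using 1 by blast
    show "(\<lambda>t. poisson R w t * norm (f (of_real R * cis t))) integrable_on {0..2*pi}"
      by (intro integrable_continuous_real continuous_intros c continuous_on_poisson assms)
  qed (use poisson_nonneg[OF assms(3)] in \<open>auto simp: norm_mult\<close>)
  finally show ?thesis by (simp add: norm_mult)
qed

section \<open>Approximation on a circle by real parts of entire functions\<close>

inductive trig_poly :: "(complex \<Rightarrow> real) \<Rightarrow> bool" where
  monomial: "trig_poly (\<lambda>w. Re (c * w ^ k))"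
| add: "trig_poly f \<Longrightarrow> trig_poly g \<Longrightarrow> trig_poly (\<lambda>w. f w + g w)"

lemma trig_poly_Re: "trig_poly f \<Longrightarrow> \<exists>Q. Q holomorphic_on UNIV \<and> (\<forall>w. f w = Re (Q w))"
proof (induction rule: trig_poly.induct)
  case (monomial c k)
  show ?case by (rule exI[of _ "\<lambda>w. c * w ^ k"]) (auto intro!: holomorphic_intros)
next
  case (add f g)
  then obtain Q1 Q2 where "Q1 holomorphic_on UNIV \<and> (\<forall>w. f w = Re (Q1 w))"
    "Q2 holomorphic_on UNIV \<and> (\<forall>w. g w = Re (Q2 w))" by blast
  thus ?case by (intro exI[of _ "\<lambda>w. Q1 w + Q2 w"]) (auto intro!: holomorphic_intros)
qed

text \<open>On the circle \<open>w * cnj w\<close> is the constant R^2, which turns a product of two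
  real parts of monomials into a sum of two such real parts. Closure under products holds only on
  the circle, and Stone-Weierstrass requires it there.\<close>

lemma Re_monomial_mult:
  assumes "norm w = R" "k \<le> j"
  shows "Re (c * w ^ j) * Re (d * w ^ k) =
     Re ((c * d / 2) * w ^ (j + k)) + Re ((c * cnj d * of_real (R ^ (2*k)) / 2) * w ^ (j - k))"
proof -
  have *: "Re a * Re b = Re (a * b / 2) + Re (a * cnj b / 2)" for a b by (simp add: field_simps)
  have "w ^ j * cnj (w ^ k) = w ^ (j - k) * (w * cnj w) ^ k"
    using assms(2) by (simp add: power_mult_distrib flip: power_add mult.assoc)
  also have "w * cnj w = of_real (R\<^sup>2)" using assms(1) complex_norm_square[of w] by simp
  finally have e: "w ^ j * cnj (w ^ k) = w ^ (j - k) * of_real (R ^ (2*k))" by (simp add: power_mult)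
  have "(c * w ^ j) * cnj (d * w ^ k) / 2 = c * cnj d * (w ^ j * cnj (w ^ k)) / 2" by simp
  also have "\<dots> = (c * cnj d * of_real (R ^ (2*k)) / 2) * w ^ (j - k)" unfolding e by simp
  finally have "(c * w ^ j) * cnj (d * w ^ k) / 2 = (c * cnj d * of_real (R ^ (2*k)) / 2) * w ^ (j - k)" .
  moreover have "(c * w ^ j) * (d * w ^ k) / 2 = (c * d / 2) * w ^ (j + k)" by (simp add: power_add)
  ultimately show ?thesis using *[of "c * w ^ j" "d * w ^ k"] by (simp only:)
qed

lemma trig_poly_mult:
  assumes "trig_poly f" "trig_poly g"
  shows "\<exists>h. trig_poly h \<and> (\<forall>w. norm w = R \<longrightarrow> f w * g w = h w)"
  using assms
proof (induction rule: trig_poly.induct)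
  case (monomial c j)
  from monomial show ?case
  proof (induction rule: trig_poly.induct)
    case (monomial d k)
    show ?case
    proof (cases "k \<le> j")
      case True
      show ?thesis
        using Re_monomial_mult[OF _ True, of _ R c d] trig_poly.add[OF trig_poly.monomial trig_poly.monomial] by blast
    next
      case False
      hence "j \<le> k" by simp
      show ?thesis
        using Re_monomial_mult[OF _ \<open>j \<le> k\<close>, of _ R d c] trig_poly.add[OF trig_poly.monomial trig_poly.monomial]
        unfolding mult.commute[of "Re (c * _)"] by blast
    qed
  next
    case (add g1 g2)
    then obtain h1 h2 where "trig_poly h1 \<and> (\<forall>w. norm w = R \<longrightarrow> Re (c * w ^ j) * g1 w = h1 w)"
      "trig_poly h2 \<and> (\<forall>w. norm w = R \<longrightarrow> Re (c * w ^ j) * g2 w = h2 w)" by blast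
    thus ?case by (intro exI[of _ "\<lambda>w. h1 w + h2 w"]) (auto intro: trig_poly.add simp: distrib_left)
  qed
next
  case (add f1 f2)
  then obtain h1 h2 where "trig_poly h1 \<and> (\<forall>w. norm w = R \<longrightarrow> f1 w * g w = h1 w)"
      "trig_poly h2 \<and> (\<forall>w. norm w = R \<longrightarrow> f2 w * g w = h2 w)" by blast
  thus ?case by (intro exI[of _ "\<lambda>w. h1 w + h2 w"]) (auto intro: trig_poly.add simp: distrib_right)
qed

text \<open>Real parts of an entire \<open>Q\<close> are wanted because \<open>exp (Q w)\<close> is
  then a zero-free holomorphic function with nearly prescribed modulus on the circle.\<close>

lemma trig_poly_approx:
  assumes "continuous_on (sphere 0 R) g" "0 < e"
  obtains Q where "Q holomorphic_on UNIV" "\<And>w. norm w = R \<Longrightarrow> \<bar>g w - Re (Q w)\<bar> < e"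
proof -
  define P where "P f \<longleftrightarrow> (\<exists>h. trig_poly h \<and> (\<forall>w. norm w = R \<longrightarrow> f w = h w))" for f
  have P_trig: "P f" if "trig_poly f" for f using that unfolding P_def by blast
  have cont: "continuous_on (sphere 0 R) f" if "P f" for f
  proof -
    from that obtain h where h: "trig_poly h" "\<And>w. norm w = R \<Longrightarrow> f w = h w" unfolding P_def by blast
    from trig_poly_Re[OF h(1)] obtain Q where Q: "Q holomorphic_on UNIV" "\<And>w. h w = Re (Q w)" by blast
    have "continuous_on (sphere 0 R) (\<lambda>w. Re (Q w))"
      by (intro continuous_intros holomorphic_on_imp_continuous_on holomorphic_on_subset[OF Q(1)]) auto
    thus ?thesis by (rule continuous_on_cong[THEN iffD1, rotated -1]) (use h Q in auto)
  qed
  have "\<exists>f. P f \<and> (\<forall>x\<in>sphere 0 R. \<bar>g x - f x\<bar> < e)"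
  proof (rule Stone_Weierstrass_HOL[OF _ _ _ _ _ _ assms])
    show "compact (sphere (0::complex) R)" by simp
    show "P (\<lambda>x. c)" for c using P_trig[OF trig_poly.monomial[of "of_real c" 0]] by simp
    show "P (\<lambda>x. f x + h x)" if "P f \<and> P h" for f h
      using that trig_poly.add unfolding P_def by metis
    show "P (\<lambda>x. f x * h x)" if "P f \<and> P h" for f h
    proof -
      from that obtain f' h' where 1: "trig_poly f'" "\<forall>w. norm w = R \<longrightarrow> f w = f' w"
         "trig_poly h'" "\<forall>w. norm w = R \<longrightarrow> h w = h' w" unfolding P_def by blast
      from trig_poly_mult[OF 1(1,3), of R] 1(2,4) show ?thesis unfolding P_def by metis
    qed
    show "\<exists>f. P f \<and> f x \<noteq> f y" if "x \<in> sphere 0 R \<and> y \<in> sphere 0 R \<and> x \<noteq> y" for x y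
    proof (cases "Re x = Re y")
      case False
      thus ?thesis using P_trig[OF trig_poly.monomial[of 1 1]] by (intro exI[of _ Re]) auto
    next
      case True
      hence "Im x \<noteq> Im y" using that complex_eqI by blast
      moreover have "P Im" using P_trig[OF trig_poly.monomial[of "-\<i>" 1]] by simp
      ultimately show ?thesis by blast
    qed
  qed (use cont in auto)
  then obtain f where "P f" and f: "\<And>x. norm x = R \<Longrightarrow> \<bar>g x - f x\<bar> < e" by auto
  then obtain h where h: "trig_poly h" "\<And>w. norm w = R \<Longrightarrow> f w = h w" unfolding P_def by blast
  from trig_poly_Re[OF h(1)] obtain Q where Q: "Q holomorphic_on UNIV" "\<And>w. h w = Re (Q w)" by blast
  show thesis by (rule that[OF Q(1)]) (use f h Q in auto)
qed

text \<open>Choosing an entire Q with Re Q close to log (|f|^q + e) on the circle, the maximum principle for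
  f exp (-Q/q) reduces the claim to the Poisson formula for exp Q; no zeros have to be factored out.\<close>

lemma norm_powr_le_poisson:
  assumes f: "continuous_on (cball 0 R) f" "f holomorphic_on ball 0 R" and w: "norm w < R" and q: "0 < q"
  shows "2 * pi * norm (f w) powr q \<le>
     integral {0..2*pi} (\<lambda>t. poisson R w t * norm (f (of_real R * cis t)) powr q)" (is "_ \<le> ?I")
proof -
  have R: "R > 0" using w norm_ge_zero[of w] by linarith
  have cf: "continuous_on {0..2*pi} (\<lambda>t. f (of_real R * cis t))"
    by (rule continuous_on_compose2[OF f(1)])
       (use R in \<open>auto intro!: continuous_intros simp: norm_mult\<close>)
  have int1: "(\<lambda>t. poisson R w t * norm (f (of_real R * cis t)) powr q) integrable_on {0..2*pi}"
    by (intro integrable_continuous_real continuous_intros cf continuous_on_poisson w continuous_on_powr') (use q in auto)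
  have int2: "poisson R w integrable_on {0..2*pi}" using poisson_has_integral[OF w] by blast
  \<comment> \<open>The summand \<open>e\<close> keeps the logarithm finite at zeros of
    \<open>f\<close>. The error \<open>e\<close> of the approximation enters once from each side,
    whence \<open>exp (2 * e)\<close>.\<close>
  have main: "2 * pi * norm (f w) powr q \<le> exp (2 * e) * (?I + e * (2 * pi))" if e: "e > 0" for e
  proof -
    have "continuous_on (sphere 0 R) (\<lambda>u. ln (norm (f u) powr q + e))"
    proof -
      have "continuous_on (sphere 0 R) f" by (rule continuous_on_subset[OF f(1)]) auto
      moreover have "norm (f u) powr q + e \<noteq> 0" for u
        using e powr_ge_zero[of "norm (f u)" q] by linarith
      ultimately show ?thesis
        by (intro continuous_intros continuous_on_powr' continuous_on_ln) (use q in auto)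
    qed
    from trig_poly_approx[OF this e] obtain Q where Q: "Q holomorphic_on UNIV"
      and Qg: "\<And>u. norm u = R \<Longrightarrow> \<bar>ln (norm (f u) powr q + e) - Re (Q u)\<bar> < e"
      by metis
    have Qc: "continuous_on A Q" for A
      using holomorphic_on_imp_continuous_on[OF Q] continuous_on_subset by blast
    have Qh: "Q holomorphic_on A" for A using Q holomorphic_on_subset by blast
    have up: "norm (f u) powr q + e \<le> exp (Re (Q u) + e)"
      and lo: "exp (Re (Q u) + e) \<le> exp (2 * e) * (norm (f u) powr q + e)" if "norm u = R" for u
    proof -
      have pos: "norm (f u) powr q + e > 0" using e powr_ge_zero[of "norm (f u)" q] by linarith
      have "ln (norm (f u) powr q + e) \<le> Re (Q u) + e" using Qg[OF that] by linarith
      thus "norm (f u) powr q + e \<le> exp (Re (Q u) + e)" using pos by (metis exp_le_cancel_iff exp_ln)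
      have "Re (Q u) + e \<le> 2 * e + ln (norm (f u) powr q + e)" using Qg[OF that] by linarith
      hence "exp (Re (Q u) + e) \<le> exp (2 * e + ln (norm (f u) powr q + e))" by simp
      also have "\<dots> = exp (2 * e) * (norm (f u) powr q + e)" using pos by (simp add: exp_add)
      finally show "exp (Re (Q u) + e) \<le> exp (2 * e) * (norm (f u) powr q + e)" .
    qed
    have J: "((\<lambda>t. exp (2 * e) * (poisson R w t * norm (f (of_real R * cis t)) powr q + e * poisson R w t))
        has_integral exp (2 * e) * (?I + e * (2 * pi))) {0..2*pi}"
      by (intro has_integral_mult_right has_integral_add integrable_integral int1 poisson_has_integral w)
    have "norm (f w * exp (- (Q w + of_real e) / of_real q)) \<le> 1"
    proof (rule maximum_modulus_frontier[where S = "cball 0 R" and \<xi> = w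
          and f = "\<lambda>w. f w * exp (- (Q w + of_real e) / of_real q)"])
      show "(\<lambda>w. f w * exp (- (Q w + of_real e) / of_real q)) holomorphic_on interior (cball 0 R)"
        using q by (auto intro!: holomorphic_intros f Qh)
      show "continuous_on (closure (cball 0 R)) (\<lambda>w. f w * exp (- (Q w + of_real e) / of_real q))"
        using q by (auto intro!: continuous_intros f Qc)
      fix u assume "u \<in> frontier (cball (0::complex) R)"
      hence u: "norm u = R" using R by (simp add: frontier_cball)
      have "norm (f u) powr q \<le> exp (Re (Q u) + e)" using up[OF u] e by linarith
      hence "(norm (f u) powr q) powr (1/q) \<le> exp (Re (Q u) + e) powr (1/q)"
        using q by (intro powr_mono2) auto
      moreover have "(norm (f u) powr q) powr (1/q) = norm (f u)" using q by (simp add: powr_powr)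
      moreover have "exp (Re (Q u) + e) powr (1/q) = exp ((Re (Q u) + e) / q)" by (simp add: powr_def)
      ultimately have "norm (f u) \<le> exp ((Re (Q u) + e) / q)" by simp
      moreover have "norm (exp (- (Q u + of_real e) / of_real q)) = inverse (exp ((Re (Q u) + e) / q))"
        by (simp add: minus_divide_left flip: exp_minus)
      ultimately show "norm (f u * exp (- (Q u + of_real e) / of_real q)) \<le> 1"
        by (simp only: norm_mult divide_inverse[symmetric]) (simp add: divide_le_eq)
    qed (use w in auto)
    moreover have "norm (exp (- (Q w + of_real e) / of_real q)) = inverse (exp ((Re (Q w) + e) / q))"
      by (simp add: minus_divide_left flip: exp_minus)
    ultimately have "norm (f w) * inverse (exp ((Re (Q w) + e) / q)) \<le> 1"
      by (simp only: norm_mult)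
    hence "norm (f w) \<le> exp ((Re (Q w) + e) / q)"
      by (simp add: divide_le_eq flip: divide_inverse)
    hence "norm (f w) powr q \<le> exp ((Re (Q w) + e) / q) powr q"
      using q by (intro powr_mono2) auto
    also have "\<dots> = norm (exp (Q w + of_real e))" using q by (simp add: powr_def)
    finally have "2 * pi * norm (f w) powr q \<le> 2 * pi * norm (exp (Q w + of_real e))" by simp
    also have "\<dots> \<le> integral {0..2*pi} (\<lambda>t. poisson R w t * norm (exp (Q (of_real R * cis t) + of_real e)))"
      by (rule poisson_norm_le[OF _ _ w]) (auto intro!: continuous_intros holomorphic_intros Qc Qh)
    also have "\<dots> \<le> integral {0..2*pi} (\<lambda>t. exp (2 * e) * (poisson R w t * norm (f (of_real R * cis t)) powr q + e * poisson R w t))"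
    proof (rule integral_le)
      show "(\<lambda>t. poisson R w t * norm (exp (Q (of_real R * cis t) + of_real e))) integrable_on {0..2*pi}"
        by (intro integrable_continuous_real continuous_intros continuous_on_poisson w
             continuous_on_compose2[OF Qc[of UNIV]]) auto
      show "(\<lambda>t. exp (2 * e) * (poisson R w t * norm (f (of_real R * cis t)) powr q + e * poisson R w t)) integrable_on {0..2*pi}"
        using J by blast
      fix t
      have "norm (of_real R * cis t) = R" using R by (simp add: norm_mult)
      from lo[OF this] have "poisson R w t * exp (Re (Q (of_real R * cis t)) + e) \<le>
          poisson R w t * (exp (2 * e) * (norm (f (of_real R * cis t)) powr q + e))"
        using poisson_nonneg[OF w] by (intro mult_left_mono) auto
      thus "poisson R w t * norm (exp (Q (of_real R * cis t) + of_real e)) \<le>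
         exp (2 * e) * (poisson R w t * norm (f (of_real R * cis t)) powr q + e * poisson R w t)"
        by (simp add: algebra_simps)
    qed
    also have "\<dots> = exp (2 * e) * (?I + e * (2 * pi))"
      using J by (rule integral_unique)
    finally show ?thesis .
  qed
  have "((\<lambda>e. exp (2 * e) * (?I + e * (2 * pi))) \<longlongrightarrow> exp (2 * 0) * (?I + 0 * (2 * pi))) (at_right 0)"
    by (intro tendsto_intros)
  moreover have "eventually (\<lambda>e. 2 * pi * norm (f w) powr q \<le> exp (2 * e) * (?I + e * (2 * pi))) (at_right 0)"
    using main by (auto simp: eventually_at_right_field intro: exI[of _ 1])
  ultimately have "2 * pi * norm (f w) powr q \<le> exp (2 * 0) * (?I + 0 * (2 * pi))"
    by (rule tendsto_lowerbound) simp
  thus ?thesis by simp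
qed

section \<open>Normalised circular averages and suprema\<close>

definition circ :: "real measure" where
  "circ = uniform_measure lborel {0..2*pi}"

lemma sets_circ [measurable_cong, simp]: "sets circ = sets borel"
  by (simp add: circ_def)

lemma space_circ [simp]: "space circ = UNIV"
  by (simp add: circ_def)

lemma emeasure_circ: "emeasure circ UNIV = 1"
  unfolding circ_def by (subst emeasure_uniform_measure) (auto simp: ennreal_divide_self)

lemma finite_measure_circ: "finite_measure circ"
  by (rule finite_measureI) (simp add: emeasure_circ)

lemma sigma_finite_circ: "sigma_finite_measure circ"
  using finite_measure_circ by (simp add: finite_measure_def)

lemma AE_circ: "AE t in circ. t \<in> {0..2*pi}"
  unfolding circ_def by (intro AE_uniform_measureI) auto

lemma AE_circI: "(\<And>t. t \<in> {0..2*pi} \<Longrightarrow> P t) \<Longrightarrow> AE t in circ. P t"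
  by (rule AE_mp[OF AE_circ]) auto

lemma nn_integral_circ:
  assumes "continuous_on {0..2*pi} f" "f \<in> borel_measurable borel" "\<And>t. t \<in> {0..2*pi} \<Longrightarrow> 0 \<le> f t"
  shows "(\<integral>\<^sup>+t. ennreal (f t) \<partial>circ) = ennreal (integral {0..2*pi} f / (2*pi))"
proof -
  have "(f has_integral integral {0..2*pi} f) {0..2*pi}"
    using integrable_continuous_real[OF assms(1)] by (rule integrable_integral)
  hence 1: "((\<lambda>t. f t * indicator {0..2*pi} t) has_integral integral {0..2*pi} f) UNIV"
    by (subst (asm) has_integral_restrict_UNIV[symmetric])
       (auto simp: indicator_def if_distrib cong: if_cong elim!: back_subst[of "\<lambda>x. (x has_integral _) _"])
  have "(\<integral>\<^sup>+t. ennreal (f t * indicator {0..2*pi} t) \<partial>lborel) = ennreal (integral {0..2*pi} f)"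
    by (rule nn_integral_has_integral_lborel[OF _ _ 1])
       (use assms in \<open>auto simp: indicator_def\<close>)
  moreover have "(\<integral>\<^sup>+t. ennreal (f t) * indicator {0..2*pi} t \<partial>lborel) = (\<integral>\<^sup>+t. ennreal (f t * indicator {0..2*pi} t) \<partial>lborel)"
    by (intro nn_integral_cong) (auto simp: indicator_def)
  moreover have "integral {0..2*pi} f \<ge> 0"
    by (intro integral_nonneg integrable_continuous_real assms)
  ultimately show ?thesis unfolding circ_def
    by (subst nn_integral_uniform_measure) (use assms in \<open>auto simp: divide_ennreal\<close>)
qed

text \<open>\<open>p\<close> merely selects supremum or average. The power is put into
  \<open>g\<close>, so the mean is monotone, homogeneous and countably subadditive for every
  \<open>p\<close>, also below 1.\<close>

definition cmean :: "ereal \<Rightarrow> (real \<Rightarrow> ennreal) \<Rightarrow> ennreal" where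
  "cmean p g = (if p = \<infinity> then (SUP t\<in>{0..2*pi}. g t) else (\<integral>\<^sup>+t. g t \<partial>circ))"

lemma cmean_mono:
  assumes "\<And>t. t \<in> {0..2*pi} \<Longrightarrow> g t \<le> h t" shows "cmean p g \<le> cmean p h"
  unfolding cmean_def using assms
  by (cases "p = \<infinity>") (auto intro!: nn_integral_mono_AE AE_circI intro: SUP_subset_mono)


lemma cmean_const: "cmean p (\<lambda>_. c) = c"
  unfolding cmean_def by (auto simp: emeasure_circ)

lemma cmean_bound:
  assumes "\<And>t. t \<in> {0..2*pi} \<Longrightarrow> g t \<le> c" shows "cmean p g \<le> c"
  using cmean_mono[of g "\<lambda>_. c" p] assms by (simp add: cmean_const)

lemma cmean_cmult: "g \<in> borel_measurable borel \<Longrightarrow> cmean p (\<lambda>t. c * g t) = c * cmean p g"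
  unfolding cmean_def by (auto simp: nn_integral_cmult SUP_mult_left_ennreal)

lemma cmean_add_le:
  assumes [measurable]: "g \<in> borel_measurable borel" "h \<in> borel_measurable borel"
  shows "cmean p (\<lambda>t. g t + h t) \<le> cmean p g + cmean p h"
proof (cases "p = \<infinity>")
  case True
  thus ?thesis unfolding cmean_def by (auto intro!: SUP_least add_mono SUP_upper)
next
  case False
  thus ?thesis unfolding cmean_def by (simp add: nn_integral_add)
qed

lemma cmean_suminf_le:
  assumes [measurable]: "\<And>n::nat. g n \<in> borel_measurable borel"
  shows "cmean p (\<lambda>t. \<Sum>n. g n t) \<le> (\<Sum>n. cmean p (g n))"
proof (cases "p = \<infinity>")
  case True
  thus ?thesis unfolding cmean_def by (auto intro!: SUP_least suminf_le SUP_upper)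
next
  case False
  thus ?thesis unfolding cmean_def by (simp add: nn_integral_suminf)
qed

text \<open>This takes the place of Minkowski's integral inequality: by Tonelli, averaging over a
  parameter with a probability measure does not increase the mean. For the supremum the bound holds
  at each angle separately.\<close>

lemma cmean_nn_integral_le:
  assumes M: "finite_measure M" "emeasure M (space M) = 1"
    and m: "(\<lambda>(t, s). g t s) \<in> borel_measurable (borel \<Otimes>\<^sub>M M)"
    and S: "AE s in M. s \<in> S" and b: "\<And>s. s \<in> S \<Longrightarrow> cmean p (\<lambda>t. g t s) \<le> B"
  shows "cmean p (\<lambda>t. \<integral>\<^sup>+s. g t s \<partial>M) \<le> B"
proof (cases "p = \<infinity>")
  case True
  have "(\<integral>\<^sup>+s. g t s \<partial>M) \<le> B" if "t \<in> {0..2*pi}" for t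
  proof -
    have "(\<integral>\<^sup>+s. g t s \<partial>M) \<le> (\<integral>\<^sup>+s. B \<partial>M)"
    proof (rule nn_integral_mono_AE, rule AE_mp[OF S], rule AE_I2, rule impI)
      fix s assume "s \<in> S"
      from b[OF this] show "g t s \<le> B" using True that unfolding cmean_def by (auto simp: SUP_le_iff)
    qed
    also have "\<dots> = B" using M by simp
    finally show ?thesis .
  qed
  thus ?thesis by (rule cmean_bound)
next
  case False
  interpret M: finite_measure M by fact
  interpret C: sigma_finite_measure circ by (rule sigma_finite_circ)
  interpret P: pair_sigma_finite circ M ..
  have "(\<lambda>(t, s). g t s) \<in> borel_measurable (circ \<Otimes>\<^sub>M M)"
    using m by (simp cong: measurable_cong_sets add: sets_pair_measure_cong[OF sets_circ refl])
  from P.Fubini'[OF this] have "(\<integral>\<^sup>+t. \<integral>\<^sup>+s. g t s \<partial>M \<partial>circ) = (\<integral>\<^sup>+s. \<integral>\<^sup>+t. g t s \<partial>circ \<partial>M)" by simp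
  also have "\<dots> \<le> (\<integral>\<^sup>+s. B \<partial>M)"
    by (rule nn_integral_mono_AE, rule AE_mp[OF S]) (use b False in \<open>auto simp: cmean_def\<close>)
  also have "\<dots> = B" using M by simp
  finally show ?thesis using False by (simp add: cmean_def)
qed

section \<open>Poisson integrals of nonnegative functions: Harnack and subordination\<close>

definition pint :: "real \<Rightarrow> (real \<Rightarrow> ennreal) \<Rightarrow> complex \<Rightarrow> ennreal" where
  "pint R g w = (\<integral>\<^sup>+t. ennreal (poisson R w t) * g t \<partial>circ)"

lemma borel_measurable_poisson [measurable]:
  "(\<lambda>(w, t). poisson R w t) \<in> borel_measurable (borel \<Otimes>\<^sub>M borel)"
proof -
  have 1: "(\<lambda>x::complex \<times> real. R\<^sup>2 - (norm (fst x))\<^sup>2) \<in> borel_measurable borel"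
    by (intro borel_measurable_continuous_onI continuous_intros)
  have 2: "(\<lambda>x::complex \<times> real. (norm (of_real R * cis (snd x) - fst x))\<^sup>2) \<in> borel_measurable borel"
    by (intro borel_measurable_continuous_onI continuous_intros)
  show ?thesis unfolding poisson_def case_prod_unfold borel_prod
    by (rule borel_measurable_divide[OF 1 2])
qed

lemma nn_integral_poisson:
  assumes "norm w < R" shows "(\<integral>\<^sup>+t. ennreal (poisson R w t) \<partial>circ) = 1"
proof -
  have "(\<integral>\<^sup>+t. ennreal (poisson R w t) \<partial>circ) = ennreal (integral {0..2*pi} (poisson R w) / (2*pi))"
    by (rule nn_integral_circ) (use assms poisson_nonneg continuous_on_poisson in auto)
  thus ?thesis using integral_unique[OF poisson_has_integral[OF assms]] by simp
qed

lemma pint_le_cmean_inf: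
  assumes "norm w < R" "g \<in> borel_measurable borel" shows "pint R g w \<le> cmean \<infinity> g"
proof -
  have "pint R g w \<le> (\<integral>\<^sup>+t. ennreal (poisson R w t) * cmean \<infinity> g \<partial>circ)"
    unfolding pint_def
    by (intro nn_integral_mono_AE AE_circI) (auto simp: cmean_def intro!: mult_left_mono SUP_upper)
  also have "\<dots> = cmean \<infinity> g" using nn_integral_poisson[OF assms(1)]
    by (subst nn_integral_multc) auto
  finally show ?thesis .
qed

lemma norm_powr_le_pint:
  assumes f: "continuous_on (cball 0 R) f" "f holomorphic_on ball 0 R" and w: "norm w < R" and q: "0 < q"
    and m: "(\<lambda>t. f (of_real R * cis t)) \<in> borel_measurable borel"
  shows "ennreal (norm (f w) powr q) \<le> pint R (\<lambda>t. ennreal (norm (f (of_real R * cis t)) powr q)) w"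
proof -
  note [measurable] = m
  have R: "R > 0" using w norm_ge_zero[of w] by linarith
  have cf: "continuous_on {0..2*pi} (\<lambda>t. f (of_real R * cis t))"
    by (rule continuous_on_compose2[OF f(1)])
       (use R in \<open>auto intro!: continuous_intros simp: norm_mult\<close>)
  have "pint R (\<lambda>t. ennreal (norm (f (of_real R * cis t)) powr q)) w =
      (\<integral>\<^sup>+t. ennreal (poisson R w t * norm (f (of_real R * cis t)) powr q) \<partial>circ)"
    unfolding pint_def using poisson_nonneg[OF w] by (intro nn_integral_cong) (simp add: ennreal_mult)
  also have "\<dots> = ennreal (integral {0..2*pi} (\<lambda>t. poisson R w t * norm (f (of_real R * cis t)) powr q) / (2*pi))"
    by (intro nn_integral_circ mult_nonneg_nonneg poisson_nonneg w continuous_intros cf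
          continuous_on_poisson continuous_on_powr') (use q in auto)
  finally show ?thesis using norm_powr_le_poisson[OF f w q]
    by (simp add: ennreal_leI field_simps)
qed

text \<open>12 = 3 * 4: within half the distance from \<open>z\<close> to the circle the numerator
  grows at most by the factor 3, and the distance to a boundary point, which enters squared, drops
  at most by half.\<close>

lemma poisson_Harnack:
  assumes "norm z < R" "norm (w - z) \<le> (R - norm z) / 2"
  shows "poisson R w t \<le> 12 * poisson R z t"
proof -
  define u where "u = of_real R * cis t"
  have R: "R > 0" using assms(1) norm_ge_zero[of z] by linarith
  have u: "norm u = R" using R by (simp add: u_def norm_mult)
  have w: "norm w \<le> norm z + (R - norm z) / 2" using norm_triangle_ineq[of z "w - z"] assms(2) by (simp add: field_simps)
  hence wR: "norm w < R" using assms(1) by (simp add: field_simps)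
  have w2: "norm z - (R - norm z) / 2 \<le> norm w"
    using norm_triangle_ineq2[of z w] assms(2) by (simp add: norm_minus_commute field_simps)
  have d1: "norm (u - z) \<ge> R - norm z" using norm_triangle_ineq2[of u z] u by simp
  have d2: "norm (u - w) \<ge> norm (u - z) / 2"
  proof -
    have "norm (u - z) \<le> norm (u - w) + norm (w - z)" using norm_triangle_ineq[of "u-w" "w-z"] by simp
    moreover have "norm (w - z) \<le> norm (u - z) / 2"
      using assms(2) divide_right_mono[OF d1, of 2] by linarith
    ultimately show ?thesis by simp
  qed
  have p: "norm (u - z) > 0" using d1 assms(1) by linarith
  have n1: "R\<^sup>2 - (norm w)\<^sup>2 \<le> 3 * (R\<^sup>2 - (norm z)\<^sup>2)"
  proof -
    have "R\<^sup>2 - (norm w)\<^sup>2 = (R - norm w) * (R + norm w)" by (simp add: power2_eq_square algebra_simps)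
    also have "\<dots> \<le> (3/2 * (R - norm z)) * (2 * R)"
    proof (intro mult_mono)
      show "R - norm w \<le> 3/2 * (R - norm z)" using w2 by (simp add: field_simps)
      show "R + norm w \<le> 2 * R" using wR by simp
      show "0 \<le> 3/2 * (R - norm z)" using assms(1) by simp
      show "0 \<le> R + norm w" using R norm_ge_zero[of w] by linarith
    qed
    also have "\<dots> = 3 * ((R - norm z) * R)" by simp
    also have "\<dots> \<le> 3 * ((R - norm z) * (R + norm z))"
      using assms(1) by (intro mult_left_mono) auto
    also have "\<dots> = 3 * (R\<^sup>2 - (norm z)\<^sup>2)" by (simp add: power2_eq_square algebra_simps)
    finally show ?thesis .
  qed
  have n2: "R\<^sup>2 - (norm z)\<^sup>2 \<ge> 0" using assms(1) by (auto intro: power_mono)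
  have "poisson R w t \<le> (3 * (R\<^sup>2 - (norm z)\<^sup>2)) / (norm (u - z) / 2)\<^sup>2"
    unfolding poisson_def u_def[symmetric]
    using d2 p n1 n2 by (intro frac_le power_mono) auto
  also have "\<dots> = 12 * poisson R z t" unfolding poisson_def u_def[symmetric]
    by (simp add: power2_eq_square field_simps)
  finally show ?thesis .
qed

lemma pint_Harnack:
  assumes "norm z < R" "norm (w - z) \<le> (R - norm z) / 2" "g \<in> borel_measurable borel"
  shows "pint R g w \<le> 12 * pint R g z"
proof -
  have "ennreal (poisson R w t) \<le> 12 * ennreal (poisson R z t)" for t
    using ennreal_leI[OF poisson_Harnack[OF assms(1,2), of t]] poisson_nonneg[OF assms(1), of t]
    by (simp add: ennreal_mult)
  hence "pint R g w \<le> (\<integral>\<^sup>+t. 12 * (ennreal (poisson R z t) * g t) \<partial>circ)"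
    unfolding pint_def by (intro nn_integral_mono) (simp add: mult.assoc[symmetric] mult_right_mono)
  also have "\<dots> = 12 * pint R g z" unfolding pint_def using assms(3)
    by (subst nn_integral_cmult) auto
  finally show ?thesis .
qed

lemma poisson_le: "norm w < R \<Longrightarrow> poisson R w t \<le> (R + norm w) / (R - norm w)"
proof -
  assume w: "norm w < R"
  have R: "R > 0" using w norm_ge_zero[of w] by linarith
  have d1: "norm (of_real R * cis t - w) \<ge> R - norm w"
    using norm_triangle_ineq2[of "of_real R * cis t" w] R by (simp add: norm_mult)
  have "poisson R w t \<le> (R\<^sup>2 - (norm w)\<^sup>2) / (R - norm w)\<^sup>2"
    unfolding poisson_def using d1 w by (intro divide_left_mono power_mono mult_pos_pos) 
      (auto intro: power_mono simp: circle_ne)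
  also have "R\<^sup>2 - (norm w)\<^sup>2 = (R + norm w) * (R - norm w)" by (simp add: power2_eq_square algebra_simps)
  also have "(R + norm w) * (R - norm w) / (R - norm w)\<^sup>2 = (R + norm w) / (R - norm w)"
    using w by (simp add: power2_eq_square)
  finally show ?thesis .
qed

text \<open>As a function of \<open>w\<close> the kernel is the real part of
  \<open>(u + w) / (u - w)\<close>, so its composition with \<phi> is harmonic and the mean value
  property applies.\<close>

lemma poisson_compose_mean:
  assumes "\<phi> holomorphic_on unit_disc" "0 \<le> r" "r < 1" "\<And>z. norm z \<le> r \<Longrightarrow> norm (\<phi> z) < R"
  shows "((\<lambda>s. poisson R (\<phi> (of_real r * cis s)) t) has_integral 2 * pi * poisson R (\<phi> 0) t) {0..2*pi}"
proof -
  define u where "u = of_real R * cis t"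
  have R: "R > 0" using assms(4)[of 0] assms(2) norm_ge_zero[of "\<phi> 0"] by (smt (verit) norm_zero)
  have u: "norm u = R" using R by (simp add: u_def norm_mult)
  have eq: "poisson R w t = Re ((u + w) / (u - w))" if "norm w < R" for w
  proof -
    have "(u + w) / (u - w) = ((u + w) * cnj (u - w)) / (u - w) / cnj (u - w)"
    proof -
      have "cnj (u - w) \<noteq> 0" using circle_ne[OF that, of t] unfolding u_def complex_cnj_zero_iff by simp
      thus ?thesis by (metis (no_types) divide_divide_eq_left mult.commute nonzero_mult_divide_mult_cancel_left)
    qed
    also have "\<dots> = ((u + w) * cnj (u - w)) / of_real ((norm (u - w))\<^sup>2)"
      using complex_norm_square[of "u - w"] by simp
    finally have "Re ((u + w) / (u - w)) = Re ((u + w) * cnj (u - w)) / (norm (u - w))\<^sup>2"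
      by (simp only: Re_divide_of_real)
    also have "Re ((u + w) * cnj (u - w)) = (norm u)\<^sup>2 - (norm w)\<^sup>2"
      by (simp only: cmod_power2) (simp add: power2_eq_square algebra_simps)
    finally show ?thesis using u by (simp add: poisson_def u_def)
  qed
  have ne: "u - \<phi> z \<noteq> 0" if "norm z \<le> r" for z
    using circle_ne[OF assms(4)[OF that], of t] by (simp add: u_def)
  have sub: "cball 0 r \<subseteq> unit_disc" using assms(3) by auto
  have "((\<lambda>s. (u + \<phi> (of_real r * cis s)) / (u - \<phi> (of_real r * cis s))) has_integral
      2 * of_real pi * ((u + \<phi> 0) / (u - \<phi> 0))) {0..2*pi}"
  proof (rule circle_mean_value)
    show "continuous_on (cball 0 r) (\<lambda>z. (u + \<phi> z) / (u - \<phi> z))"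
      using ne by (intro continuous_intros holomorphic_on_imp_continuous_on holomorphic_on_subset[OF assms(1) sub]) auto
    show "(\<lambda>z. (u + \<phi> z) / (u - \<phi> z)) holomorphic_on ball 0 r"
      using ne sub by (intro holomorphic_intros holomorphic_on_subset[OF assms(1)]) auto
  qed fact
  moreover have "Re (2 * of_real pi * c) = 2 * pi * Re c" for c :: complex by simp
  ultimately have "((\<lambda>s. Re ((u + \<phi> (of_real r * cis s)) / (u - \<phi> (of_real r * cis s)))) has_integral
      2 * pi * Re ((u + \<phi> 0) / (u - \<phi> 0))) {0..2*pi}"
    using has_integral_Re by metis
  thus ?thesis
    using eq assms(2,3,4) by (simp add: eq norm_mult)
qed

text \<open>Littlewood's subordination principle in quantitative form. Exchanging the two
  integrations leaves the mean of the kernel along the image of the circle, which is the kernel at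
  \<open>\<phi> 0\<close>; that value is bounded by the displayed quotient.\<close>

lemma cmean_pint_compose:
  assumes phi: "\<phi> holomorphic_on unit_disc" "0 \<le> r" "r < 1" "\<And>z. norm z \<le> r \<Longrightarrow> norm (\<phi> z) < R"
    and g[measurable]: "g \<in> borel_measurable borel"
  shows "cmean p (\<lambda>s. pint R g (\<phi> (of_real r * cis s))) \<le>
           ennreal ((R + norm (\<phi> 0)) / (R - norm (\<phi> 0))) * cmean p g"
proof (cases "p = \<infinity>")
  case True
  have 0: "norm (\<phi> 0) < R" using phi(2,4) by simp
  have "cmean p (\<lambda>s. pint R g (\<phi> (of_real r * cis s))) \<le> cmean p g"
    by (rule cmean_bound) (use True phi pint_le_cmean_inf g in \<open>auto simp: norm_mult\<close>)
  also have "\<dots> = ennreal 1 * cmean p g" by simp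
  also have "\<dots> \<le> ennreal ((R + norm (\<phi> 0)) / (R - norm (\<phi> 0))) * cmean p g"
    by (intro mult_right_mono ennreal_leI) (use 0 in \<open>auto simp: field_simps\<close>)
  finally show ?thesis .
next
  case False
  have 0: "norm (\<phi> 0) < R" using phi(2,4) by simp
  have cphi: "continuous_on UNIV (\<lambda>s. \<phi> (of_real r * cis s))"
    by (rule continuous_on_compose2[OF holomorphic_on_imp_continuous_on[OF phi(1)]])
       (use phi in \<open>auto intro!: continuous_intros simp: norm_mult\<close>)
  hence [measurable]: "(\<lambda>s. \<phi> (of_real r * cis s)) \<in> borel_measurable borel"
    by (rule borel_measurable_continuous_onI)
  have lt: "norm (\<phi> (of_real r * cis s)) < R" for s using phi by (auto simp: norm_mult)
  interpret C: sigma_finite_measure circ by (rule sigma_finite_circ)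
  interpret P: pair_sigma_finite circ circ ..
  have "cmean p (\<lambda>s. pint R g (\<phi> (of_real r * cis s))) =
     (\<integral>\<^sup>+s. \<integral>\<^sup>+t. ennreal (poisson R (\<phi> (of_real r * cis s)) t) * g t \<partial>circ \<partial>circ)"
    using False by (simp add: cmean_def pint_def)
  also have "\<dots> = (\<integral>\<^sup>+t. \<integral>\<^sup>+s. ennreal (poisson R (\<phi> (of_real r * cis s)) t) * g t \<partial>circ \<partial>circ)"
    by (rule P.Fubini'[symmetric]) measurable
  also have "\<dots> \<le> (\<integral>\<^sup>+t. ennreal ((R + norm (\<phi> 0)) / (R - norm (\<phi> 0))) * g t \<partial>circ)"
  proof (rule nn_integral_mono)
    fix t
    have "(\<integral>\<^sup>+s. ennreal (poisson R (\<phi> (of_real r * cis s)) t) * g t \<partial>circ) =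
          (\<integral>\<^sup>+s. ennreal (poisson R (\<phi> (of_real r * cis s)) t) \<partial>circ) * g t"
      by (rule nn_integral_multc) measurable
    also have "(\<integral>\<^sup>+s. ennreal (poisson R (\<phi> (of_real r * cis s)) t) \<partial>circ) =
       ennreal (integral {0..2*pi} (\<lambda>s. poisson R (\<phi> (of_real r * cis s)) t) / (2*pi))"
    proof (rule nn_integral_circ)
      show "continuous_on {0..2*pi} (\<lambda>s. poisson R (\<phi> (of_real r * cis s)) t)"
        unfolding poisson_def using circle_ne[OF lt]
        by (intro continuous_intros continuous_on_subset[OF cphi]) auto
    qed (use poisson_nonneg lt in auto)
    also have "\<dots> = ennreal (poisson R (\<phi> 0) t)"
      using integral_unique[OF poisson_compose_mean[OF phi, of t]] by simp
    finally show "(\<integral>\<^sup>+s. ennreal (poisson R (\<phi> (of_real r * cis s)) t) * g t \<partial>circ) \<le>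
        ennreal ((R + norm (\<phi> 0)) / (R - norm (\<phi> 0))) * g t"
      using poisson_le[OF 0, of t] by (simp add: mult_right_mono ennreal_leI)
  qed
  also have "\<dots> = ennreal ((R + norm (\<phi> 0)) / (R - norm (\<phi> 0))) * cmean p g"
    using False by (simp add: cmean_def nn_integral_cmult)
  finally show ?thesis .
qed

section \<open>Integral means and the mixed norms\<close>

text \<open>For \<open>p = \<infinity>\<close> the circular mean is a supremum and the exponent is set to 1, so that both cases are
  governed by \<open>cmean p (norm f powr qexp p)\<close>; \<open>eexp p\<close> stands for \<open>1 / p\<close>.\<close>

definition qexp :: "ereal \<Rightarrow> real" where
  "qexp p = (if p = \<infinity> then 1 else real_of_ereal p)"

definition eexp :: "ereal \<Rightarrow> real" where
  "eexp p = (if p = \<infinity> then 0 else 1 / real_of_ereal p)"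

lemma qexp_pos: "0 < p \<Longrightarrow> 0 < qexp p"
  unfolding qexp_def by (cases p) auto

lemma eexp_nonneg: "0 < p \<Longrightarrow> 0 \<le> eexp p"
  unfolding eexp_def by (cases p) auto

lemma eexp_qexp: "0 < p \<Longrightarrow> eexp p * qexp p = (if p = \<infinity> then 0 else 1)"
  unfolding eexp_def qexp_def by (cases p) auto

definition pmean :: "ereal \<Rightarrow> real \<Rightarrow> (complex \<Rightarrow> complex) \<Rightarrow> ennreal" where
  "pmean p r f = cmean p (\<lambda>t. ennreal (norm (f (of_real r * cis t)) powr qexp p))"

text \<open>By \<open>wmean_eq\<close> this is the \<open>qexp p\<close>-th power of the quantity
  whose supremum is \<open>Hnorm\<close>. Powers are additive under averaging, roots are
  not.\<close>

definition wmean :: "ereal \<Rightarrow> real \<Rightarrow> real \<Rightarrow> (complex \<Rightarrow> complex) \<Rightarrow> ennreal" where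
  "wmean p \<alpha> r f = ennreal ((1 - r) powr (\<alpha> * qexp p)) * pmean p r f"

lemma continuous_circle:
  assumes "continuous_on unit_disc f" "0 \<le> r" "r < 1"
  shows "continuous_on A (\<lambda>t. f (of_real r * cis t))"
  by (rule continuous_on_compose2[OF assms(1)])
     (use assms in \<open>auto intro!: continuous_intros simp: norm_mult\<close>)

lemma measurable_circle:
  assumes "continuous_on unit_disc f" "0 \<le> r" "r < 1"
  shows "(\<lambda>t. f (of_real r * cis t)) \<in> borel_measurable borel"
  by (intro borel_measurable_continuous_onI continuous_circle assms)

lemma powr_powr_inverse: "0 < q \<Longrightarrow> 0 \<le> x \<Longrightarrow> (x powr (1/q)) powr q = (x::real)"
  by (simp add: powr_powr)

lemma powr_powr_inverse': "0 < q \<Longrightarrow> 0 \<le> x \<Longrightarrow> (x powr q) powr (1/q) = (x::real)"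
  by (simp add: powr_powr)

lemma powr_le_iff: "0 < q \<Longrightarrow> 0 \<le> x \<Longrightarrow> 0 \<le> y \<Longrightarrow> x powr q \<le> y powr q \<longleftrightarrow> x \<le> (y::real)"
  by (meson linorder_not_le powr_less_mono2 powr_mono2 less_imp_le)

lemma Mp_nonneg:
  assumes "0 < p" "continuous_on unit_disc f" "0 \<le> r" "r < 1"
  shows "0 \<le> Mp p r f"
proof (cases "p = \<infinity>")
  case True
  have "bdd_above ((\<lambda>t. norm (f (of_real r * cis t))) ` {0..2*pi})"
    by (intro bounded_imp_bdd_above compact_imp_bounded compact_continuous_image
         continuous_intros continuous_circle assms) auto
  hence "norm (f (of_real r * cis 0)) \<le> (SUP t\<in>{0..2*pi}. norm (f (of_real r * cis t)))"
    by (intro cSUP_upper) auto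
  from order_trans[OF norm_ge_zero this] show ?thesis using True unfolding Mp_def by simp
next
  case False
  thus ?thesis unfolding Mp_def by simp
qed

lemma pmean_eq:
  assumes p: "0 < p" and f: "continuous_on unit_disc f" "0 \<le> r" "r < 1"
  shows "pmean p r f = ennreal (Mp p r f powr qexp p)"
proof (cases "p = \<infinity>")
  case True
  let ?g = "\<lambda>t. norm (f (of_real r * cis t))"
  have "continuous_on {0..2*pi} ?g" by (intro continuous_intros continuous_circle f)
  \<comment> \<open>The maximum is attained, so the real supremum in \<open>Mp\<close> and the
    \<open>ennreal\<close> supremum in \<open>cmean\<close> agree.\<close>
  then obtain t0 where t0: "t0 \<in> {0..2*pi}" "\<And>t. t \<in> {0..2*pi} \<Longrightarrow> ?g t \<le> ?g t0"
    using continuous_attains_sup[of "{0..2*pi}" ?g] by auto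
  have "(SUP t\<in>{0..2*pi}. ?g t) = ?g t0"
    by (rule cSup_eq_maximum) (use t0 in auto)
  moreover have "(SUP t\<in>{0..2*pi}. ennreal (?g t)) = ennreal (?g t0)"
    by (intro antisym SUP_least ennreal_leI t0 SUP_upper2[OF t0(1)]) auto
  ultimately show ?thesis using True by (simp add: pmean_def cmean_def Mp_def qexp_def)
next
  case False
  hence q: "qexp p = real_of_ereal p" by (simp add: qexp_def)
  have q0: "0 < qexp p" by (rule qexp_pos) fact
  let ?g = "\<lambda>t. norm (f (of_real r * cis t)) powr qexp p"
  have c: "continuous_on A ?g" for A
    using q0 by (intro continuous_on_powr' continuous_intros continuous_circle f) auto
  have "pmean p r f = ennreal (integral {0..2*pi} ?g / (2*pi))"
    using False unfolding pmean_def cmean_def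
    by (simp, intro nn_integral_circ borel_measurable_continuous_onI c) auto
  moreover have "integral {0..2*pi} ?g \<ge> 0"
    by (intro integral_nonneg integrable_continuous_real c) auto
  ultimately show ?thesis using False q q0
    by (simp add: Mp_def powr_powr)
qed

lemma wmean_eq:
  assumes p: "0 < p" and f: "continuous_on unit_disc f" "0 \<le> r" "r < 1"
  shows "wmean p \<alpha> r f = ennreal (((1 - r) powr \<alpha> * Mp p r f) powr qexp p)"
  using Mp_nonneg[OF assms] f(3)
  by (simp add: wmean_def pmean_eq[OF assms] powr_mult powr_powr ennreal_mult)

lemma wmean_le_iff:
  assumes p: "0 < p" and f: "continuous_on unit_disc f" "0 \<le> r" "r < 1" and c: "0 \<le> c"
  shows "wmean p \<alpha> r f \<le> ennreal (c powr qexp p) \<longleftrightarrow> (1 - r) powr \<alpha> * Mp p r f \<le> c"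
  unfolding wmean_eq[OF assms(1-4)] using Mp_nonneg[OF assms(1-4)] c qexp_pos[OF p]
  by (simp add: powr_le_iff ennreal_le_iff)

lemma Hnorm_le_iff:
  assumes p: "0 < p" and f: "continuous_on unit_disc f" and c: "0 \<le> c"
  shows "Hnorm p \<alpha> f \<le> ennreal c \<longleftrightarrow> (\<forall>r\<in>{0..<1}. wmean p \<alpha> r f \<le> ennreal (c powr qexp p))"
  unfolding Hnorm_def SUP_le_iff using wmean_le_iff[OF p f _ _ c] c
  by (auto simp: ennreal_le_iff)

lemma H_inf_iff:
  assumes p: "0 < p"
  shows "f \<in> H_inf p \<alpha> \<longleftrightarrow> f holomorphic_on unit_disc \<and> (\<exists>c\<ge>0. \<forall>r\<in>{0..<1}. wmean p \<alpha> r f \<le> ennreal c)"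
proof (cases "f holomorphic_on unit_disc")
  case True
  hence f: "continuous_on unit_disc f" by (rule holomorphic_on_imp_continuous_on)
  have q: "qexp p > 0" by (rule qexp_pos[OF p])
  have "Hnorm p \<alpha> f < \<infinity> \<longleftrightarrow> (\<exists>c\<ge>0. Hnorm p \<alpha> f \<le> ennreal c)"
    by (metis ennreal_less_top infinity_ennreal_def le_less_trans less_top_ennreal order_refl)
  also have "\<dots> \<longleftrightarrow> (\<exists>c\<ge>0. \<forall>r\<in>{0..<1}. wmean p \<alpha> r f \<le> ennreal (c powr qexp p))"
    using Hnorm_le_iff[OF p f] by blast
  also have "\<dots> \<longleftrightarrow> (\<exists>c\<ge>0. \<forall>r\<in>{0..<1}. wmean p \<alpha> r f \<le> ennreal c)"
    by (metis powr_ge_zero powr_powr_inverse[OF q])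
  finally show ?thesis using True by (simp add: H_inf_def)
qed (simp add: H_inf_def)

lemma powr_ge_one_bound: "0 \<le> r \<Longrightarrow> r < 1 \<Longrightarrow> 0 \<le> a \<Longrightarrow> (1 - r) powr a \<le> 1" for r a :: real
  using powr_mono2[of a "1 - r" 1] by simp

lemma wmean_le_sup:
  assumes p: "0 < p" "0 \<le> \<alpha>" "0 \<le> r" "r < 1" and B: "\<And>z. norm z = r \<Longrightarrow> norm (f z) \<le> B"
  shows "wmean p \<alpha> r f \<le> ennreal (B powr qexp p)"
proof -
  have "pmean p r f \<le> ennreal (B powr qexp p)" unfolding pmean_def
    using B p qexp_pos[OF p(1)] by (intro cmean_bound ennreal_leI powr_mono2) (auto simp: norm_mult)
  moreover have "ennreal ((1 - r) powr (\<alpha> * qexp p)) \<le> 1"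
    using powr_ge_one_bound[OF p(3,4), of "\<alpha> * qexp p"] p qexp_pos[OF p(1)]
    by (simp add: ennreal_le_1)
  ultimately show ?thesis unfolding wmean_def
    using mult_mono[of "ennreal ((1 - r) powr (\<alpha> * qexp p))" 1] by fastforce
qed

lemma bounded_on_cball:
  assumes "continuous_on unit_disc (f :: complex \<Rightarrow> complex)" "r < 1"
  obtains B where "0 \<le> B" "\<And>z. norm z \<le> r \<Longrightarrow> norm (f z) \<le> B"
proof -
  have "compact (f ` cball 0 r)"
    by (intro compact_continuous_image continuous_on_subset[OF assms(1)]) (use assms in auto)
  hence "bounded (f ` cball 0 r)" by (rule compact_imp_bounded)
  then obtain B where "\<And>x. x \<in> f ` cball 0 r \<Longrightarrow> norm x \<le> B" unfolding bounded_iff by blast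
  hence "norm z \<le> r \<Longrightarrow> norm (f z) \<le> max 0 B" for z by (fastforce simp: le_max_iff_disj)
  thus thesis by (intro that[of "max 0 B"]) auto
qed

text \<open>The bound contained in \<open>H_inf\<close> is recovered from the decay near radius 1
  together with compactness of the remaining disc.\<close>

lemma H_zero_iff:
  assumes p: "0 < p" "0 < \<alpha>"
  shows "f \<in> H_zero p \<alpha> \<longleftrightarrow> f holomorphic_on unit_disc \<and>
     (\<forall>e>0. \<exists>r0<1. \<forall>r. r0 < r \<and> 0 \<le> r \<and> r < 1 \<longrightarrow> wmean p \<alpha> r f \<le> ennreal e)"
proof (cases "f holomorphic_on unit_disc")
  case True
  hence f: "continuous_on unit_disc f" by (rule holomorphic_on_imp_continuous_on)
  have q: "qexp p > 0" by (rule qexp_pos[OF p(1)])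
  let ?X = "\<lambda>r. (1 - r) powr \<alpha> * Mp p r f"
  let ?E = "\<forall>e>0. \<exists>r0<1. \<forall>r. r0 < r \<and> 0 \<le> r \<and> r < 1 \<longrightarrow> wmean p \<alpha> r f \<le> ennreal e"
  have X0: "0 \<le> ?X r" if "0 \<le> r" "r < 1" for r using Mp_nonneg[OF p(1) f that] by simp
  have "f \<in> H_inf p \<alpha>" if E: ?E
  proof -
    from E obtain r0 where r0: "r0 < 1" "\<And>r. r0 < r \<Longrightarrow> 0 \<le> r \<Longrightarrow> r < 1 \<Longrightarrow> wmean p \<alpha> r f \<le> ennreal 1"
      by (meson zero_less_one)
    obtain B where B: "0 \<le> B" "\<And>z. norm z \<le> r0 \<Longrightarrow> norm (f z) \<le> B" using bounded_on_cball[OF f r0(1)] by blast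
    have "wmean p \<alpha> r f \<le> ennreal (max 1 (B powr qexp p))" if "r \<in> {0..<1}" for r
    proof (cases "r \<le> r0")
      case True
      have "wmean p \<alpha> r f \<le> ennreal (B powr qexp p)"
        by (rule wmean_le_sup) (use p that B True in auto)
      thus ?thesis by (rule order_trans) (auto intro: ennreal_leI)
    next
      case False
      hence "wmean p \<alpha> r f \<le> ennreal 1" using r0 that by auto
      thus ?thesis by (rule order_trans) (auto intro: ennreal_leI)
    qed
    thus ?thesis unfolding H_inf_iff[OF p(1)] using True by (auto intro!: exI[of _ "max 1 (B powr qexp p)"])
  qed
  moreover have "(?X \<longlongrightarrow> 0) (at_left 1) \<longleftrightarrow> ?E"
  proof
    assume *: "(?X \<longlongrightarrow> 0) (at_left 1)"
    show ?E
    proof (intro allI impI)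
      fix e :: real assume e: "e > 0"
      hence "eventually (\<lambda>r. ?X r < e powr (1 / qexp p)) (at_left 1)"
        using order_tendstoD(2)[OF *] by simp
      then obtain r0 where r0: "r0 < 1" "\<And>r. r0 < r \<Longrightarrow> r < 1 \<Longrightarrow> ?X r < e powr (1 / qexp p)"
        unfolding eventually_at_left_field by blast
      have "wmean p \<alpha> r f \<le> ennreal e" if "r0 < r" "0 \<le> r" "r < 1" for r
        using wmean_le_iff[OF p(1) f that(2,3), of "e powr (1 / qexp p)" \<alpha>] r0(2)[OF that(1,3)]
           powr_powr_inverse[OF q, of e] e by simp
      thus "\<exists>r0<1. \<forall>r. r0 < r \<and> 0 \<le> r \<and> r < 1 \<longrightarrow> wmean p \<alpha> r f \<le> ennreal e" using r0(1) by blast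
    qed
  next
    assume E: ?E
    show "(?X \<longlongrightarrow> 0) (at_left 1)"
    proof (rule tendstoI)
      fix e :: real assume e: "e > 0"
      then obtain r0 where r0: "r0 < 1" "\<And>r. r0 < r \<Longrightarrow> 0 \<le> r \<Longrightarrow> r < 1 \<Longrightarrow> wmean p \<alpha> r f \<le> ennreal ((e/2) powr qexp p)"
        using E by (metis half_gt_zero powr_gt_zero less_numeral_extra(3))
      have "dist (?X r) 0 < e" if "max r0 0 < r" "r < 1" for r
        using wmean_le_iff[OF p(1) f _ that(2), of "e/2" \<alpha>] r0(2)[of r] X0[of r] e that by simp
      thus "eventually (\<lambda>r. dist (?X r) 0 < e) (at_left 1)"
        unfolding eventually_at_left_field using r0(1) by (intro exI[of _ "max r0 0"]) auto
    qed
  qed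
  ultimately show ?thesis using True by (auto simp: H_zero_def)
qed (simp add: H_zero_def H_inf_def)

lemma ennreal_tendsto_0_iff:
  "((u :: 'a \<Rightarrow> ennreal) \<longlongrightarrow> 0) F \<longleftrightarrow> (\<forall>e>0. eventually (\<lambda>t. u t \<le> ennreal e) F)"
proof
  assume *: "(u \<longlongrightarrow> 0) F"
  show "\<forall>e>0. eventually (\<lambda>t. u t \<le> ennreal e) F"
  proof (intro allI impI)
    fix e :: real assume "e > 0"
    hence "eventually (\<lambda>t. u t < ennreal e) F" using order_tendstoD(2)[OF *, of "ennreal e"] by simp
    thus "eventually (\<lambda>t. u t \<le> ennreal e) F" by (rule eventually_mono) (rule less_imp_le)
  qed
next
  assume *: "\<forall>e>0. eventually (\<lambda>t. u t \<le> ennreal e) F"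
  show "(u \<longlongrightarrow> 0) F"
  proof (rule order_tendstoI)
    fix a :: ennreal assume "0 < a"
    then obtain e where e: "0 < e" "ennreal e < a"
      by (metis dense ennreal_less_zero_iff ennreal_zero_less_top less_top_ennreal not_less_iff_gr_or_eq order_less_trans ennreal_cases top_greatest linorder_not_le)
    thus "eventually (\<lambda>x. u x < a) F" using * by (auto elim!: eventually_mono)
  qed simp
qed

lemma Hnorm_tendsto_0_iff:
  assumes p: "0 < p" and f: "eventually (\<lambda>t. continuous_on unit_disc (f t)) F"
  shows "((\<lambda>t. Hnorm p \<alpha> (f t)) \<longlongrightarrow> 0) F \<longleftrightarrow>
     (\<forall>e>0. eventually (\<lambda>t. \<forall>r\<in>{0..<1}. wmean p \<alpha> r (f t) \<le> ennreal e) F)"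
  unfolding ennreal_tendsto_0_iff
proof (intro iffI allI impI)
  have q: "qexp p > 0" by (rule qexp_pos[OF p(1)])
  fix e :: real assume e: "e > 0"
  {
    assume *: "\<forall>e>0. eventually (\<lambda>t. Hnorm p \<alpha> (f t) \<le> ennreal e) F"
    have "eventually (\<lambda>t. Hnorm p \<alpha> (f t) \<le> ennreal (e powr (1 / qexp p))) F" using * e by simp
    with f show "eventually (\<lambda>t. \<forall>r\<in>{0..<1}. wmean p \<alpha> r (f t) \<le> ennreal e) F"
      by eventually_elim (use Hnorm_le_iff[OF p, where c = "e powr (1 / qexp p)"] e powr_powr_inverse[OF q, of e] in simp)
  next
    assume *: "\<forall>e>0. eventually (\<lambda>t. \<forall>r\<in>{0..<1}. wmean p \<alpha> r (f t) \<le> ennreal e) F"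
    have "eventually (\<lambda>t. \<forall>r\<in>{0..<1}. wmean p \<alpha> r (f t) \<le> ennreal (e powr qexp p)) F" using * e by simp
    with f show "eventually (\<lambda>t. Hnorm p \<alpha> (f t) \<le> ennreal e) F"
      by eventually_elim (use Hnorm_le_iff[OF p] e in simp)
  }
qed

lemma powr_add_le:
  fixes a b q :: real
  assumes "0 \<le> a" "0 \<le> b" "0 < q" shows "(a + b) powr q \<le> 2 powr q * (a powr q + b powr q)"
proof -
  have "(a + b) powr q \<le> (2 * max a b) powr q" using assms by (intro powr_mono2) auto
  also have "\<dots> = 2 powr q * max a b powr q" using assms by (simp add: powr_mult)
  also have "\<dots> \<le> 2 powr q * (a powr q + b powr q)"
    by (intro mult_left_mono) (auto simp: max_def)
  finally show ?thesis .
qed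

text \<open>The main term keeps a constant as close to 1 as desired; the factor
  \<open>2 powr q\<close> of \<open>powr_add_le\<close> would destroy the contraction in
  \<open>strong_cont_subset_H_zero\<close>. With \<open>m\<close> such that
  \<open>(1 + m) powr q = l\<close>, either \<open>b\<close> is at most \<open>m * a\<close>, or
  \<open>a\<close> is at most \<open>b / m\<close>.\<close>

lemma powr_add_le_weighted:
  fixes q l :: real
  assumes q: "0 < q" and l: "1 < l"
  obtains C where "0 \<le> C" "\<And>a b. 0 \<le> a \<Longrightarrow> 0 \<le> b \<Longrightarrow> (a + b) powr q \<le> l * a powr q + C * b powr q"
proof -
  define m where "m = l powr (1/q) - 1"
  have m: "m > 0" unfolding m_def using q l by simp
  have lm: "(1 + m) powr q = l" unfolding m_def using q l by (simp add: powr_powr)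
  show thesis
  proof (rule that[of "(1 + 1/m) powr q"])
    fix a b :: real assume ab: "0 \<le> a" "0 \<le> b"
    show "(a + b) powr q \<le> l * a powr q + (1 + 1/m) powr q * b powr q"
    proof (cases "b \<le> m * a")
      case True
      have "(a + b) powr q \<le> ((1 + m) * a) powr q"
        using True ab q by (intro powr_mono2) (auto simp: algebra_simps)
      also have "\<dots> = l * a powr q" using ab m lm by (simp add: powr_mult)
      finally show ?thesis by (smt (verit) mult_nonneg_nonneg powr_ge_zero)
    next
      case False
      hence "a \<le> b / m" using m by (simp add: field_simps)
      hence "(a + b) powr q \<le> ((1 + 1/m) * b) powr q"
        using ab q by (intro powr_mono2) (auto simp: algebra_simps)
      also have "\<dots> = (1 + 1/m) powr q * b powr q" using ab m by (simp add: powr_mult)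
      finally show ?thesis using l by (smt (verit) mult_nonneg_nonneg powr_ge_zero)
    qed
  qed simp
qed

lemma pmean_add_le:
  assumes p: "0 < p" and f: "continuous_on unit_disc f" "continuous_on unit_disc g" and r: "0 \<le> r" "r < 1"
    and h: "\<And>t. norm (h (of_real r * cis t)) \<le> norm (f (of_real r * cis t)) + norm (g (of_real r * cis t))"
  shows "pmean p r h \<le> ennreal (2 powr qexp p) * (pmean p r f + pmean p r g)"
proof -
  note [measurable] = measurable_circle[OF f(1) r] measurable_circle[OF f(2) r]
  have q: "qexp p > 0" by (rule qexp_pos[OF p(1)])
  have "pmean p r h \<le> cmean p (\<lambda>t. ennreal (2 powr qexp p) * (ennreal (norm (f (of_real r * cis t)) powr qexp p) + ennreal (norm (g (of_real r * cis t)) powr qexp p)))"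
    unfolding pmean_def
  proof (rule cmean_mono)
    fix t
    let ?z = "of_real r * cis t"
    have "norm (h ?z) powr qexp p \<le> (norm (f ?z) + norm (g ?z)) powr qexp p"
      using h q by (intro powr_mono2) auto
    also have "\<dots> \<le> 2 powr qexp p * (norm (f ?z) powr qexp p + norm (g ?z) powr qexp p)"
      using q by (intro powr_add_le) auto
    finally have "ennreal (norm (h ?z) powr qexp p) \<le> ennreal (2 powr qexp p * (norm (f ?z) powr qexp p + norm (g ?z) powr qexp p))"
      by (rule ennreal_leI)
    thus "ennreal (norm (h ?z) powr qexp p) \<le> ennreal (2 powr qexp p) * (ennreal (norm (f ?z) powr qexp p) + ennreal (norm (g ?z) powr qexp p))"
      by (simp add: ennreal_mult)
  qed
  also have "\<dots> = ennreal (2 powr qexp p) * cmean p (\<lambda>t. ennreal (norm (f (of_real r * cis t)) powr qexp p) + ennreal (norm (g (of_real r * cis t)) powr qexp p))"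
    by (rule cmean_cmult) measurable
  also have "\<dots> \<le> ennreal (2 powr qexp p) * (pmean p r f + pmean p r g)"
    unfolding pmean_def by (intro mult_left_mono cmean_add_le) auto
  finally show ?thesis .
qed

lemma wmean_add_le:
  assumes p: "0 < p" and f: "continuous_on unit_disc f" "continuous_on unit_disc g" and r: "0 \<le> r" "r < 1"
    and h: "\<And>t. norm (h (of_real r * cis t)) \<le> norm (f (of_real r * cis t)) + norm (g (of_real r * cis t))"
  shows "wmean p \<alpha> r h \<le> ennreal (2 powr qexp p) * (wmean p \<alpha> r f + wmean p \<alpha> r g)"
  using mult_left_mono[OF pmean_add_le[OF assms], of "ennreal ((1 - r) powr (\<alpha> * qexp p))"]
  unfolding wmean_def by (simp add: algebra_simps)

text \<open>\<open>|f|^q\<close> is at most its Poisson integral over the circle of radius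
  \<open>R\<close>, and the subordination estimate applies to that integral. The displacement of the
  origin by \<phi> costs the constant factor.\<close>

lemma pmean_compose_le:
  assumes p: "0 < p" and f: "f holomorphic_on unit_disc"
    and phi: "\<phi> holomorphic_on unit_disc" "0 \<le> r" "r < 1" "\<And>z. norm z \<le> r \<Longrightarrow> norm (\<phi> z) < R" and R: "R < 1"
  shows "pmean p r (\<lambda>z. f (\<phi> z)) \<le> ennreal ((R + norm (\<phi> 0)) / (R - norm (\<phi> 0))) * pmean p R f"
proof -
  have R0: "0 \<le> R" using phi(4)[of 0] phi(2) norm_ge_zero[of "\<phi> 0"] by (smt (verit) norm_zero)
  have fc: "continuous_on unit_disc f" using f by (rule holomorphic_on_imp_continuous_on)
  have sub: "cball 0 R \<subseteq> unit_disc" "ball 0 R \<subseteq> unit_disc" using R by auto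
  note [measurable] = measurable_circle[OF fc R0 R]
  have "pmean p r (\<lambda>z. f (\<phi> z)) \<le> cmean p (\<lambda>s. pint R (\<lambda>t. ennreal (norm (f (of_real R * cis t)) powr qexp p)) (\<phi> (of_real r * cis s)))"
    unfolding pmean_def
    by (intro cmean_mono norm_powr_le_pint continuous_on_subset[OF fc] holomorphic_on_subset[OF f] sub
          qexp_pos p phi(4)) (use phi(2) in \<open>auto simp: norm_mult\<close>)
  also have "\<dots> \<le> ennreal ((R + norm (\<phi> 0)) / (R - norm (\<phi> 0))) * pmean p R f"
    unfolding pmean_def by (intro cmean_pint_compose phi) auto
  finally show ?thesis .
qed

text \<open>The circle halfway between \<open>w\<close> and the boundary is used. For finite
  \<open>p\<close> the Poisson kernel there is at most \<open>4 / (1 - norm w)\<close>, which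
  accounts for the extra exponent 1/p; the weights at the two radii differ by a power of 2.\<close>

lemma point_evaluation:
  assumes p: "0 < p" and f: "f holomorphic_on unit_disc" and w: "norm w < 1"
  shows "ennreal ((norm (f w) * (1 - norm w) powr (\<alpha> + eexp p)) powr qexp p) \<le>
     ennreal (4 * 2 powr (\<alpha> * qexp p)) * wmean p \<alpha> ((1 + norm w) / 2) f"
proof -
  define R where "R = (1 + norm w) / 2"
  have R: "0 \<le> R" "R < 1" "norm w < R" and RR: "1 - R = (1 - norm w) / 2" "R - norm w = (1 - norm w) / 2"
    using w by (auto simp: R_def field_simps)
  have fc: "continuous_on unit_disc f" using f by (rule holomorphic_on_imp_continuous_on)
  have sub: "cball 0 R \<subseteq> unit_disc" "ball 0 R \<subseteq> unit_disc" using R by auto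
  note [measurable] = measurable_circle[OF fc R(1,2)]
  let ?g = "\<lambda>t. ennreal (norm (f (of_real R * cis t)) powr qexp p)"
  have q: "qexp p > 0" by (rule qexp_pos[OF p(1)])
  have 1: "ennreal (norm (f w) powr qexp p) \<le> pint R ?g w"
    by (intro norm_powr_le_pint continuous_on_subset[OF fc] holomorphic_on_subset[OF f] sub qexp_pos p R) measurable
  have 2: "ennreal ((1 - norm w) powr (eexp p * qexp p)) * pint R ?g w \<le> 4 * pmean p R f"
  proof (cases "p = \<infinity>")
    case True
    have "pint R ?g w \<le> cmean \<infinity> ?g" by (rule pint_le_cmean_inf[OF R(3)]) measurable
    also have "\<dots> = 1 * pmean p R f" using True by (simp add: pmean_def)
    also have "\<dots> \<le> 4 * pmean p R f" by (intro mult_right_mono) auto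
    finally show ?thesis using True w by (simp add: eexp_def)
  next
    case False
    have "pint R ?g w \<le> (\<integral>\<^sup>+t. ennreal (4 / (1 - norm w)) * ?g t \<partial>circ)"
      unfolding pint_def
    proof (intro nn_integral_mono mult_right_mono ennreal_leI)
      fix t
      have "poisson R w t \<le> (R + norm w) / (R - norm w)" by (rule poisson_le[OF R(3)])
      also have "\<dots> \<le> 2 / (R - norm w)" using R by (intro divide_right_mono) auto
      finally show "poisson R w t \<le> 4 / (1 - norm w)" using RR by simp
    qed auto
    also have "\<dots> = ennreal (4 / (1 - norm w)) * pmean p R f"
      using False by (subst nn_integral_cmult) (auto simp: pmean_def cmean_def)
    finally have "ennreal (1 - norm w) * pint R ?g w \<le> ennreal (1 - norm w) * (ennreal (4 / (1 - norm w)) * pmean p R f)"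
      by (rule mult_left_mono) simp
    also have "\<dots> = ennreal ((1 - norm w) * (4 / (1 - norm w))) * pmean p R f"
      using w by (subst ennreal_mult) (auto simp: mult.assoc simp del: times_divide_eq_right)
    also have "(1 - norm w) * (4 / (1 - norm w)) = 4"
      using w by (subst times_divide_eq_right, subst nonzero_mult_div_cancel_left) auto
    finally have "ennreal (1 - norm w) * pint R ?g w \<le> 4 * pmean p R f" by simp
    thus ?thesis using False w by (simp add: eexp_qexp[OF p])
  qed
  have "ennreal ((norm (f w) * (1 - norm w) powr (\<alpha> + eexp p)) powr qexp p) =
      ennreal ((1 - norm w) powr (\<alpha> * qexp p)) * (ennreal ((1 - norm w) powr (eexp p * qexp p)) * ennreal (norm (f w) powr qexp p))"
    using w by (simp add: powr_mult powr_powr powr_add distrib_right ennreal_mult[symmetric] mult_ac)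
  also have "\<dots> \<le> ennreal ((1 - norm w) powr (\<alpha> * qexp p)) * (ennreal ((1 - norm w) powr (eexp p * qexp p)) * pint R ?g w)"
    by (intro mult_left_mono 1) auto
  also have "\<dots> \<le> ennreal ((1 - norm w) powr (\<alpha> * qexp p)) * (4 * pmean p R f)"
    by (intro mult_left_mono 2) auto
  also have "(1 - norm w) powr (\<alpha> * qexp p) = 2 powr (\<alpha> * qexp p) * (1 - R) powr (\<alpha> * qexp p)"
  proof -
    have "1 - norm w = 2 * (1 - R)" using RR by simp
    thus ?thesis using R by (simp only: powr_mult)
  qed
  also have "ennreal (2 powr (\<alpha> * qexp p) * (1 - R) powr (\<alpha> * qexp p)) * (4 * pmean p R f) =
     ennreal (4 * 2 powr (\<alpha> * qexp p)) * wmean p \<alpha> R f"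
    by (simp add: wmean_def ennreal_mult mult_ac)
  finally show ?thesis unfolding R_def .
qed

section \<open>Schwarz--Pick, Harnack and path estimates\<close>

lemma one_minus_cnj_mult_lower: "norm (1 - cnj a * z) \<ge> 1 - norm a * norm z"
  using norm_triangle_ineq2[of 1 "cnj a * z"] by (simp add: norm_mult)

lemma one_minus_cnj_mult_upper: "norm (1 - cnj a * z) \<le> 1 + norm a * norm z"
  using norm_triangle_ineq4[of 1 "cnj a * z"] by (simp add: norm_mult)

lemma one_minus_cnj_mult_ne:
  assumes "norm a < 1" "norm z < 1" shows "1 - cnj a * z \<noteq> 0"
proof -
  have "norm a * norm z < 1" using mult_strict_mono'[OF assms] by simp
  thus ?thesis using one_minus_cnj_mult_lower[of a z] by force
qed

lemma one_minus_norm_Moebius: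
  assumes "norm a < 1" "norm z < 1"
  shows "1 - (norm ((z - a) / (1 - cnj a * z)))\<^sup>2 =
    (1 - (norm a)\<^sup>2) * (1 - (norm z)\<^sup>2) / (norm (1 - cnj a * z))\<^sup>2"
proof -
  have 0: "(norm (1 - cnj a * z))\<^sup>2 > 0" using one_minus_cnj_mult_ne[OF assms] by simp
  have "(norm (1 - cnj a * z))\<^sup>2 - (norm (z - a))\<^sup>2 = (1 - (norm a)\<^sup>2) * (1 - (norm z)\<^sup>2)"
    by (simp only: cmod_power2) (simp add: power2_eq_square algebra_simps)
  thus ?thesis using 0 by (simp add: norm_divide power_divide field_simps)
qed

text \<open>Moving \<open>z\<close> to the origin by a Moebius map reduces this to the Schwarz
  lemma.\<close>

lemma Schwarz_Pick_zero:
  assumes F: "F holomorphic_on unit_disc" "\<And>u. norm u < 1 \<Longrightarrow> norm (F u) < 1"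
    and z: "norm z < 1" "F z = 0" and w: "norm w < 1"
  shows "norm (F w) \<le> norm ((w - z) / (1 - cnj z * w))"
proof -
  let ?N = "Moebius_function 0 (-z)"
  let ?x = "Moebius_function 0 z w"
  have N: "norm (?N u) < 1" if "norm u < 1" for u using Moebius_function_norm_lt_1[of "-z" u 0] z that by simp
  have "norm ((F \<circ> ?N) ?x) \<le> norm ?x"
  proof (rule Schwarz_Lemma(1))
    show "(F \<circ> ?N) holomorphic_on unit_disc"
      using z N by (intro holomorphic_on_compose_gen[OF Moebius_function_holomorphic F(1)]) auto
    show "(F \<circ> ?N) 0 = 0" using z by (simp add: Moebius_function_of_zero)
    show "norm ((F \<circ> ?N) u) < 1" if "norm u < 1" for u using F(2) N that by simp
    show "norm ?x < 1" by (rule Moebius_function_norm_lt_1) fact+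
  qed
  moreover have "?N ?x = w" by (rule Moebius_function_compose) (use z w in auto)
  ultimately show ?thesis by (simp add: Moebius_function_simple)
qed

text \<open>The Cayley transform of \<open>P + e\<close>, centred at its value at \<open>z\<close>,
  maps into the disc and vanishes at \<open>z\<close>, so Schwarz-Pick applies; the shift by
  \<open>e\<close> makes the real part strictly positive. The bound concerns the modulus rather than
  the real part because the modulus of \<open>P\<close> governs the speed of the flow.\<close>

lemma Harnack_Re_nonneg:
  assumes P: "P holomorphic_on unit_disc" "\<And>u. norm u < 1 \<Longrightarrow> 0 \<le> Re (P u)"
    and z: "norm z < 1" and w: "norm w < 1"
    and rho: "norm ((w - z) / (1 - cnj z * w)) \<le> \<rho>" "\<rho> < 1"
  shows "(1 - \<rho>) * norm (P w) \<le> (1 + \<rho>) * norm (P z)"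
proof (rule field_le_epsilon)
  fix e' :: real assume e': "0 < e'"
  define e where "e = e' / 2"
  have e: "e > 0" "2 * e = e'" using e' by (auto simp: e_def)
  have rho0: "0 \<le> \<rho>" using rho(1) norm_ge_zero order_trans by blast
  define p where "p = P z + of_real e"
  define F where "F u = (P u + of_real e - p) / (P u + of_real e + cnj p)" for u
  have Rep: "Re p > 0" using P(2)[OF z] e by (simp add: p_def)
  have pos: "Re (P u + of_real e) > 0" if "norm u < 1" for u using P(2)[OF that] e by simp
  have ne: "P u + of_real e + cnj p \<noteq> 0" if "norm u < 1" for u
    using pos[OF that] Rep by (metis add_pos_pos cnj.sel(1) less_irrefl plus_complex.sel(1) zero_complex.sel(1))
  have lt: "norm (x - p) < norm (x + cnj p)" if "Re x > 0" for x
  proof -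
    have "(norm (x + cnj p))\<^sup>2 - (norm (x - p))\<^sup>2 = 4 * Re x * Re p"
      by (simp only: cmod_power2) (simp add: power2_eq_square algebra_simps)
    also have "\<dots> > 0" using that Rep by simp
    finally show ?thesis by (simp add: power2_less_imp_less)
  qed
  have "norm (F w) \<le> norm ((w - z) / (1 - cnj z * w))"
  proof (rule Schwarz_Pick_zero[OF _ _ z _ w])
    show "F holomorphic_on unit_disc" unfolding F_def using ne by (intro holomorphic_intros P) auto
    show "norm (F u) < 1" if "norm u < 1" for u
      using lt[OF pos[OF that]] ne[OF that] by (simp add: F_def norm_divide)
    show "F z = 0" by (simp add: F_def p_def)
  qed
  hence "norm (F w) \<le> \<rho>" using rho by linarith
  hence "norm (P w + of_real e - p) \<le> \<rho> * norm (P w + of_real e + cnj p)"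
    using ne[OF w] by (simp add: F_def norm_divide divide_le_eq)
  also have "\<dots> \<le> \<rho> * (norm (P w + of_real e) + norm p)"
    using norm_triangle_ineq[of "P w + of_real e" "cnj p"] rho0 by (intro mult_left_mono) auto
  finally have "norm (P w + of_real e) - norm p \<le> \<rho> * (norm (P w + of_real e) + norm p)"
    using norm_triangle_ineq2[of "P w + of_real e" p] by linarith
  hence 1: "(1 - \<rho>) * norm (P w + of_real e) \<le> (1 + \<rho>) * norm p" by (simp add: algebra_simps)
  have "norm (P w) \<le> norm (P w + of_real e) + e"
    using norm_triangle_ineq4[of "P w + of_real e" "of_real e"] e by simp
  hence "(1 - \<rho>) * norm (P w) \<le> (1 - \<rho>) * (norm (P w + of_real e) + e)"
    using rho by (intro mult_left_mono) auto
  also have "\<dots> \<le> (1 + \<rho>) * norm p + (1 - \<rho>) * e" using 1 by (simp add: algebra_simps)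
  also have "\<dots> \<le> (1 + \<rho>) * (norm (P z) + e) + (1 - \<rho>) * e"
    using norm_triangle_ineq[of "P z" "of_real e"] e rho rho0 by (intro add_mono mult_left_mono) (auto simp: p_def)
  also have "\<dots> = (1 + \<rho>) * norm (P z) + e'" using e by (simp add: algebra_simps)
  finally show "(1 - \<rho>) * norm (P w) \<le> (1 + \<rho>) * norm (P z) + e'" .
qed

text \<open>Half the difference \<open>F u - F z\<close> maps into the unit disc and vanishes at
  \<open>z\<close>.\<close>

lemma self_map_Lipschitz:
  assumes F: "F holomorphic_on unit_disc" "\<And>u. norm u < 1 \<Longrightarrow> norm (F u) < 1"
    and z: "norm z < 1" and w: "norm w < 1"
  shows "norm (F w - F z) \<le> 2 * norm (w - z) / (1 - norm z)"
proof -
  define H where "H u = (F u - F z) / 2" for u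
  have "norm (H w) \<le> norm ((w - z) / (1 - cnj z * w))"
  proof (rule Schwarz_Pick_zero[OF _ _ z _ w])
    show "H holomorphic_on unit_disc" unfolding H_def by (intro holomorphic_intros F) auto
    show "norm (H u) < 1" if "norm u < 1" for u
      using norm_triangle_ineq4[of "F u" "F z"] F(2)[OF that] F(2)[OF z] by (simp add: H_def norm_divide)
  qed (simp add: H_def)
  also have "\<dots> = norm (w - z) / norm (1 - cnj z * w)" by (simp add: norm_divide)
  also have "\<dots> \<le> norm (w - z) / (1 - norm z)"
  proof (rule divide_left_mono)
    have "norm z * norm w \<le> norm z" using w by (simp add: mult_left_le)
    thus "1 - norm z \<le> norm (1 - cnj z * w)" using one_minus_cnj_mult_lower[of z w] by linarith
    show "0 < norm (1 - cnj z * w) * (1 - norm z)" using z one_minus_cnj_mult_ne[OF z w] by simp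
  qed simp
  finally show ?thesis by (simp add: H_def norm_divide field_simps)
qed

text \<open>Only a right derivative is available. For each \<open>e > 0\<close> the set of times
  \<open>s\<close> with \<open>norm (v s - v 0) \<le> e * s\<close> is closed, and its last element
  can be pushed further to the right unless it is \<open>T\<close>.\<close>

lemma right_derivative_zero_const:
  fixes v :: "real \<Rightarrow> 'a :: real_normed_vector"
  assumes c: "continuous_on {0..T} v" and T: "0 \<le> T"
    and d: "\<And>t. 0 \<le> t \<Longrightarrow> t < T \<Longrightarrow> (v has_vector_derivative 0) (at t within {t..T})"
  shows "v T = v 0"
proof -
  have *: "norm (v T - v 0) \<le> e * T" if e: "e > 0" for e
  proof -
    define S where "S = {s \<in> {0..T}. norm (v s - v 0) \<le> e * s}"
    have "closed S" unfolding S_def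
      by (intro continuous_closed_preimage_constant continuous_on_closed_Collect_le continuous_intros c)
    have S0: "0 \<in> S" using T by (simp add: S_def)
    have bdd: "bdd_above S" by (auto simp: S_def intro: bdd_aboveI[of _ T])
    define m where "m = Sup S"
    have mS: "m \<in> S" unfolding m_def by (rule closed_contains_Sup) (use S0 bdd \<open>closed S\<close> in auto)
    hence m: "0 \<le> m" "m \<le> T" "norm (v m - v 0) \<le> e * m" by (auto simp: S_def)
    have "m = T"
    proof (rule ccontr)
      assume "m \<noteq> T"
      hence mT: "m < T" using m by simp
      from d[OF m(1) mT] have "\<exists>\<delta>>0. \<forall>y\<in>{m..T}. norm (y - m) < \<delta> \<longrightarrow> norm (v y - v m) \<le> e * norm (y - m)"
        using e unfolding has_vector_derivative_def has_derivative_within_alt by simp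
      then obtain \<delta> where \<delta>: "\<delta> > 0" "\<And>y. y \<in> {m..T} \<Longrightarrow> norm (y - m) < \<delta> \<Longrightarrow> norm (v y - v m) \<le> e * norm (y - m)"
        by blast
      define y where "y = min T (m + \<delta>/2)"
      have y: "y \<in> {m..T}" "norm (y - m) < \<delta>" "m < y" using \<delta>(1) mT by (auto simp: y_def min_def)
      have "norm (v y - v 0) \<le> norm (v y - v m) + norm (v m - v 0)"
        using norm_triangle_ineq[of "v y - v m" "v m - v 0"] by simp
      also have "\<dots> \<le> e * (y - m) + e * m" using \<delta>(2)[OF y(1,2)] m(3) y by simp
      also have "\<dots> = e * y" by (simp add: algebra_simps)
      finally have "y \<in> S" using y m by (auto simp: S_def)
      hence "y \<le> m" unfolding m_def using bdd by (intro cSup_upper)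
      thus False using y by simp
    qed
    thus ?thesis using m by simp
  qed
  have "norm (v T - v 0) \<le> 0 + e" if "e > 0" for e
    using *[of "e / T"] that T by (cases "T = 0") auto
  hence "norm (v T - v 0) \<le> 0" by (rule field_le_epsilon)
  thus ?thesis by simp
qed

text \<open>Subtracting the integral of \<open>g\<close> leaves a continuous function with vanishing
  right derivative. The semigroup law yields only right derivatives of orbits; this upgrades
  them.\<close>

lemma continuous_right_derivative:
  fixes u :: "real \<Rightarrow> 'a :: banach"
  assumes u: "continuous_on {0..T} u" and g: "continuous_on {0..T} g"
    and d: "\<And>t. 0 \<le> t \<Longrightarrow> t < T \<Longrightarrow> (u has_vector_derivative g t) (at t within {t..T})"
    and t: "t \<in> {0..T}"
  shows "(u has_vector_derivative g t) (at t within {0..T})"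
proof -
  define I where "I s = integral {0..s} g" for s
  have I: "(I has_vector_derivative g s) (at s within {0..T})" if "s \<in> {0..T}" for s
    unfolding I_def by (rule integral_has_vector_derivative[OF g that])
  have cI: "continuous_on {0..T} I" by (rule continuous_on_vector_derivative[OF I])
  have "u s - I s = u 0 - I 0" if s: "s \<in> {0..T}" for s
  proof (rule right_derivative_zero_const)
    show "continuous_on {0..s} (\<lambda>s. u s - I s)"
      using s by (intro continuous_on_diff continuous_on_subset[OF u] continuous_on_subset[OF cI]) auto
    fix x assume x: "0 \<le> x" "x < s"
    have "((\<lambda>s. u s - I s) has_vector_derivative g x - g x) (at x within {x..s})"
    proof (rule has_vector_derivative_diff)
      show "(u has_vector_derivative g x) (at x within {x..s})"
        by (rule has_vector_derivative_within_subset[OF d[of x]]) (use x s in auto)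
      show "(I has_vector_derivative g x) (at x within {x..s})"
        by (rule has_vector_derivative_within_subset[OF I[of x]]) (use x s in auto)
    qed
    thus "((\<lambda>s. u s - I s) has_vector_derivative 0) (at x within {x..s})" by simp
  qed (use s in auto)
  hence eq: "u s = I s + (u 0 - I 0)" if "s \<in> {0..T}" for s using that by (metis add.commute diff_add_cancel add_diff_eq)
  have "((\<lambda>s. I s + (u 0 - I 0)) has_vector_derivative g t + 0) (at t within {0..T})"
    using t by (intro derivative_intros I)
  hence "((\<lambda>s. I s + (u 0 - I 0)) has_vector_derivative g t) (at t within {0..T})" by simp
  thus ?thesis by (rule has_vector_derivative_transform[OF t eq, rotated])
qed

text \<open>A bootstrap: the speed bound is known only inside the ball, but up to a first exit time
  the path has moved by at most \<open>L * T\<close>, too little to reach the sphere.\<close>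

lemma path_stays_close:
  fixes u :: "real \<Rightarrow> 'a :: real_normed_vector"
  assumes d: "\<And>s. s \<in> {0..T} \<Longrightarrow> (u has_vector_derivative u' s) (at s within {0..T})"
    and b: "\<And>s. s \<in> {0..T} \<Longrightarrow> norm (u s - x) < \<rho> \<Longrightarrow> norm (u' s) \<le> L"
    and L: "norm (u 0 - x) + L * T < \<rho>" and L0: "0 \<le> L"
    and s: "s \<in> {0..T}"
  shows "norm (u s - x) < \<rho> \<and> norm (u s - u 0) \<le> L * s"
proof -
  have cu: "continuous_on {0..T} u" by (rule continuous_on_vector_derivative[OF d])
  have bound: "norm (u r - u 0) \<le> L * r" if r: "r \<in> {0..T}" and st: "\<And>y. 0 \<le> y \<Longrightarrow> y < r \<Longrightarrow> norm (u y - x) < \<rho>" for r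
  proof (cases "r = 0")
    case False
    hence r0: "0 < r" using r by simp
    have "norm (u r - u 0) \<le> L * r - L * 0"
    proof (rule differentiable_bound_general[OF r0])
      show "continuous_on {0..r} u" by (rule continuous_on_subset[OF cu]) (use r in auto)
      show "continuous_on {0..r} (\<lambda>s. L * s)" by (intro continuous_intros)
      fix y assume y: "0 < y" "y < r"
      have "at y within {0..T} = at y" using y r by (intro at_within_interior) auto
      thus "(u has_vector_derivative u' y) (at y)" using d[of y] y r by auto
      show "((\<lambda>s. L * s) has_vector_derivative L) (at y)"
        by (auto intro!: derivative_eq_intros simp flip: has_real_derivative_iff_has_vector_derivative)
      show "norm (u' y) \<le> L" using b[of y] st[of y] y r by auto
    qed
    thus ?thesis by simp
  qed simp
  have close: "norm (u r - x) < \<rho>" if r: "r \<in> {0..T}" and b': "norm (u r - u 0) \<le> L * r" for r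
  proof -
    have "norm (u r - x) \<le> norm (u r - u 0) + norm (u 0 - x)" using norm_triangle_ineq[of "u r - u 0" "u 0 - x"] by simp
    also have "\<dots> \<le> L * T + norm (u 0 - x)" using b' mult_left_mono[OF _ L0, of r T] r by auto
    finally show ?thesis using L by linarith
  qed
  have all: "norm (u r - x) < \<rho>" if "r \<in> {0..T}" for r
  proof (rule ccontr)
    assume r': "\<not> norm (u r - x) < \<rho>"
    define S where "S = {y \<in> {0..T}. \<rho> \<le> norm (u y - x)}"
    have "closed S" unfolding S_def
      by (intro continuous_on_closed_Collect_le continuous_intros cu)
    have rS: "r \<in> S" using that r' by (simp add: S_def)
    have bdd: "bdd_below S" by (auto simp: S_def intro: bdd_belowI[of _ 0])
    define m where "m = Inf S"
    have mS: "m \<in> S" unfolding m_def by (rule closed_contains_Inf) (use rS bdd \<open>closed S\<close> in auto)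
    have "norm (u y - x) < \<rho>" if "0 \<le> y" "y < m" for y
    proof (rule ccontr)
      assume "\<not> norm (u y - x) < \<rho>"
      hence "y \<in> S" using that mS by (auto simp: S_def)
      hence "m \<le> y" unfolding m_def using bdd by (intro cInf_lower)
      thus False using that by simp
    qed
    hence "norm (u m - u 0) \<le> L * m" using bound[of m] mS by (auto simp: S_def)
    thus False using close[of m] mS by (auto simp: S_def)
  qed
  thus ?thesis using bound[OF s] s by auto
qed

section \<open>The semigroup and its generator\<close>

locale interior_semigroup =
  fixes phi :: "real \<Rightarrow> complex \<Rightarrow> complex" and G :: "complex \<Rightarrow> complex" and b :: complex
  assumes sg: "analytic_semigroup phi" and nt: "nontrivial_semigroup phi"
    and gen: "is_generator phi G" and dw: "interior_DW_point phi b"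
begin

lemma b_disc: "norm b < 1" and phi_b: "0 \<le> t \<Longrightarrow> phi t b = b"
  using dw by (auto simp: interior_DW_point_def)

lemma phi_hol: "0 \<le> t \<Longrightarrow> phi t holomorphic_on unit_disc"
  and phi_disc: "0 \<le> t \<Longrightarrow> norm z < 1 \<Longrightarrow> norm (phi t z) < 1"
  and phi_0: "norm z < 1 \<Longrightarrow> phi 0 z = z"
  and phi_add: "0 \<le> t \<Longrightarrow> 0 \<le> s \<Longrightarrow> norm z < 1 \<Longrightarrow> phi (t + s) z = phi t (phi s z)"
  using sg unfolding analytic_semigroup_def by (auto simp: image_subset_iff)

lemma phi_uniform:
  assumes "r < 1" "0 < e"
  obtains d where "0 < d" "\<And>t z. 0 < t \<Longrightarrow> t < d \<Longrightarrow> norm z \<le> r \<Longrightarrow> norm (phi t z - z) < e"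
proof -
  have "uniform_limit (cball 0 r) phi (phi 0) (at_right 0)"
  proof -
    have "compact (cball (0::complex) r) \<and> cball 0 r \<subseteq> unit_disc" using assms(1) by auto
    thus ?thesis using sg unfolding analytic_semigroup_def by blast
  qed
  hence "eventually (\<lambda>t. \<forall>z\<in>cball 0 r. dist (phi t z) (phi 0 z) < e) (at_right 0)"
    using assms(2) by (rule uniform_limitD)
  then obtain d where "0 < d" "\<And>t. 0 < t \<Longrightarrow> t < d \<Longrightarrow> \<forall>z\<in>cball 0 r. dist (phi t z) (phi 0 z) < e"
    unfolding eventually_at_right_field by blast
  thus thesis using assms(1) by (intro that[of d]) (auto simp: dist_norm phi_0)
qed

lemma phi_G: "norm z < 1 \<Longrightarrow> ((\<lambda>t. (phi t z - z) / of_real t) \<longlongrightarrow> G z) (at_right 0)"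
  using gen by (auto simp: is_generator_def)

lemma G_b: "G b = 0"
proof -
  have "((\<lambda>t. (phi t b - b) / of_real t) \<longlongrightarrow> 0) (at_right 0)"
    by (rule tendsto_eventually) (auto simp: eventually_at_right_field phi_b intro: exI[of _ 1])
  thus ?thesis using phi_G[OF b_disc] tendsto_unique trivial_limit_at_right_real by blast
qed

lemma phi_contraction:
  assumes t: "0 \<le> t" and z: "norm z < 1"
  shows "norm ((phi t z - b) / (1 - cnj b * phi t z)) \<le> norm ((z - b) / (1 - cnj b * z))"
proof (rule Schwarz_Pick_zero[where F = "\<lambda>z. (phi t z - b) / (1 - cnj b * phi t z)", OF _ _ b_disc _ z])
  show "(\<lambda>z. (phi t z - b) / (1 - cnj b * phi t z)) holomorphic_on unit_disc"
    using one_minus_cnj_mult_ne[OF b_disc phi_disc[OF t]] by (intro holomorphic_intros phi_hol t) auto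
  show "norm ((phi t u - b) / (1 - cnj b * phi t u)) < 1" if "norm u < 1" for u
    using Moebius_function_norm_lt_1[OF b_disc phi_disc[OF t that], of 0] by (simp add: Moebius_function_simple)
qed (simp add: phi_b t)

text \<open>The factor by which the flow may shrink the distance to the unit circle, whatever the
  time; it is positive because \<open>b\<close> lies inside the disc.\<close>

definition cb :: real where "cb = ((1 - norm b) / (1 + norm b))\<^sup>2 / 2"

lemma cb_pos: "0 < cb" and cb_half: "cb \<le> 1/2"
proof -
  have 1: "0 < 1 + norm b" using norm_ge_zero[of b] by linarith
  thus "0 < cb" using b_disc unfolding cb_def by simp
  have "(1 - norm b) / (1 + norm b) \<le> 1" "0 \<le> (1 - norm b) / (1 + norm b)"
    using 1 b_disc norm_ge_zero[of b] by (auto simp: divide_le_eq_1_pos simp del: norm_ge_zero)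
  hence "((1 - norm b) / (1 + norm b))\<^sup>2 \<le> 1" by (simp add: power_le_one)
  thus "cb \<le> 1/2" by (simp add: cb_def)
qed

text \<open>The pseudohyperbolic distance to \<open>b\<close> does not grow along the flow. One
  minus its square is a constant times \<open>1 - |z|^2\<close> over
  \<open>|1 - cnj b * z|^2\<close>, and the modulus in the denominator lies between
  \<open>1 - norm b\<close> and \<open>1 + norm b\<close>. The factor 1/2 in \<open>cb\<close> pays
  for replacing \<open>1 - |z|^2\<close> by \<open>1 - |z|\<close>.\<close>

lemma phi_boundary_distance:
  assumes t: "0 \<le> t" and z: "norm z < 1"
  shows "cb * (1 - norm z) \<le> 1 - norm (phi t z)"
proof -
  let ?w = "phi t z"
  have w: "norm ?w < 1" by (rule phi_disc[OF t z])
  let ?A = "norm (1 - cnj b * z)" and ?B = "norm (1 - cnj b * ?w)"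
  have B: "1 - norm b \<le> ?B"
    using one_minus_cnj_mult_lower[of b ?w] mult_left_le[of "norm ?w" "norm b"] w by simp
  have A: "?A \<le> 1 + norm b"
    using one_minus_cnj_mult_upper[of b z] mult_left_le[of "norm z" "norm b"] z by simp
  have A0: "0 < ?A" and B0: "0 < ?B"
    using one_minus_cnj_mult_ne[OF b_disc z] one_minus_cnj_mult_ne[OF b_disc w] by auto
  have b2: "0 < 1 - (norm b)\<^sup>2" using b_disc by (simp add: power_less_one_iff abs_square_less_1)
  have "1 - (norm ((z - b) / (1 - cnj b * z)))\<^sup>2 \<le> 1 - (norm ((?w - b) / (1 - cnj b * ?w)))\<^sup>2"
    using phi_contraction[OF t z] by (simp add: power_mono)
  hence "(1 - (norm b)\<^sup>2) * (1 - (norm z)\<^sup>2) / ?A\<^sup>2 \<le> (1 - (norm b)\<^sup>2) * (1 - (norm ?w)\<^sup>2) / ?B\<^sup>2"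
    unfolding one_minus_norm_Moebius[OF b_disc z] one_minus_norm_Moebius[OF b_disc w] .
  hence "(1 - (norm b)\<^sup>2) * ((1 - (norm z)\<^sup>2) / ?A\<^sup>2) \<le> (1 - (norm b)\<^sup>2) * ((1 - (norm ?w)\<^sup>2) / ?B\<^sup>2)" by simp
  hence "(1 - (norm z)\<^sup>2) / ?A\<^sup>2 \<le> (1 - (norm ?w)\<^sup>2) / ?B\<^sup>2"
    using b2 by (simp only: mult_le_cancel_left_pos)
  hence "(1 - (norm z)\<^sup>2) / ?A\<^sup>2 * ?B\<^sup>2 \<le> 1 - (norm ?w)\<^sup>2"
    using B0 by (simp add: pos_le_divide_eq)
  moreover have "(1 - (norm z)\<^sup>2) * ((1 - norm b) / (1 + norm b))\<^sup>2 \<le> (1 - (norm z)\<^sup>2) / ?A\<^sup>2 * ?B\<^sup>2"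
  proof -
    have "(1 - norm b) / (1 + norm b) \<le> ?B / ?A"
      using A B A0 b_disc by (intro frac_le) auto
    hence "((1 - norm b) / (1 + norm b))\<^sup>2 \<le> (?B / ?A)\<^sup>2"
      using b_disc by (intro power_mono) (auto simp: add_nonneg_nonneg)
    hence "(1 - (norm z)\<^sup>2) * ((1 - norm b) / (1 + norm b))\<^sup>2 \<le> (1 - (norm z)\<^sup>2) * (?B / ?A)\<^sup>2"
      using z by (intro mult_left_mono) (auto simp: power_le_one abs_square_le_1)
    thus ?thesis by (simp add: power_divide)
  qed
  moreover have "2 * cb * (1 - norm z) \<le> (1 - (norm z)\<^sup>2) * ((1 - norm b) / (1 + norm b))\<^sup>2"
  proof -
    have "(norm z)\<^sup>2 \<le> norm z" using z by (simp add: power2_eq_square mult_left_le)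
    hence "2 * cb * (1 - norm z) \<le> 2 * cb * (1 - (norm z)\<^sup>2)" using cb_pos by (intro mult_left_mono) auto
    thus ?thesis by (simp add: cb_def mult.commute)
  qed
  moreover have "1 - (norm ?w)\<^sup>2 \<le> 2 * (1 - norm ?w)"
  proof -
    have "1 - (norm ?w)\<^sup>2 = (1 + norm ?w) * (1 - norm ?w)" by (simp add: power2_eq_square algebra_simps)
    also have "\<dots> \<le> 2 * (1 - norm ?w)" using w by (intro mult_right_mono) auto
    finally show ?thesis .
  qed
  ultimately have "2 * cb * (1 - norm z) \<le> 2 * (1 - norm ?w)" by (meson order_trans)
  thus ?thesis by simp
qed

text \<open>Apart from the removable singularity at \<open>b\<close>, this is
  \<open>(1 - H) / t\<close> with H the quotient of the Moebius images of \<open>phi t z\<close> and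
  of \<open>z\<close> when \<open>b\<close> is sent to 0. Since H has modulus at most 1,
  \<open>1 - H\<close> has nonnegative real part, and as t tends to 0 a multiple of the
  Berkson-Porta function of the generator appears.\<close>

definition quot :: "real \<Rightarrow> complex \<Rightarrow> complex" where
  "quot t z = (1 - (if z = b then deriv (phi t) b else (phi t z - phi t b) / (z - b)) *
      ((1 - cnj b * z) / (1 - cnj b * phi t z))) / of_real t"

lemma quot_hol: "0 < t \<Longrightarrow> quot t holomorphic_on unit_disc"
proof -
  assume t: "0 < t"
  have "(\<lambda>z. if z = b then deriv (phi t) b else (phi t z - phi t b) / (z - b)) holomorphic_on unit_disc"
    by (rule pole_lemma_open) (use t phi_hol in auto)
  moreover have "1 - cnj b * phi t z \<noteq> 0" if "norm z < 1" for z
    using one_minus_cnj_mult_ne[OF b_disc phi_disc] t that by simp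
  ultimately show ?thesis unfolding quot_def using t phi_hol[of t] by (intro holomorphic_intros) auto
qed

lemma quot_eq:
  assumes "0 < t" "norm z < 1" "z \<noteq> b"
  shows "quot t z = - ((phi t z - z) / of_real t) * (of_real (1 - (norm b)\<^sup>2) / ((1 - cnj b * phi t z) * (z - b)))"
proof -
  have ne: "1 - cnj b * phi t z \<noteq> 0" "z - b \<noteq> 0"
    using one_minus_cnj_mult_ne[OF b_disc phi_disc] assms by auto
  have bb: "of_real (1 - (norm b)\<^sup>2) = 1 - b * cnj b" using complex_norm_square[of b] by simp
  have "1 - (phi t z - b) / (z - b) * ((1 - cnj b * z) / (1 - cnj b * phi t z)) =
      ((z - b) * (1 - cnj b * phi t z) - (phi t z - b) * (1 - cnj b * z)) / ((1 - cnj b * phi t z) * (z - b))"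
  proof -
    have "1 - x / y * (v / w) = (y * w - x * v) / (w * y)" if "y \<noteq> 0" "w \<noteq> 0" for x y v w :: complex
      using that by (simp add: field_simps)
    thus ?thesis using ne by blast
  qed
  also have "(z - b) * (1 - cnj b * phi t z) - (phi t z - b) * (1 - cnj b * z) = - (phi t z - z) * of_real (1 - (norm b)\<^sup>2)"
    unfolding bb by (simp add: algebra_simps)
  finally have "quot t z = (- (phi t z - z) * of_real (1 - (norm b)\<^sup>2) / ((1 - cnj b * phi t z) * (z - b))) / of_real t"
    using assms phi_b[of t] unfolding quot_def by simp
  moreover have "(- x * k / w) / s = - (x / s) * (k / w)" for x k w s :: complex by simp
  ultimately show ?thesis by (simp only:)
qed

lemma Re_quot_nonneg:
  assumes t: "0 < t" and z: "norm z < 1"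
  shows "0 \<le> Re (quot t z)"
proof -
  have *: "0 \<le> Re (quot t u)" if u: "norm u < 1" "u \<noteq> b" for u
  proof -
    let ?H = "(phi t u - b) / (u - b) * ((1 - cnj b * u) / (1 - cnj b * phi t u))"
    have ne: "1 - cnj b * u \<noteq> 0" "u - b \<noteq> 0" using one_minus_cnj_mult_ne[OF b_disc] u by auto
    have "norm ?H = norm ((phi t u - b) / (1 - cnj b * phi t u)) / norm ((u - b) / (1 - cnj b * u))"
      by (simp add: norm_mult norm_divide)
    also have "\<dots> \<le> 1" using phi_contraction[of t u] t u ne by (simp add: divide_le_eq_1)
    finally have "Re ?H \<le> 1" using complex_Re_le_cmod[of ?H] by linarith
    moreover have "quot t u = (1 - ?H) / of_real t" using u phi_b[of t] t by (simp add: quot_def)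
    ultimately show ?thesis using t by (simp add: Re_divide_of_real del: Re_divide)
  qed
  show ?thesis
  proof (cases "z = b")
    case False thus ?thesis using * z by simp
  next
    case True
    \<comment> \<open>At \<open>b\<close> itself the sign is inherited from the neighbouring points
      by continuity.\<close>
    have "continuous_on unit_disc (quot t)" using quot_hol[OF t] holomorphic_on_imp_continuous_on by blast
    hence "isCont (quot t) b" using b_disc by (simp add: continuous_on_eq_continuous_at)
    hence "((\<lambda>u. Re (quot t u)) \<longlongrightarrow> Re (quot t b)) (at b)" by (intro tendsto_intros) (simp add: isCont_def)
    moreover have "eventually (\<lambda>u. 0 \<le> Re (quot t u)) (at b)"
    proof -
      have "eventually (\<lambda>u. u \<in> unit_disc - {b}) (at b)"
        using b_disc by (intro eventually_at_in_open) auto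
      thus ?thesis by eventually_elim (use * in auto)
    qed
    ultimately show ?thesis using True tendsto_lowerbound trivial_limit_at by blast
  qed
qed

text \<open>The quotients \<open>quot t\<close> have nonnegative real part and converge at every point other than b, so Harnack's
  inequality makes them a normal family; hence the pointwise limit is holomorphic.\<close>

lemma generator_form:
  obtains P where "P holomorphic_on unit_disc" "\<And>z. norm z < 1 \<Longrightarrow> 0 \<le> Re (P z)"
    "\<And>z. norm z < 1 \<Longrightarrow> G z = - (z - b) * (1 - cnj b * z) * P z"
proof -
  define k where "k = 1 - (norm b)\<^sup>2"
  have k: "k > 0" using b_disc by (simp add: k_def abs_square_less_1)
  define F where "F n = quot (1 / real (Suc n))" for n
  have Fhol: "F n holomorphic_on unit_disc" for n unfolding F_def by (rule quot_hol) simp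
  have FRe: "0 \<le> Re (F n z)" if "norm z < 1" for n z unfolding F_def by (rule Re_quot_nonneg) (use that in auto)
  have to0: "filterlim (\<lambda>n. 1 / real (Suc n)) (at_right 0) sequentially"
  proof -
    have "(\<lambda>n. 1 / real (Suc n)) \<longlonglongrightarrow> 0"
      using LIMSEQ_inverse_real_of_nat by (simp only: inverse_eq_divide)
    thus ?thesis unfolding filterlim_at by auto
  qed
  have Flim: "(\<lambda>n. F n z) \<longlonglongrightarrow> - G z * (of_real k / ((1 - cnj b * z) * (z - b)))" if z: "norm z < 1" "z \<noteq> b" for z
  proof -
    have c: "((\<lambda>t. phi t z) \<longlongrightarrow> z) (at_right 0)"
    proof (rule tendstoI)
      fix e :: real assume "e > 0"
      then obtain d where "0 < d" "\<And>t u. 0 < t \<Longrightarrow> t < d \<Longrightarrow> norm u \<le> norm z \<Longrightarrow> norm (phi t u - u) < e"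
        using phi_uniform[OF z(1)] by blast
      thus "eventually (\<lambda>t. dist (phi t z) z < e) (at_right 0)"
        unfolding eventually_at_right_field by (auto simp: dist_norm intro!: exI[of _ d])
    qed
    have "((\<lambda>t. - ((phi t z - z) / of_real t) * (of_real k / ((1 - cnj b * phi t z) * (z - b)))) \<longlongrightarrow>
        - G z * (of_real k / ((1 - cnj b * z) * (z - b)))) (at_right 0)"
      by (intro tendsto_intros phi_G z c) (use z one_minus_cnj_mult_ne[OF b_disc z(1)] in auto)
    from filterlim_compose[OF this to0] show ?thesis
      unfolding F_def using z by (simp add: quot_eq k_def del: of_nat_Suc)
  qed
  obtain z0 where z0: "norm z0 < 1" "z0 \<noteq> b"
  proof (cases "b = 0")
    case True thus thesis using that[of "1/2"] by simp
  next
    case False thus thesis using that[of 0] by simp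
  qed
  have "Bseq (\<lambda>n. F n z0)" using Flim[OF z0] by (intro convergent_imp_Bseq) (auto simp: convergent_def)
  then obtain B0 where B0: "\<And>n. norm (F n z0) \<le> B0" by (auto simp: Bseq_def)
  have bound: "\<exists>B. \<forall>h\<in>range F. \<forall>z\<in>K. norm (h z) \<le> B" if K: "compact K" "K \<subseteq> unit_disc" for K
  proof (cases "K = {}")
    case False
    have m: "norm ((z - z0) / (1 - cnj z0 * z)) < 1" if "z \<in> K" for z
      using Moebius_function_norm_lt_1[OF z0(1), of z 0] K that by (auto simp: Moebius_function_simple)
    have ne: "1 - cnj z0 * z \<noteq> 0" if "z \<in> K" for z
      using one_minus_cnj_mult_ne[OF z0(1), of z] K that by auto
    have "continuous_on K (\<lambda>z. norm ((z - z0) / (1 - cnj z0 * z)))"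
      by (intro continuous_intros) (use ne in auto)
    then obtain x where x: "x \<in> K" "\<And>z. z \<in> K \<Longrightarrow> norm ((z - z0) / (1 - cnj z0 * z)) \<le> norm ((x - z0) / (1 - cnj z0 * x))"
      using continuous_attains_sup[OF K(1) False] by blast
    define \<rho> where "\<rho> = norm ((x - z0) / (1 - cnj z0 * x))"
    have \<rho>: "\<rho> < 1" "0 \<le> \<rho>" using m[OF x(1)] unfolding \<rho>_def by auto
    have "norm (F n z) \<le> (1 + \<rho>) * B0 / (1 - \<rho>)" if "z \<in> K" for n z
    proof -
      have "(1 - \<rho>) * norm (F n z) \<le> (1 + \<rho>) * norm (F n z0)"
        by (rule Harnack_Re_nonneg[OF Fhol FRe z0(1) _ _ \<rho>(1)]) (use that K x(2) in \<open>auto simp: \<rho>_def\<close>)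
      also have "\<dots> \<le> (1 + \<rho>) * B0" using B0 \<rho> by (intro mult_left_mono) auto
      finally show ?thesis using \<rho> by (simp add: pos_le_divide_eq mult.commute)
    qed
    thus ?thesis by blast
  qed auto
  obtain g r where g: "g holomorphic_on unit_disc" "strict_mono (r :: nat \<Rightarrow> nat)"
     "\<And>x. x \<in> unit_disc \<Longrightarrow> (\<lambda>n. F (r n) x) \<longlonglongrightarrow> g x"
    by (rule Montel[of unit_disc "range F" F]) (use Fhol bound in auto)
  have gRe: "0 \<le> Re (g z)" if "norm z < 1" for z
  proof (rule tendsto_lowerbound)
    show "((\<lambda>n. Re (F (r n) z)) \<longlongrightarrow> Re (g z)) sequentially" by (intro tendsto_intros g(3)) (use that in auto)
    show "eventually (\<lambda>n. 0 \<le> Re (F (r n) z)) sequentially" using FRe[OF that] by simp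
  qed simp
  have gG: "g z = - G z * (of_real k / ((1 - cnj b * z) * (z - b)))" if z: "norm z < 1" "z \<noteq> b" for z
    using LIMSEQ_subseq_LIMSEQ[OF Flim[OF z] g(2)] g(3)[of z] z(1) LIMSEQ_unique by (fastforce simp: o_def)
  show thesis
  \<comment> \<open>By \<open>quot_eq\<close> the quotients approximate \<open>k\<close> times the
    function wanted, hence the division by \<open>k\<close>.\<close>
  proof (rule that[of "\<lambda>z. g z / of_real k"])
    show "(\<lambda>z. g z / of_real k) holomorphic_on unit_disc" using k by (intro holomorphic_intros g) auto
    show "0 \<le> Re (g z / of_real k)" if "norm z < 1" for z
      using gRe[OF that] k by (simp add: Re_divide_of_real del: Re_divide)
    show "G z = - (z - b) * (1 - cnj b * z) * (g z / of_real k)" if z: "norm z < 1" for z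
    proof (cases "z = b")
      case False
      have "x = - d * c * (y / l)" if "y = - x * (l / (c * d))" "c \<noteq> 0" "d \<noteq> 0" "l \<noteq> 0" for x y c d l :: complex
        using that by (simp add: field_simps)
      from this[OF gG[OF z False]] show ?thesis using False k one_minus_cnj_mult_ne[OF b_disc z] by simp
    qed (simp add: G_b)
  qed
qed

section \<open>Joint continuity of the flow in time and space\<close>

lemma phi_Lipschitz:
  assumes "0 \<le> t" "norm z < 1" "norm w < 1"
  shows "norm (phi t w - phi t z) \<le> 2 * norm (w - z) / (1 - norm z)"
  by (rule self_map_Lipschitz) (use assms phi_hol phi_disc in auto)

text \<open>The map for the smaller of the two times is factored out by the semigroup law, and its
  Lipschitz constant at \<open>z\<close> does not depend on time.\<close>

lemma phi_time_difference:
  assumes s: "0 \<le> s" "0 \<le> t" and z: "norm z < 1"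
  shows "norm (phi t z - phi s z) \<le> 2 * norm (phi \<bar>t - s\<bar> z - z) / (1 - norm z)"
proof -
  have *: "norm (phi t z - phi s z) \<le> 2 * norm (phi (t - s) z - z) / (1 - norm z)" if "0 \<le> s" "s \<le> t" for s t
  proof -
    have "phi t z = phi s (phi (t - s) z)" using phi_add[of s "t - s" z] that z by simp
    thus ?thesis using phi_Lipschitz[OF that(1) z phi_disc[of "t - s" z]] that z by simp
  qed
  show ?thesis
  proof (cases "s \<le> t")
    case True thus ?thesis using *[OF s(1) True] by simp
  next
    case False
    thus ?thesis using *[OF s(2), of s] by (simp add: norm_minus_commute)
  qed
qed

text \<open>The Lipschitz bound in space is uniform in time, and a time difference reduces to a
  short time from \<open>z\<close>. Joint continuity supplies the measurability needed to exchange
  time averages and circular means.\<close>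

lemma phi_joint_continuous: "continuous_on ({0::real..} \<times> unit_disc) (\<lambda>x. phi (fst x) (snd x))"
  unfolding continuous_on_iff
proof (intro ballI allI impI)
  fix x and e :: real assume x: "x \<in> {0::real..} \<times> unit_disc" and e: "0 < e"
  obtain s :: real and z where sz: "x = (s, z)" by (cases x)
  have s: "0 \<le> s" and z: "norm z < 1" using x sz by auto
  define c where "c = e * (1 - norm z) / 4"
  have c: "c > 0" using e z by (simp add: c_def)
  obtain d where d: "0 < d" "\<And>t u. 0 < t \<Longrightarrow> t < d \<Longrightarrow> norm u \<le> norm z \<Longrightarrow> norm (phi t u - u) < c"
    using phi_uniform[OF z c] by blast
  have d': "norm (phi h z - z) < c" if "0 \<le> h" "h < d" for h :: real
    using d(2)[of h z] that phi_0[OF z] c by (cases "h = 0") auto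
  have "dist (phi t w) (phi s z) < e" if "0 \<le> t" "norm w < 1" "dist (t, w) (s, z) < min c d" for t w
  proof -
    have dd: "\<bar>t - s\<bar> < d" "norm (w - z) < c"
      using that(3) dist_fst_le[of "(t,w)" "(s,z)"] dist_snd_le[of "(t,w)" "(s,z)"] by (auto simp: dist_norm)
    have "norm (phi t w - phi s z) \<le> norm (phi t w - phi t z) + norm (phi t z - phi s z)"
      using norm_triangle_ineq[of "phi t w - phi t z" "phi t z - phi s z"] by simp
    also have "\<dots> \<le> 2 * norm (w - z) / (1 - norm z) + 2 * norm (phi \<bar>t - s\<bar> z - z) / (1 - norm z)"
      by (intro add_mono phi_Lipschitz phi_time_difference) (use that s z in auto)
    also have "\<dots> < 2 * c / (1 - norm z) + 2 * c / (1 - norm z)"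
      using dd d'[of "\<bar>t - s\<bar>"] z by (intro add_strict_mono divide_strict_right_mono) auto
    also have "\<dots> = e"
    proof -
      have "2 * (e * x / 4) / x + 2 * (e * x / 4) / x = e" if "x \<noteq> 0" for x using that by (simp add: field_simps)
      note * = this
      show ?thesis unfolding c_def by (rule *) (use z in auto)
    qed
    finally show ?thesis by (simp add: dist_norm)
  qed
  thus "\<exists>d>0. \<forall>x'\<in>{0..} \<times> unit_disc. dist x' x < d \<longrightarrow> dist (phi (fst x') (snd x')) (phi (fst x) (snd x)) < e"
    using c d(1) sz by (intro exI[of _ "min c d"]) auto
qed

lemma phi_time_continuous: "norm z < 1 \<Longrightarrow> A \<subseteq> {0..} \<Longrightarrow> continuous_on A (\<lambda>t. phi t z)"
proof -
  assume *: "norm z < 1" "A \<subseteq> {0..}"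
  have "continuous_on A (\<lambda>t. phi (fst (t, z)) (snd (t, z)))"
    by (rule continuous_on_compose2[OF phi_joint_continuous]) (use * in \<open>auto intro!: continuous_intros\<close>)
  thus ?thesis by simp
qed

end

section \<open>The flow equation, displacement estimates and the derivative of the g-symbol\<close>

locale interior_semigroup_P = interior_semigroup +
  fixes P :: "complex \<Rightarrow> complex"
  assumes P_hol: "P holomorphic_on unit_disc" and P_Re: "\<And>z. norm z < 1 \<Longrightarrow> 0 \<le> Re (P z)"
    and G_eq: "\<And>z. norm z < 1 \<Longrightarrow> G z = - (z - b) * (1 - cnj b * z) * P z"
begin

lemma G_hol: "G holomorphic_on unit_disc"
proof -
  have "(\<lambda>z. - (z - b) * (1 - cnj b * z) * P z) holomorphic_on unit_disc"
    by (intro holomorphic_intros P_hol)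
  thus ?thesis by (rule holomorphic_transform) (simp add: G_eq)
qed

lemma phi_right_derivative:
  assumes t: "0 \<le> t" and z: "norm z < 1"
  shows "((\<lambda>t. phi t z) has_vector_derivative G (phi t z)) (at t within {t..T})"
  unfolding has_vector_derivative_def has_derivative_within_alt
proof (intro conjI allI impI)
  show "bounded_linear (\<lambda>x. x *\<^sub>R G (phi t z))" by (rule bounded_linear_scaleR_left)
  fix e :: real assume e: "0 < e"
  let ?w = "phi t z"
  have w: "norm ?w < 1" by (rule phi_disc[OF t z])
  have "eventually (\<lambda>h. dist ((phi h ?w - ?w) / of_real h) (G ?w) < e) (at_right 0)"
    using phi_G[OF w] e by (rule tendstoD)
  then obtain d where d: "0 < d" "\<And>h. 0 < h \<Longrightarrow> h < d \<Longrightarrow> norm ((phi h ?w - ?w) / of_real h - G ?w) < e"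
    unfolding eventually_at_right_field dist_norm by blast
  have "norm (phi y z - ?w - (y - t) *\<^sub>R G ?w) \<le> e * norm (y - t)" if y: "y \<in> {t..T}" "norm (y - t) < d" for y
  proof (cases "y = t")
    case False
    define h where "h = y - t"
    have h: "0 < h" "h < d" using False y by (auto simp: h_def)
    have "phi y z = phi h ?w" using phi_add[of h t z] h t z by (simp add: h_def)
    hence "phi y z - ?w - h *\<^sub>R G ?w = of_real h * ((phi h ?w - ?w) / of_real h - G ?w)"
      using h by (simp add: scaleR_conv_of_real field_simps)
    hence "norm (phi y z - ?w - h *\<^sub>R G ?w) = h * norm ((phi h ?w - ?w) / of_real h - G ?w)"
      using h by (simp add: norm_mult)
    also have "\<dots> \<le> h * e" using d(2)[OF h] h by (intro mult_left_mono) auto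
    finally show ?thesis using h by (simp add: h_def mult.commute)
  qed simp
  thus "\<exists>d>0. \<forall>y\<in>{t..T}. norm (y - t) < d \<longrightarrow> norm (phi y z - phi t z - (y - t) *\<^sub>R G (phi t z)) \<le> e * norm (y - t)"
    using d(1) by blast
qed

text \<open>The semigroup law transports the defining limit of \<open>G\<close> from time 0 to every
  time, but only from the right; continuity of \<open>G\<close> along the orbit then gives the
  derivative within the whole interval.\<close>

lemma phi_ODE:
  assumes z: "norm z < 1" and t: "t \<in> {0..T}"
  shows "((\<lambda>t. phi t z) has_vector_derivative G (phi t z)) (at t within {0..T})"
proof (rule continuous_right_derivative[OF _ _ _ t])
  show "continuous_on {0..T} (\<lambda>t. phi t z)" by (rule phi_time_continuous[OF z]) auto
  thus "continuous_on {0..T} (\<lambda>t. G (phi t z))"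
    by (rule continuous_on_compose2[OF holomorphic_on_imp_continuous_on[OF G_hol]]) (use phi_disc z in auto)
qed (rule phi_right_derivative[OF _ z])

text \<open>By Harnack a zero of \<open>P\<close> forces \<open>P\<close> to vanish identically.
  Then orbits have zero right derivative and the semigroup would be trivial.\<close>

lemma P_ne:
  assumes z: "norm z < 1" shows "P z \<noteq> 0"
proof
  assume 0: "P z = 0"
  have P0: "P w = 0" if w: "norm w < 1" for w
  proof -
    define \<rho> where "\<rho> = norm ((w - z) / (1 - cnj z * w))"
    have \<rho>: "\<rho> < 1" using Moebius_function_norm_lt_1[OF z w, of 0] by (simp add: \<rho>_def Moebius_function_simple)
    have "(1 - \<rho>) * norm (P w) \<le> (1 + \<rho>) * norm (P z)"
      by (rule Harnack_Re_nonneg[OF P_hol P_Re z w _ \<rho>]) (simp_all add: \<rho>_def)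
    thus ?thesis using 0 \<rho> by (simp add: mult_le_0_iff)
  qed
  have "phi t w = w" if t: "0 \<le> t" and w: "norm w < 1" for t w
  proof -
    have "phi t w = phi 0 w"
    proof (rule right_derivative_zero_const[OF _ t])
      show "continuous_on {0..t} (\<lambda>t. phi t w)" by (rule phi_time_continuous[OF w]) auto
      fix s assume "0 \<le> s" "s < t"
      thus "((\<lambda>t. phi t w) has_vector_derivative 0) (at s within {s..t})"
        using phi_right_derivative[of s w t] w G_eq[OF phi_disc[of s w]] P0[OF phi_disc[of s w]] by simp
    qed
    thus ?thesis using phi_0[OF w] by simp
  qed
  thus False using nt unfolding nontrivial_semigroup_def by auto
qed

text \<open>Both sides are the derivative at t = 0 of
  \<open>phi t (phi s z) = phi s (phi t z)\<close>.\<close>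

lemma deriv_phi_G:
  assumes s: "0 \<le> s" and z: "norm z < 1"
  shows "deriv (phi s) z * G z = G (phi s z)"
proof -
  have "(phi s has_field_derivative deriv (phi s) z) (at z)"
    using holomorphic_derivI[OF phi_hol[OF s] open_ball, of z] z by simp
  hence 1: "(phi s has_field_derivative deriv (phi s) z) (at (phi 0 z) within (\<lambda>t. phi t z) ` {0..1})"
    by (simp add: phi_0[OF z] has_field_derivative_at_within)
  have d1: "((phi s \<circ> (\<lambda>t. phi t z)) has_vector_derivative (G (phi 0 z) * deriv (phi s) z)) (at 0 within {0..1})"
    by (rule field_vector_diff_chain_within[OF phi_right_derivative[OF order_refl z] 1])
  have d2: "((\<lambda>t. phi t (phi s z)) has_vector_derivative G (phi 0 (phi s z))) (at 0 within {0..1})"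
    by (rule phi_right_derivative[OF order_refl phi_disc[OF s z]])
  have "((\<lambda>t. phi t (phi s z)) has_vector_derivative (G (phi 0 z) * deriv (phi s) z)) (at 0 within {0..1})"
  proof (rule has_vector_derivative_transform[OF _ _ d1])
    show "phi t (phi s z) = (phi s \<circ> (\<lambda>t. phi t z)) t" if "t \<in> {0..1}" for t
      using phi_add[of t s z] phi_add[of s t z] that s z by (simp add: add.commute)
  qed simp
  with d2 have "G (phi 0 (phi s z)) = G (phi 0 z) * deriv (phi s) z"
    by (intro vector_derivative_unique_within_closed_interval[where a = 0 and b = 1 and x = 0]) auto
  thus ?thesis using phi_0[OF z] phi_0[OF phi_disc[OF s z]] by (simp add: mult.commute)
qed

text \<open>Such points have pseudohyperbolic distance at most 1/2 from \<open>z\<close>, and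
  Harnack's quotient (1 + 1/2) / (1 - 1/2) is 3.\<close>

lemma P_local:
  assumes z: "norm z < 1" and w: "norm (w - z) \<le> (1 - norm z) / 2"
  shows "norm w < 1" "norm (P w) \<le> 3 * norm (P z)"
proof -
  have "norm w \<le> norm z + norm (w - z)" using norm_triangle_ineq[of z "w - z"] by simp
  thus w1: "norm w < 1" using w z by (simp add: field_simps)
  have "norm ((w - z) / (1 - cnj z * w)) \<le> ((1 - norm z) / 2) / (1 - norm z)"
    unfolding norm_divide
  proof (rule frac_le)
    show "1 - norm z \<le> norm (1 - cnj z * w)"
      using one_minus_cnj_mult_lower[of z w] mult_left_le[of "norm w" "norm z"] w1 by simp
  qed (use z w in auto)
  moreover have "(x / 2) / x \<le> 1/2" for x :: real by simp
  ultimately have "norm ((w - z) / (1 - cnj z * w)) \<le> 1/2" using order_trans by blast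
  from Harnack_Re_nonneg[OF P_hol P_Re z w1 this] show "norm (P w) \<le> 3 * norm (P z)" by simp
qed

lemma norm_G_le:
  assumes z: "norm z < 1" shows "norm (G z) \<le> 4 * norm (P z)"
proof -
  have "norm (z - b) \<le> 2" using norm_triangle_ineq4[of z b] z b_disc by simp
  moreover have "norm (1 - cnj b * z) \<le> 2"
    using one_minus_cnj_mult_upper[of b z] mult_strict_mono'[OF b_disc z] by simp
  ultimately have "norm (z - b) * norm (1 - cnj b * z) \<le> 2 * 2" by (intro mult_mono) auto
  hence "norm (z - b) * norm (1 - cnj b * z) * norm (P z) \<le> 4 * norm (P z)" by (intro mult_right_mono) auto
  moreover have "norm (G z) = norm (z - b) * norm (1 - cnj b * z) * norm (P z)"
    unfolding G_eq[OF z] norm_mult norm_minus_cancel ..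
  ultimately show ?thesis by simp
qed

text \<open>In the disc of radius \<open>(1 - norm z) / 2\<close> the speed is at most
  \<open>12 * norm (P z)\<close>: 4 from \<open>norm_G_le\<close>, 3 from \<open>P_local\<close>.
  The condition on \<open>t\<close> keeps the path shorter than a quarter of
  \<open>1 - norm z\<close>, so an orbit starting in the quarter disc stays in the half
  disc.\<close>

lemma displacement_forward:
  assumes z: "norm z < 1" and w: "norm (w - z) \<le> (1 - norm z) / 4" and t: "0 \<le> t" "48 * norm (P z) * t < 1 - norm z"
  shows "norm (phi t w - w) \<le> 12 * norm (P z) * t" "norm (phi t w - z) < (1 - norm z) / 2"
proof -
  have w1: "norm w < 1" by (rule P_local(1)[OF z]) (use w z in auto)
  have "norm (phi t w - z) < (1 - norm z) / 2 \<and> norm (phi t w - phi 0 w) \<le> (12 * norm (P z)) * t"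
  proof (rule path_stays_close[where u = "\<lambda>s. phi s w" and T = t and u' = "\<lambda>s. G (phi s w)"])
    fix s assume s: "s \<in> {0..t}"
    thus "((\<lambda>s. phi s w) has_vector_derivative G (phi s w)) (at s within {0..t})" by (rule phi_ODE[OF w1])
    assume "norm (phi s w - z) < (1 - norm z) / 2"
    hence *: "norm (phi s w - z) \<le> (1 - norm z) / 2" by simp
    show "norm (G (phi s w)) \<le> 12 * norm (P z)"
      using norm_G_le[OF P_local(1)[OF z *]] P_local(2)[OF z *] by linarith
  next
    show "norm (phi 0 w - z) + 12 * norm (P z) * t < (1 - norm z) / 2"
      using w t(2) phi_0[OF w1] by (simp add: field_simps)
  qed (use t in auto)
  thus "norm (phi t w - w) \<le> 12 * norm (P z) * t" "norm (phi t w - z) < (1 - norm z) / 2"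
    using phi_0[OF w1] by auto
qed

text \<open>The speed is controlled by \<open>P\<close> at the end point, so the orbit is run
  backwards from there. This serves the case in which closeness to a peak is known only for the
  moved point.\<close>

lemma displacement_backward:
  assumes w: "norm w < 1" and t: "0 \<le> t" "48 * norm (P (phi t w)) * t < 1 - norm (phi t w)"
  shows "norm (phi t w - w) \<le> 12 * norm (P (phi t w)) * t"
proof -
  define z where "z = phi t w"
  have z: "norm z < 1" unfolding z_def by (rule phi_disc[OF t(1) w])
  have "norm (phi (t - t) w - z) < (1 - norm z) / 2 \<and> norm (phi (t - t) w - phi (t - 0) w) \<le> (12 * norm (P z)) * t"
  proof (rule path_stays_close[where u = "\<lambda>s. phi (t - s) w" and T = t and u' = "\<lambda>s. - G (phi (t - s) w)"])
    fix s assume s: "s \<in> {0..t}"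
    have 1: "((\<lambda>s. t - s) has_vector_derivative -1) (at s within {0..t})"
      by (auto intro!: derivative_eq_intros)
    have "(\<lambda>s. t - s) ` {0..t} \<subseteq> {0..t}" by auto
    note sub = this
    have 2: "((\<lambda>s. phi s w) has_vector_derivative G (phi (t - s) w)) (at (t - s) within (\<lambda>s. t - s) ` {0..t})"
      by (rule has_vector_derivative_within_subset[OF phi_ODE[OF w, of "t - s" t] sub]) (use s in auto)
    from vector_diff_chain_within[OF 1 2]
    show "((\<lambda>s. phi (t - s) w) has_vector_derivative - G (phi (t - s) w)) (at s within {0..t})"
      by (simp add: o_def)
    assume "norm (phi (t - s) w - z) < (1 - norm z) / 2"
    hence *: "norm (phi (t - s) w - z) \<le> (1 - norm z) / 2" by simp
    show "norm (- G (phi (t - s) w)) \<le> 12 * norm (P z)"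
      using norm_G_le[OF P_local(1)[OF z *]] P_local(2)[OF z *] by simp
  next
    show "norm (phi (t - 0) w - z) + 12 * norm (P z) * t < (1 - norm z) / 2"
      using t(2) z unfolding z_def by simp
  qed (use t in auto)
  thus ?thesis using phi_0[OF w] by (simp add: z_def norm_minus_commute)
qed

text \<open>The factor \<open>z - b\<close> of \<open>G\<close> cancels, so the integrand extends
  holomorphically over \<open>b\<close> to a function \<open>k\<close> without singularities, and
  the disc is convex.\<close>

lemma g_symbol_deriv:
  assumes z: "norm z < 1"
  shows "(g_symbol G b has_field_derivative - 1 / ((1 - cnj b * z) * P z)) (at z)"
proof -
  define k where "k w = - 1 / ((1 - cnj b * w) * P w)" for w
  have khol: "k holomorphic_on unit_disc" unfolding k_def
    using one_minus_cnj_mult_ne[OF b_disc] P_ne by (intro holomorphic_intros P_hol) auto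
  obtain g where g: "\<And>x. x \<in> unit_disc \<Longrightarrow> (g has_field_derivative k x) (at x within unit_disc)"
    using holomorphic_convex_primitive'[OF convex_ball open_ball khol] by blast
  have eq: "g_symbol G b w = g w - g b" if w: "w \<in> unit_disc" for w
  proof (cases "w = b")
    case True thus ?thesis by (simp add: g_symbol_def)
  next
    case False
    have "closed_segment b w \<subseteq> unit_disc"
      by (rule closed_segment_subset) (use w b_disc in auto)
    hence "(k has_contour_integral g w - g b) (linepath b w)"
      using contour_integral_primitive[of unit_disc g k "linepath b w"] g by simp
    hence "((\<lambda>x. k (linepath b w x) * (w - b)) has_integral g w - g b) {0..1}"
      by (simp add: has_contour_integral_linepath)
    hence "((\<lambda>x. (linepath b w x - b) / G (linepath b w x) * (w - b)) has_integral g w - g b) {0..1}"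
    proof (rule has_integral_spike[of "{0}", rotated 2])
      \<comment> \<open>At x = 0 the path is at \<open>b\<close>, where the integrand is 0 / 0 and
        so takes the value 0 instead of that of \<open>k\<close>; a single point does not affect the
        integral.\<close>
      fix x :: real assume x: "x \<in> {0..1} - {0}"
      let ?u = "linepath b w x"
      have ub: "?u \<noteq> b" using x False by (simp add: linepath_def algebra_simps) 
      have "?u \<in> closed_segment b w" using x unfolding linepath_image_01[symmetric] by auto
      hence u: "norm ?u < 1" using \<open>closed_segment b w \<subseteq> unit_disc\<close> by auto
      show "(?u - b) / G ?u * (w - b) = k ?u * (w - b)"
      proof -
        have *: "x / (- x * c * p) * y = - 1 / (c * p) * y" if "x \<noteq> 0" "c \<noteq> 0" "p \<noteq> 0" for x c p y :: complex
          using that by (simp add: field_simps)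
        show ?thesis unfolding k_def G_eq[OF u]
          by (rule *) (use ub one_minus_cnj_mult_ne[OF b_disc u] P_ne[OF u] in auto)
      qed
    qed auto
    hence "((\<lambda>w. (w - b) / G w) has_contour_integral g w - g b) (linepath b w)"
      by (simp add: has_contour_integral_linepath)
    thus ?thesis unfolding g_symbol_def by (rule contour_integral_unique)
  qed
  have "((\<lambda>w. g w - g b) has_field_derivative k z - 0) (at z)"
    using g[of z] z by (intro derivative_intros) (simp add: at_within_open[OF _ open_ball])
  hence "((\<lambda>w. g w - g b) has_field_derivative k z) (at z)" by simp
  hence "(g_symbol G b has_field_derivative k z) (at z)"
    by (rule has_field_derivative_transform_within_open[OF _ open_ball[of 0 1]]) (use z eq in auto)
  thus ?thesis by (simp add: k_def)
qed

text \<open>\<open>1 - cnj b * z\<close> has modulus between \<open>1 - norm b\<close> and 2, so the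
  derivative of the g-symbol is comparable to \<open>1 / norm (P z)\<close>. The condition says that
  the time scale of the flow at \<open>z\<close> tends to 0.\<close>

lemma little_bloch_iff:
  "g_symbol G b \<in> little_bloch \<longleftrightarrow>
     (\<forall>e>0. \<exists>r<1. \<forall>z. r < norm z \<and> norm z < 1 \<longrightarrow> 1 - norm z \<le> e * norm (P z))"
proof -
  have hol: "g_symbol G b holomorphic_on unit_disc"
    unfolding holomorphic_on_open[OF open_ball] by (intro ballI exI) (rule g_symbol_deriv, simp)
  have d: "norm (deriv (g_symbol G b) z) = 1 / (norm (1 - cnj b * z) * norm (P z))" if "norm z < 1" for z
    using DERIV_imp_deriv[OF g_symbol_deriv[OF that]] by (simp add: norm_divide norm_mult)
  have lo: "1 - norm b \<le> norm (1 - cnj b * z)" and up: "norm (1 - cnj b * z) \<le> 2" if "norm z < 1" for z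
    using one_minus_cnj_mult_lower[of b z] one_minus_cnj_mult_upper[of b z] mult_left_le[of "norm z" "norm b"] that b_disc
    by auto
  show ?thesis
  proof
    assume L: "g_symbol G b \<in> little_bloch"
    show "\<forall>e>0. \<exists>r<1. \<forall>z. r < norm z \<and> norm z < 1 \<longrightarrow> 1 - norm z \<le> e * norm (P z)"
    proof (intro allI impI)
      fix e :: real assume "e > 0"
      hence e2: "e / 2 > 0" by simp
      have "\<forall>e>0. \<exists>r<1. \<forall>z. r < norm z \<and> norm z < 1 \<longrightarrow>
          (1 - (norm z)\<^sup>2) * norm (deriv (g_symbol G b) z) < e"
        using L by (simp add: little_bloch_def)
      from this[rule_format, OF e2] obtain r where r: "r < 1" "\<And>z. r < norm z \<Longrightarrow> norm z < 1 \<Longrightarrow>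
          (1 - (norm z)\<^sup>2) * norm (deriv (g_symbol G b) z) < e / 2"
        by blast
      have "1 - norm z \<le> e * norm (P z)" if z: "r < norm z" "norm z < 1" for z
      proof -
        have pos: "0 < norm (1 - cnj b * z) * norm (P z)"
          using P_ne[OF z(2)] one_minus_cnj_mult_ne[OF b_disc z(2)] by simp
        have "(1 - (norm z)\<^sup>2) < e / 2 * (norm (1 - cnj b * z) * norm (P z))"
          using r(2)[OF z] pos unfolding d[OF z(2)] by (simp add: divide_less_eq)
        also have "\<dots> \<le> e / 2 * (2 * norm (P z))"
          using up[OF z(2)] \<open>e > 0\<close> by (intro mult_left_mono mult_right_mono) auto
        finally have "1 - (norm z)\<^sup>2 < e * norm (P z)" by simp
        moreover have "(norm z)\<^sup>2 \<le> norm z" using z by (simp add: power2_eq_square mult_left_le)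
        ultimately show ?thesis by linarith
      qed
      thus "\<exists>r<1. \<forall>z. r < norm z \<and> norm z < 1 \<longrightarrow> 1 - norm z \<le> e * norm (P z)" using r(1) by blast
    qed
  next
    assume R: "\<forall>e>0. \<exists>r<1. \<forall>z. r < norm z \<and> norm z < 1 \<longrightarrow> 1 - norm z \<le> e * norm (P z)"
    have "\<exists>r<1. \<forall>z. r < norm z \<and> norm z < 1 \<longrightarrow> (1 - (norm z)\<^sup>2) * norm (deriv (g_symbol G b) z) < e" if e: "e > 0" for e
    proof -
      define e' where "e' = e * (1 - norm b) / 4"
      have "e' > 0" using e b_disc by (simp add: e'_def)
      with R obtain r where r: "r < 1" "\<And>z. r < norm z \<Longrightarrow> norm z < 1 \<Longrightarrow> 1 - norm z \<le> e' * norm (P z)" by blast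
      have "(1 - (norm z)\<^sup>2) * norm (deriv (g_symbol G b) z) < e" if z: "r < norm z" "norm z < 1" for z
      proof -
        have Pp: "0 < norm (P z)" using P_ne[OF z(2)] by simp
        have pos: "0 < norm (1 - cnj b * z) * norm (P z)"
          using P_ne[OF z(2)] one_minus_cnj_mult_ne[OF b_disc z(2)] by simp
        have "1 - (norm z)\<^sup>2 = (1 + norm z) * (1 - norm z)" by (simp add: power2_eq_square algebra_simps)
        also have "\<dots> \<le> 2 * (1 - norm z)" using z by (intro mult_right_mono) auto
        also have "\<dots> \<le> 2 * (e' * norm (P z))" using r(2)[OF z] by simp
        also have "\<dots> = e / 2 * ((1 - norm b) * norm (P z))" by (simp add: e'_def)
        also have "\<dots> \<le> e / 2 * (norm (1 - cnj b * z) * norm (P z))"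
          using lo[OF z(2)] e by (intro mult_left_mono mult_right_mono) auto
        also have "\<dots> < e * (norm (1 - cnj b * z) * norm (P z))"
          using pos e by (intro mult_strict_right_mono) auto
        finally show ?thesis using pos unfolding d[OF z(2)] by (simp add: divide_less_eq)
      qed
      thus ?thesis using r(1) by blast
    qed
    thus "g_symbol G b \<in> little_bloch" using hol by (auto simp: little_bloch_def)
  qed
qed

end

section \<open>Composition operators and the inclusion of the little space\<close>

text \<open>If the sum exceeded 8 times the average W on all of \<open>{0..t0}\<close>, its integral
  there would be at least 8 t0 W. But the integrals of \<open>h\<close> and of its shift over
  \<open>{0..t0}\<close> are each at most the integral of \<open>h\<close> over
  \<open>{0..2*t0}\<close>, which is 2 t0 W. One \<open>s\<close> thus serves both times.\<close>

lemma pigeonhole_shift: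
  fixes h :: "real \<Rightarrow> ennreal"
  assumes [measurable]: "h \<in> borel_measurable borel" and t0: "0 < t0" and \<sigma>: "0 \<le> \<sigma>" "\<sigma> \<le> t0"
  obtains s where "s \<in> {0..t0}"
    "h s + h (s + \<sigma>) \<le> 8 * (\<integral>\<^sup>+s. h s \<partial>uniform_measure lborel {0..2*t0})"
proof (rule ccontr)
  define W where "W = (\<integral>\<^sup>+s. h s \<partial>uniform_measure lborel {0..2*t0})"
  define I where "I = (\<integral>\<^sup>+s. h s * indicator {0..2*t0} s \<partial>lborel)"
  have "W = I / ennreal (2 * t0)" unfolding W_def I_def
    using t0 by (subst nn_integral_uniform_measure) auto
  hence I: "I = ennreal (2 * t0) * W"
    using t0 by (simp add: ennreal_times_divide ennreal_mult_divide_eq mult.commute)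
  assume "\<not> thesis"
  with that have gt: "8 * W < h s + h (s + \<sigma>)" if "s \<in> {0..t0}" for s
    using that unfolding W_def[symmetric] by (meson linorder_not_le)
  have "(\<integral>\<^sup>+s. h (s + \<sigma>) * indicator {0..t0} s \<partial>lborel) \<le> (\<integral>\<^sup>+s. h (s + \<sigma>) * indicator {0..2*t0} (s + \<sigma>) \<partial>lborel)"
    using \<sigma> by (intro nn_integral_mono) (auto simp: indicator_def)
  also have "\<dots> = I"
    unfolding I_def using nn_integral_real_affine[of "\<lambda>s. h s * indicator {0..2*t0} s" 1 \<sigma>]
    by (simp add: add.commute)
  finally have 1: "(\<integral>\<^sup>+s. h (s + \<sigma>) * indicator {0..t0} s \<partial>lborel) \<le> I" .
  have 2: "(\<integral>\<^sup>+s. h s * indicator {0..t0} s \<partial>lborel) \<le> I" unfolding I_def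
    using t0 by (intro nn_integral_mono) (auto simp: indicator_def)
  have "(\<integral>\<^sup>+s. (h s + h (s + \<sigma>)) * indicator {0..t0} s \<partial>lborel) =
      (\<integral>\<^sup>+s. h s * indicator {0..t0} s \<partial>lborel) + (\<integral>\<^sup>+s. h (s + \<sigma>) * indicator {0..t0} s \<partial>lborel)"
    by (subst nn_integral_add[symmetric]) (auto simp: distrib_right)
  also have "\<dots> \<le> I + I" by (rule add_mono[OF 2 1])
  also have "\<dots> = ennreal (4 * t0) * W"
  proof -
    have "I + I = (ennreal (2 * t0) + ennreal (2 * t0)) * W" unfolding I by (simp add: distrib_right)
    also have "ennreal (2 * t0) + ennreal (2 * t0) = ennreal (4 * t0)" using t0 by (simp flip: ennreal_plus)
    finally show ?thesis .
  qed
  finally have up: "(\<integral>\<^sup>+s. (h s + h (s + \<sigma>)) * indicator {0..t0} s \<partial>lborel) \<le> ennreal (4 * t0) * W" .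
  have "ennreal (8 * t0) * W = (\<integral>\<^sup>+s. 8 * W * indicator {0..t0} s \<partial>lborel)"
    using t0 by (subst nn_integral_cmult) (auto simp: ennreal_mult mult_ac)
  also have "\<dots> \<le> (\<integral>\<^sup>+s. (h s + h (s + \<sigma>)) * indicator {0..t0} s \<partial>lborel)"
    using gt by (intro nn_integral_mono) (auto simp: indicator_def less_imp_le)
  finally have le: "ennreal (8 * t0) * W \<le> ennreal (4 * t0) * W" using up by (rule order_trans)
  have "W \<noteq> \<infinity>" using gt[of 0] t0 by (auto simp: ennreal_mult_top)
  then obtain w where w: "W = ennreal w" "0 \<le> w" by (cases W) auto
  \<comment> \<open>The two bounds leave only this value, and then a strictly positive function
    would have integral zero over \<open>{0..t0}\<close>.\<close>
  have "W = 0"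
  proof -
    have "ennreal (8 * t0 * w) \<le> ennreal (4 * t0 * w)" using le w t0 by (simp add: ennreal_mult)
    hence "8 * t0 * w \<le> 4 * t0 * w" using w t0 by (subst (asm) ennreal_le_iff) auto
    hence "w \<le> 0" using t0 by simp
    thus ?thesis using w by simp
  qed
  hence "(\<integral>\<^sup>+s. (h s + h (s + \<sigma>)) * indicator {0..t0} s \<partial>lborel) = 0" using up by simp
  hence "AE s in lborel. (h s + h (s + \<sigma>)) * indicator {0..t0} s = 0"
    by (subst (asm) nn_integral_0_iff_AE) auto
  hence "AE s in lborel. s \<notin> {0..t0}"
    by (rule eventually_mono) (use gt in \<open>force simp: indicator_def split: if_splits\<close>)
  hence "emeasure lborel {s \<in> space lborel. s \<in> {0..t0}} = 0"
    by (rule emeasure_eq_0_AE)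
  hence "emeasure lborel {0..t0} = 0" by (simp add: atLeastAtMost_def atLeast_def atMost_def Int_def)
  thus False using t0 by simp
qed

lemma ennreal_combination:
  assumes "0 \<le> a" "0 \<le> k" "0 \<le> x" "0 \<le> y"
  shows "ennreal (a * (k * x + y)) = ennreal a * (ennreal k * ennreal x + ennreal y)"
  using assms by (simp add: ennreal_mult ennreal_plus)

text \<open>The radius \<open>(1 - norm z) / 2\<close> exceeds half the distance from
  \<open>z\<close> to the circle of radius \<open>R\<close>, so Harnack is applied twice through the
  midpoint \<open>m\<close>: 144 = 12 * 12.\<close>

lemma pint_Harnack2:
  assumes z: "norm z < 1" and R: "R < 1" "1 - R \<le> (1 - norm z) / 8" and w: "norm (w - z) \<le> (1 - norm z) / 2"
    and g: "g \<in> borel_measurable borel"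
  shows "pint R g w \<le> 144 * pint R g z" "norm w < R"
proof -
  define m where "m = (z + w) / 2"
  have mz: "norm (m - z) \<le> (1 - norm z) / 4" and wm: "norm (w - m) \<le> (1 - norm z) / 4"
  proof -
    have "m - z = (w - z) / 2" "w - m = (w - z) / 2" by (auto simp: m_def field_simps)
    hence "norm (m - z) = norm (w - z) / 2" "norm (w - m) = norm (w - z) / 2"
      by (simp_all only: norm_divide norm_numeral)
    thus "norm (m - z) \<le> (1 - norm z) / 4" "norm (w - m) \<le> (1 - norm z) / 4"
      using w by (simp_all add: field_simps)
  qed
  have m: "norm m \<le> norm z + (1 - norm z) / 4" using norm_triangle_ineq[of z "m - z"] mz by (simp add: field_simps)
  have zR: "norm z < R" and mR: "norm m < R" using R z m by (auto simp: field_simps)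
  have "pint R g w \<le> 12 * pint R g m"
    by (rule pint_Harnack[OF mR _ g]) (use wm m R z in \<open>auto simp: field_simps\<close>)
  also have "\<dots> \<le> 12 * (12 * pint R g z)"
    by (intro mult_left_mono pint_Harnack[OF zR _ g]) (use mz R z in \<open>auto simp: field_simps\<close>)
  finally show "pint R g w \<le> 144 * pint R g z" by (simp add: mult.assoc[symmetric])
  show "norm w < R" using norm_triangle_ineq[of z "w - z"] w R z by (simp add: field_simps)
qed

text \<open>Each use of the recursion moves away from the boundary by the factor 4/3. The number of
  steps available grows as \<open>d\<close> shrinks, so the a priori bound \<open>B\<close> enters
  with an arbitrarily high power of \<mu>, while the errors sum to at most
  \<open>c / (1 - \<mu>)\<close>.\<close>

lemma geometric_recursion:
  fixes X :: "real \<Rightarrow> real"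
  assumes rec: "\<And>d. 0 < d \<Longrightarrow> d \<le> d0 \<Longrightarrow> X d \<le> \<mu> * X (4/3 * d) + c"
    and bd: "\<And>d. 0 < d \<Longrightarrow> d \<le> 4/3 * d0 \<Longrightarrow> X d \<le> B" and \<mu>: "0 \<le> \<mu>" "\<mu> < 1" and B: "0 \<le> B" and c: "0 < c" and d0: "0 < d0"
  obtains d1 where "0 < d1" "\<And>d. 0 < d \<Longrightarrow> d \<le> d1 \<Longrightarrow> X d \<le> 2 * c / (1 - \<mu>)"
proof -
  have *: "\<forall>d. 0 < d \<and> d \<le> 4/3 * (3/4) ^ n * d0 \<longrightarrow> X d \<le> \<mu> ^ n * B + c / (1 - \<mu>)" for n
  proof (induction n)
    case 0
    have c0: "0 \<le> c / (1 - \<mu>)" using c \<mu> by simp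
    show ?case
    proof (intro allI impI)
      fix d :: real assume "0 < d \<and> d \<le> 4/3 * (3/4) ^ 0 * d0"
      hence "X d \<le> B" by (intro bd) auto
      thus "X d \<le> \<mu> ^ 0 * B + c / (1 - \<mu>)" using c0 by simp
    qed
  next
    case (Suc n)
    show ?case
    proof (intro allI impI)
      fix d :: real assume d: "0 < d \<and> d \<le> 4/3 * (3/4) ^ Suc n * d0"
      hence "4/3 * d \<le> 4/3 * (3/4) ^ n * d0" by simp
      hence X43: "X (4/3 * d) \<le> \<mu> ^ n * B + c / (1 - \<mu>)" using Suc d by simp
      have "d \<le> d0"
      proof -
        have "(3/4::real) ^ n \<le> 1" by (simp add: power_le_one)
        hence "(3/4::real) ^ n * d0 \<le> 1 * d0" using d0 by (intro mult_right_mono) auto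
        thus ?thesis using d by simp
      qed
      hence "X d \<le> \<mu> * X (4/3 * d) + c" using rec d by blast
      hence "X d \<le> \<mu> * (\<mu> ^ n * B + c / (1 - \<mu>)) + c"
        using mult_left_mono[OF X43 \<mu>(1)] by linarith
      also have "\<dots> = \<mu> ^ Suc n * B + c / (1 - \<mu>)" using \<mu> by (simp add: field_simps)
      finally show "X d \<le> \<mu> ^ Suc n * B + c / (1 - \<mu>)" .
    qed
  qed
  have "(\<lambda>n. \<mu> ^ n * B) \<longlonglongrightarrow> 0 * B" by (intro tendsto_intros LIMSEQ_realpow_zero \<mu>)
  moreover have "0 < c / (1 - \<mu>)" using c \<mu> by simp
  ultimately have "eventually (\<lambda>n. \<mu> ^ n * B < c / (1 - \<mu>)) sequentially"
    by (intro order_tendstoD(2)[of _ "0 * B"]) auto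
  then obtain n where n: "\<mu> ^ n * B < c / (1 - \<mu>)" by (auto simp: eventually_sequentially)
  show thesis
  proof (rule that[of "4/3 * (3/4) ^ n * d0"])
    fix d assume "0 < d" "d \<le> 4/3 * (3/4) ^ n * d0"
    hence "X d \<le> \<mu> ^ n * B + c / (1 - \<mu>)" using * by blast
    also have "\<dots> \<le> c / (1 - \<mu>) + c / (1 - \<mu>)" using n by simp
    finally show "X d \<le> 2 * c / (1 - \<mu>)" by simp
  qed (use d0 in auto)
qed

context interior_semigroup
begin

text \<open>Half of \<open>cb\<close> makes the inequality strict: the moved circle must lie inside
  the circle carrying the Poisson integral. It also leaves the gap \<open>cb / 2\<close> around
  \<open>phi t 0\<close> used in \<open>pmean_phi_le\<close>.\<close>

lemma compose_radius:
  assumes t: "0 \<le> t" and r: "0 \<le> r" "r < 1" and z: "norm z \<le> r"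
  shows "norm (phi t z) < 1 - cb / 2 * (1 - r)"
proof -
  have "cb / 2 * (1 - r) < cb * (1 - r)" using cb_pos r by simp
  also have "\<dots> \<le> cb * (1 - norm z)" using cb_pos z by (intro mult_left_mono) auto
  also have "\<dots> \<le> 1 - norm (phi t z)" by (rule phi_boundary_distance) (use t z r in auto)
  finally show ?thesis by simp
qed

lemma radius_bounds:
  assumes r: "0 \<le> r" "r < 1"
  shows "r \<le> 1 - cb / 2 * (1 - r)" "1 - cb / 2 * (1 - r) < 1" "0 \<le> 1 - cb / 2 * (1 - r)"
proof -
  have "cb / 2 * (1 - r) \<le> 1 * (1 - r)" using cb_half r by (intro mult_right_mono) auto
  thus 1: "r \<le> 1 - cb / 2 * (1 - r)" by simp
  show "1 - cb / 2 * (1 - r) < 1" using cb_pos r by simp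
  show "0 \<le> 1 - cb / 2 * (1 - r)" using 1 r by linarith
qed

lemma pmean_phi_le:
  assumes p: "0 < p" and f: "f holomorphic_on unit_disc" and t: "0 \<le> t" and r: "0 \<le> r" "r < 1"
  shows "pmean p r (\<lambda>z. f (phi t z)) \<le> ennreal (4 / cb) * pmean p (1 - cb / 2 * (1 - r)) f"
proof -
  let ?R = "1 - cb / 2 * (1 - r)"
  have "pmean p r (\<lambda>z. f (phi t z)) \<le> ennreal ((?R + norm (phi t 0)) / (?R - norm (phi t 0))) * pmean p ?R f"
    by (rule pmean_compose_le[OF p f phi_hol[OF t] r compose_radius[OF t r] radius_bounds(2)[OF r]])
  also have "(?R + norm (phi t 0)) / (?R - norm (phi t 0)) \<le> 2 / (cb / 2)"
  proof (rule frac_le)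
    have 1: "norm (phi t 0) \<le> 1 - cb" using phi_boundary_distance[OF t, of 0] by simp
    have "cb / 2 * (1 - r) \<le> cb / 2 * 1" using cb_pos r by (intro mult_left_mono) auto
    thus "cb / 2 \<le> ?R - norm (phi t 0)" using 1 by linarith
    show "?R + norm (phi t 0) \<le> 2" using 1 cb_pos radius_bounds(2)[OF r] by linarith
  qed (use cb_pos in auto)
  hence "ennreal ((?R + norm (phi t 0)) / (?R - norm (phi t 0))) * pmean p ?R f \<le> ennreal (4 / cb) * pmean p ?R f"
    by (intro mult_right_mono ennreal_leI) auto
  finally show ?thesis .
qed

definition comp_const :: "ereal \<Rightarrow> real \<Rightarrow> real" where
  "comp_const p \<alpha> = 4 / cb * (2 / cb) powr (\<alpha> * qexp p)"

lemma comp_const_pos: "0 < comp_const p \<alpha>"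
  using cb_pos by (simp add: comp_const_def)

lemma wmean_phi_le:
  assumes p: "0 < p" and f: "f holomorphic_on unit_disc" and t: "0 \<le> t" and r: "0 \<le> r" "r < 1"
  shows "wmean p \<alpha> r (\<lambda>z. f (phi t z)) \<le> ennreal (comp_const p \<alpha>) * wmean p \<alpha> (1 - cb / 2 * (1 - r)) f"
proof -
  let ?R = "1 - cb / 2 * (1 - r)" and ?a = "\<alpha> * qexp p"
  have e: "(1 - r) powr ?a = (2 / cb) powr ?a * (1 - ?R) powr ?a"
  proof -
    have "(2 / cb) powr ?a * (1 - ?R) powr ?a = (2 / cb * (cb / 2 * (1 - r))) powr ?a"
      using cb_pos r by (simp only: powr_mult[symmetric]) simp
    also have "2 / cb * (cb / 2 * (1 - r)) = 1 - r" using cb_pos by simp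
    finally show ?thesis by simp
  qed
  have "wmean p \<alpha> r (\<lambda>z. f (phi t z)) \<le> ennreal ((1 - r) powr ?a) * (ennreal (4 / cb) * pmean p ?R f)"
    unfolding wmean_def by (intro mult_left_mono pmean_phi_le assms) auto
  also have "\<dots> = ennreal (comp_const p \<alpha>) * wmean p \<alpha> ?R f"
  proof -
    have 1: "ennreal (comp_const p \<alpha>) = ennreal (4 / cb) * ennreal ((2 / cb) powr ?a)"
      unfolding comp_const_def using cb_pos by (intro ennreal_mult) auto
    have 2: "ennreal ((1 - r) powr ?a) = ennreal ((2 / cb) powr ?a) * ennreal ((1 - ?R) powr ?a)"
      unfolding e by (intro ennreal_mult) auto
    show ?thesis unfolding wmean_def 1 2 by (simp only: mult_ac)
  qed
  finally show ?thesis .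
qed

lemma phi_compose_hol: "f holomorphic_on unit_disc \<Longrightarrow> 0 \<le> t \<Longrightarrow> (\<lambda>z. f (phi t z)) holomorphic_on unit_disc"
  using holomorphic_on_compose_gen[OF phi_hol, of t f unit_disc] phi_disc by (auto simp: o_def image_subset_iff)

lemma strong_cont_iff:
  assumes p: "0 < p"
  shows "f \<in> strong_cont_space phi p \<alpha> \<longleftrightarrow> f \<in> H_inf p \<alpha> \<and>
    (\<forall>e>0. \<exists>d>0. \<forall>t. 0 < t \<and> t < d \<longrightarrow> (\<forall>r\<in>{0..<1}. wmean p \<alpha> r (\<lambda>z. f (phi t z) - f z) \<le> ennreal e))"
proof (cases "f \<in> H_inf p \<alpha>")
  case True
  hence f: "f holomorphic_on unit_disc" by (simp add: H_inf_def)
  have "eventually (\<lambda>t. continuous_on unit_disc (\<lambda>z. f (phi t z) - f z)) (at_right 0)"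
    unfolding eventually_at_right_field
    by (intro exI[of _ 1] conjI allI impI holomorphic_on_imp_continuous_on holomorphic_intros phi_compose_hol f) auto
  from Hnorm_tendsto_0_iff[OF p this] show ?thesis using True
    unfolding strong_cont_space_def eventually_at_right_field by (simp add: imp_conjL)
qed (simp add: strong_cont_space_def)

text \<open>The radii are split at \<open>r0\<close>. On smaller circles \<open>phi t\<close> tends
  to the identity uniformly and \<open>f\<close> is uniformly continuous; on larger ones the means
  of \<open>f\<close> and of \<open>f\<close> composed with \<open>phi t\<close> are both small,
  since the comparison radius \<open>1 - cb / 2 * (1 - r)\<close> is at least
  \<open>r\<close>.\<close>

theorem H_zero_subset_strong_cont:
  assumes p: "0 < p" and \<alpha>: "0 < \<alpha>"
  shows "H_zero p \<alpha> \<subseteq> strong_cont_space phi p \<alpha>"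
proof
  fix f assume fz: "f \<in> H_zero p \<alpha>"
  hence fi: "f \<in> H_inf p \<alpha>" and f: "f holomorphic_on unit_disc" by (auto simp: H_zero_def H_inf_def)
  have fc: "continuous_on unit_disc f" using f by (rule holomorphic_on_imp_continuous_on)
  have q: "qexp p > 0" by (rule qexp_pos[OF p])
  have "\<exists>d>0. \<forall>t. 0 < t \<and> t < d \<longrightarrow> (\<forall>r\<in>{0..<1}. wmean p \<alpha> r (\<lambda>z. f (phi t z) - f z) \<le> ennreal e)" if e: "0 < e" for e
  proof -
    define D where "D = 2 powr qexp p * (comp_const p \<alpha> + 1)"
    define e1 where "e1 = e / D"
    have e1: "0 < e1" "2 powr qexp p * (comp_const p \<alpha> * e1 + e1) = e"
    proof -
      have K: "0 < D" using comp_const_pos[of p \<alpha>] unfolding D_def by simp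
      show "0 < e1" using e K unfolding e1_def by simp
      have "2 powr qexp p * (comp_const p \<alpha> * e1 + e1) = D * e1" by (simp add: D_def algebra_simps)
      thus "2 powr qexp p * (comp_const p \<alpha> * e1 + e1) = e" using K unfolding e1_def by simp
    qed
    from fz e1(1) obtain r0' where r0': "r0' < 1" "\<And>r. r0' < r \<Longrightarrow> 0 \<le> r \<Longrightarrow> r < 1 \<Longrightarrow> wmean p \<alpha> r f \<le> ennreal e1"
      unfolding H_zero_iff[OF p \<alpha>] by blast
    define r0 where "r0 = max 0 r0'"
    have r0: "0 \<le> r0" "r0 < 1" "\<And>r. r0 < r \<Longrightarrow> r < 1 \<Longrightarrow> wmean p \<alpha> r f \<le> ennreal e1"
      using r0' by (auto simp: r0_def)
    define B where "B = e powr (1 / qexp p)"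
    have B: "0 < B" "B powr qexp p = e" using e q by (auto simp: B_def powr_powr)
    have "uniformly_continuous_on (cball 0 ((1 + r0) / 2)) f"
      by (intro compact_uniformly_continuous continuous_on_subset[OF fc]) (use r0 in auto)
    then obtain c where c: "0 < c" "\<And>x y. norm x \<le> (1 + r0) / 2 \<Longrightarrow> norm y \<le> (1 + r0) / 2 \<Longrightarrow> dist y x < c \<Longrightarrow> dist (f y) (f x) < B"
      using B(1) unfolding uniformly_continuous_on_def by (metis mem_cball_0)
    \<comment> \<open>The second entry keeps \<open>phi t z\<close> in the disc of radius
      \<open>(1 + r0) / 2\<close>, on which \<open>f\<close> is uniformly continuous.\<close>
    have c': "0 < min c ((1 - r0) / 2)" using c(1) r0 by simp
    obtain d where d: "0 < d" "\<And>t z. 0 < t \<Longrightarrow> t < d \<Longrightarrow> norm z \<le> r0 \<Longrightarrow> norm (phi t z - z) < min c ((1 - r0) / 2)"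
      using phi_uniform[OF r0(2) c'] by blast
    have "wmean p \<alpha> r (\<lambda>z. f (phi t z) - f z) \<le> ennreal e" if t: "0 < t" "t < d" and r: "r \<in> {0..<1}" for t r
    proof (cases "r \<le> r0")
      case True
      have "wmean p \<alpha> r (\<lambda>z. f (phi t z) - f z) \<le> ennreal (B powr qexp p)"
      proof (rule wmean_le_sup[OF p])
        fix z :: complex assume z: "norm z = r"
        have 1: "norm (phi t z - z) < min c ((1 - r0) / 2)" using d(2)[OF t, of z] z True by simp
        have "norm (phi t z) \<le> norm z + norm (phi t z - z)" using norm_triangle_ineq[of z "phi t z - z"] by simp
        also have "\<dots> \<le> r0 + (1 - r0) / 2" using 1 z True by (simp add: field_simps)
        also have "\<dots> = (1 + r0) / 2" by (simp add: field_simps)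
        finally have 2: "norm (phi t z) \<le> (1 + r0) / 2" .
        have "dist (f (phi t z)) (f z) < B"
          by (rule c(2)) (use 1 2 z True r0 in \<open>auto simp: dist_norm\<close>)
        thus "norm (f (phi t z) - f z) \<le> B" by (simp add: dist_norm)
      qed (use \<alpha> r in auto)
      thus ?thesis using B by simp
    next
      case False
      have r': "0 \<le> r" "r < 1" using r by auto
      have "wmean p \<alpha> r (\<lambda>z. f (phi t z) - f z) \<le> ennreal (2 powr qexp p) * (wmean p \<alpha> r (\<lambda>z. f (phi t z)) + wmean p \<alpha> r f)"
        by (intro wmean_add_le p holomorphic_on_imp_continuous_on phi_compose_hol f r' norm_triangle_ineq4) (use t in auto)
      also have "\<dots> \<le> ennreal (2 powr qexp p) * (ennreal (comp_const p \<alpha>) * ennreal e1 + ennreal e1)"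
      proof (intro mult_left_mono add_mono)
        have "wmean p \<alpha> r (\<lambda>z. f (phi t z)) \<le> ennreal (comp_const p \<alpha>) * wmean p \<alpha> (1 - cb / 2 * (1 - r)) f"
          by (rule wmean_phi_le[OF p f]) (use t r in auto)
        also have "\<dots> \<le> ennreal (comp_const p \<alpha>) * ennreal e1"
          using radius_bounds[OF r'] False by (intro mult_left_mono r0) auto
        finally show "wmean p \<alpha> r (\<lambda>z. f (phi t z)) \<le> ennreal (comp_const p \<alpha>) * ennreal e1" .
        show "wmean p \<alpha> r f \<le> ennreal e1" using r0(3)[of r] False r' by simp
      qed auto
      also have "\<dots> = ennreal (2 powr qexp p * (comp_const p \<alpha> * e1 + e1))"
        by (rule ennreal_combination[symmetric]) (use e1 comp_const_pos[of p \<alpha>] in auto)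
      finally show ?thesis using e1 by simp
    qed
    thus ?thesis using d(1) by blast
  qed
  thus "f \<in> strong_cont_space phi p \<alpha>" unfolding strong_cont_iff[OF p] using fi by blast
qed

end

section \<open>Strong continuity when the symbol is little Bloch\<close>

context interior_semigroup_P
begin

lemma norm_G_ge:
  assumes z: "norm z < 1" "(1 + norm b) / 2 \<le> norm z"
  shows "(1 - norm b)\<^sup>2 / 2 * norm (P z) \<le> norm (G z)"
proof -
  have 1: "(1 - norm b) / 2 \<le> norm (z - b)"
    using norm_triangle_ineq2[of z b] z by (simp add: field_simps)
  have 2: "1 - norm b \<le> norm (1 - cnj b * z)"
    using one_minus_cnj_mult_lower[of b z] mult_left_le[of "norm z" "norm b"] z by simp
  have "(1 - norm b)\<^sup>2 / 2 = (1 - norm b) / 2 * (1 - norm b)" by (simp add: power2_eq_square)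
  also have "\<dots> \<le> norm (z - b) * norm (1 - cnj b * z)"
    using 1 2 b_disc by (intro mult_mono) auto
  finally have "(1 - norm b)\<^sup>2 / 2 * norm (P z) \<le> norm (z - b) * norm (1 - cnj b * z) * norm (P z)"
    by (intro mult_right_mono) auto
  also have "\<dots> = norm (G z)" unfolding G_eq[OF z(1)] norm_mult norm_minus_cancel ..
  finally show ?thesis .
qed

text \<open>\<open>deriv f * G\<close> is the derivative of \<open>f\<close> along the flow, and
  this derivation commutes with composition by \<open>phi s\<close>.\<close>

lemma deriv_compose_phi_G:
  assumes f: "f holomorphic_on unit_disc" and s: "0 \<le> s" and z: "norm z < 1"
  shows "deriv (\<lambda>w. f (phi s w)) z * G z = deriv f (phi s z) * G (phi s z)"
proof -
  have "deriv (f \<circ> phi s) z = deriv f (phi s z) * deriv (phi s) z"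
    by (rule deriv_chain)
       (use holomorphic_on_imp_differentiable_at[OF phi_hol[OF s]] holomorphic_on_imp_differentiable_at[OF f]
          phi_disc[OF s] z in auto)
  thus ?thesis using deriv_phi_G[OF s z] by (simp add: o_def mult.assoc)
qed

text \<open>192 = 2 * 96 comes from the bound 2 M on the change of \<open>f\<close> over the time
  \<open>(1 - norm z) / (96 * norm (P z))\<close>, divided by the lower bound
  \<open>norm_G_ge\<close> for the speed. 8 = 2 * 4 comes from Cauchy's inequality on a disc of
  radius \<open>(1 - norm z) / 4\<close>.\<close>

definition derivC :: real where
  "derivC = 192 / ((1 - norm b)\<^sup>2 / 2) + 8"

lemma derivC_pos: "0 < derivC"
  using b_disc unfolding derivC_def by (intro add_nonneg_pos divide_nonneg_nonneg) auto

text \<open>The cocycle identity \<open>F \<sigma> = F (s + \<sigma>) - F s \<circ> phi \<sigma>\<close> for \<open>F s = f \<circ> phi s - f\<close> transfers the bound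
  from two suitable times s and \<open>s + \<sigma>\<close> to every \<open>\<sigma>\<close> up to the time scale \<open>(1 - |z|) / |P z|\<close> of the flow at z.
  On that scale \<open>G * f'\<close> is nearly constant along the orbit of z.\<close>

lemma deriv_le_oscillation:
  assumes f: "f holomorphic_on unit_disc" and z: "norm z < 1" "(1 + norm b) / 2 \<le> norm z" and M: "0 \<le> M"
    and osc: "\<And>\<sigma>. 0 \<le> \<sigma> \<Longrightarrow> \<sigma> \<le> (1 - norm z) / (96 * norm (P z)) \<Longrightarrow>
      \<exists>s\<ge>0. \<forall>w. norm (w - z) \<le> (1 - norm z) / 2 \<longrightarrow>
        norm (f (phi s w) - f w) \<le> M \<and> norm (f (phi (s + \<sigma>) w) - f w) \<le> M"
  shows "norm (deriv f z) * (1 - norm z) \<le> derivC * M"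
proof -
  define T where "T = (1 - norm z) / (96 * norm (P z))"
  define \<delta> where "\<delta> = 1 - norm z"
  have \<delta>: "0 < \<delta>" using z by (simp add: \<delta>_def)
  have Pz: "0 < norm (P z)" using P_ne[OF z(1)] by simp
  have T: "0 < T" using \<delta> Pz by (simp add: T_def \<delta>_def)
  have TP: "norm (P z) * T = \<delta> / 96" using Pz by (simp add: T_def \<delta>_def)
  define B where "B = norm (G z) * (8 * M / \<delta>)"
  have small: "48 * norm (P z) * \<sigma> < 1 - norm z" if "\<sigma> \<le> T" "0 \<le> \<sigma>" for \<sigma>
  proof -
    have "48 * (norm (P z) * \<sigma>) \<le> 48 * (norm (P z) * T)" using that Pz by simp
    also have "\<dots> < \<delta>" using TP \<delta> by simp
    finally show ?thesis by (simp add: \<delta>_def mult.assoc)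
  qed
  have F: "norm (f (phi \<sigma> w) - f w) \<le> 2 * M" if \<sigma>: "\<sigma> \<in> {0..T}" and w: "norm (w - z) \<le> \<delta> / 4" for \<sigma> w
  proof -
    obtain s where s: "0 \<le> s" "\<And>w. norm (w - z) \<le> (1 - norm z) / 2 \<Longrightarrow> norm (f (phi s w) - f w) \<le> M"
        "\<And>w. norm (w - z) \<le> (1 - norm z) / 2 \<Longrightarrow> norm (f (phi (s + \<sigma>) w) - f w) \<le> M"
      using osc[of \<sigma>] \<sigma> unfolding T_def by auto
    have w4: "norm (w - z) \<le> (1 - norm z) / 4" "norm (w - z) \<le> (1 - norm z) / 2" using w \<delta> by (auto simp: \<delta>_def)
    have w1: "norm w < 1" by (rule P_local(1)[OF z(1) w4(2)])
    have "norm (phi \<sigma> w - z) < (1 - norm z) / 2"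
      by (rule displacement_forward(2)[OF z(1) w4(1)]) (use \<sigma> small in auto)
    hence 1: "norm (f (phi s (phi \<sigma> w)) - f (phi \<sigma> w)) \<le> M" by (intro s) simp
    have 2: "norm (f (phi s (phi \<sigma> w)) - f w) \<le> M"
      using s(3)[OF w4(2)] phi_add[OF s(1), of \<sigma> w] \<sigma> w1 by simp
    have "norm (f (phi \<sigma> w) - f w) \<le> norm (f (phi s (phi \<sigma> w)) - f w) + norm (f (phi s (phi \<sigma> w)) - f (phi \<sigma> w))"
      using norm_triangle_ineq4[of "f (phi s (phi \<sigma> w)) - f w" "f (phi s (phi \<sigma> w)) - f (phi \<sigma> w)"] by simp
    thus ?thesis using 1 2 by linarith
  qed
  define k where "k w = deriv f w * G w" for w
  have kdiff: "norm (k (phi \<sigma> z) - k z) \<le> B" if \<sigma>: "\<sigma> \<in> {0..T}" for \<sigma>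
  proof -
    have sub: "ball z (\<delta> / 4) \<subseteq> unit_disc" "cball z (\<delta> / 4) \<subseteq> unit_disc"
    proof -
      show c: "cball z (\<delta> / 4) \<subseteq> unit_disc"
      proof
        fix w assume "w \<in> cball z (\<delta> / 4)"
        hence "norm (w - z) \<le> \<delta> / 4" by (simp add: dist_norm norm_minus_commute)
        hence "norm (w - z) \<le> (1 - norm z) / 2" using \<delta> by (simp add: \<delta>_def)
        thus "w \<in> unit_disc" using P_local(1)[OF z(1)] by simp
      qed
      show "ball z (\<delta> / 4) \<subseteq> unit_disc" using c ball_subset_cball by blast
    qed
    have hol: "(\<lambda>w. f (phi \<sigma> w) - f w) holomorphic_on unit_disc"
      using \<sigma> by (intro holomorphic_intros phi_compose_hol f) auto
    have "norm ((deriv ^^ 1) (\<lambda>w. f (phi \<sigma> w) - f w) z) \<le> fact 1 * (2 * M) / (\<delta> / 4) ^ 1"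
    proof (rule Cauchy_inequality)
      show "(\<lambda>w. f (phi \<sigma> w) - f w) holomorphic_on ball z (\<delta> / 4)" by (rule holomorphic_on_subset[OF hol sub(1)])
      show "continuous_on (cball z (\<delta> / 4)) (\<lambda>w. f (phi \<sigma> w) - f w)"
        by (rule holomorphic_on_imp_continuous_on[OF holomorphic_on_subset[OF hol sub(2)]])
    qed (use \<delta> F[OF \<sigma>] in \<open>auto simp: norm_minus_commute\<close>)
    hence d: "norm (deriv (\<lambda>w. f (phi \<sigma> w) - f w) z) \<le> 8 * M / \<delta>" by simp
    have "deriv (\<lambda>w. f (phi \<sigma> w) - f w) z = deriv (\<lambda>w. f (phi \<sigma> w)) z - deriv f z"
      by (rule deriv_diff)
         (use holomorphic_on_imp_differentiable_at[OF phi_compose_hol[OF f]] holomorphic_on_imp_differentiable_at[OF f] \<sigma> z in auto)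
    hence "k (phi \<sigma> z) - k z = deriv (\<lambda>w. f (phi \<sigma> w) - f w) z * G z"
      using deriv_compose_phi_G[OF f _ z(1), of \<sigma>] \<sigma> by (simp add: k_def left_diff_distrib)
    hence "norm (k (phi \<sigma> z) - k z) = norm (G z) * norm (deriv (\<lambda>w. f (phi \<sigma> w) - f w) z)"
      by (simp add: norm_mult)
    also have "\<dots> \<le> B" unfolding B_def using d by (intro mult_left_mono) auto
    finally show ?thesis .
  qed
  \<comment> \<open>\<open>k\<close> is the derivative of \<open>f\<close> along the orbit. It stays
    within \<open>B\<close> of its initial value, so the total change is \<open>T\<close> times that
    value up to \<open>T * B\<close>.\<close>
  have "norm (f (phi T z) - f (phi 0 z) - (T - 0) *\<^sub>R k (phi 0 z)) \<le> norm (T - 0) * B"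
  proof (rule vector_differentiable_bound_linearization[where f = "\<lambda>s. f (phi s z)" and S = "{0..T}" and f' = "\<lambda>s. k (phi s z)" and ?x0.0 = 0])
    fix s assume s: "s \<in> {0..T}"
    have "(f has_field_derivative deriv f (phi s z)) (at (phi s z))"
      using holomorphic_derivI[OF f open_ball] phi_disc[of s z] s z by simp
    hence "(f has_field_derivative deriv f (phi s z)) (at (phi s z) within (\<lambda>s. phi s z) ` {0..T})"
      by (rule has_field_derivative_at_within)
    from field_vector_diff_chain_within[OF phi_ODE[OF z(1) s] this]
    show "((\<lambda>s. f (phi s z)) has_vector_derivative k (phi s z)) (at s within {0..T})"
      by (simp add: o_def k_def mult.commute)
    show "norm (k (phi s z) - k (phi 0 z)) \<le> B" using kdiff[OF s] phi_0[OF z(1)] by simp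
  next
    show "closed_segment 0 T \<subseteq> {0..T}" using T by (simp add: closed_segment_eq_real_ivl)
  qed (use T in auto)
  hence 1: "norm (f (phi T z) - f z - T *\<^sub>R k z) \<le> T * B" using phi_0[OF z(1)] T by simp
  have "norm (T *\<^sub>R k z) \<le> norm (f (phi T z) - f z) + norm (f (phi T z) - f z - T *\<^sub>R k z)"
    using norm_triangle_ineq4[of "f (phi T z) - f z" "f (phi T z) - f z - T *\<^sub>R k z"] by simp
  also have "\<dots> \<le> 2 * M + T * B" using 1 F[of T z] T \<delta> by simp
  finally have 2: "T * (norm (deriv f z) * norm (G z)) \<le> 2 * M + T * norm (G z) * (8 * M / \<delta>)"
    using T by (simp add: k_def norm_mult B_def mult.assoc)
  define g where "g = (1 - norm b)\<^sup>2 / 2"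
  have g: "0 < g" using b_disc by (simp add: g_def)
  define x where "x = T * norm (G z)"
  have x: "g * \<delta> / 96 \<le> x"
  proof -
    have "T * (g * norm (P z)) \<le> T * norm (G z)"
      using norm_G_ge[OF z] T unfolding g_def by (intro mult_left_mono) auto
    moreover have "T * (g * norm (P z)) = g * (norm (P z) * T)" by simp
    ultimately show ?thesis unfolding TP x_def by simp
  qed
  have x0: "0 < x" using x g \<delta> by (meson divide_pos_pos less_le_trans mult_pos_pos zero_less_numeral)
  have "x * norm (deriv f z) \<le> 2 * M + x * (8 * M / \<delta>)" using 2 by (simp add: x_def mult_ac)
  hence "norm (deriv f z) \<le> (2 * M + x * (8 * M / \<delta>)) / x" using x0 by (simp add: pos_le_divide_eq mult.commute)
  also have "\<dots> = 2 * M / x + 8 * M / \<delta>" using x0 by (simp add: add_divide_distrib)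
  also have "\<dots> \<le> 2 * M / (g * \<delta> / 96) + 8 * M / \<delta>"
    using x x0 g \<delta> M by (intro add_right_mono divide_left_mono) auto
  also have "\<dots> = derivC * M / \<delta>" using g \<delta> unfolding derivC_def g_def[symmetric] by (simp add: field_simps)
  finally show ?thesis using \<delta> unfolding \<delta>_def[symmetric] by (simp add: pos_le_divide_eq)
qed

section \<open>Time averages of the increments along the flow\<close>

definition increment :: "(complex \<Rightarrow> complex) \<Rightarrow> real \<Rightarrow> complex \<Rightarrow> complex" where
  "increment f s z = f (phi (max 0 s) z) - f z"

lemma increment_hol: "f holomorphic_on unit_disc \<Longrightarrow> increment f s holomorphic_on unit_disc"
  unfolding increment_def by (intro holomorphic_intros phi_compose_hol) auto

text \<open>Cutting the time off at 0 in \<open>increment\<close> makes it continuous in time and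
  angle on the whole plane, so Tonelli needs no restricted domains.\<close>

lemma increment_measurable:
  assumes f: "f holomorphic_on unit_disc" and R: "0 \<le> R" "R < 1"
  shows "(\<lambda>(s, t). increment f s (of_real R * cis t)) \<in> borel_measurable (borel \<Otimes>\<^sub>M borel)"
proof -
  have fc: "continuous_on unit_disc f" using f by (rule holomorphic_on_imp_continuous_on)
  have 1: "continuous_on UNIV (\<lambda>x::real \<times> real. phi (fst (max 0 (fst x), of_real R * cis (snd x))) (snd (max 0 (fst x), of_real R * cis (snd x))))"
    by (rule continuous_on_compose2[OF phi_joint_continuous])
       (use R in \<open>auto intro!: continuous_intros simp: norm_mult\<close>)
  have "continuous_on UNIV (\<lambda>x::real \<times> real. increment f (fst x) (of_real R * cis (snd x)))"
    unfolding increment_def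
    by (intro continuous_intros continuous_on_compose2[OF fc 1[simplified]] continuous_on_compose2[OF fc])
       (use R phi_disc in \<open>auto simp: norm_mult intro!: continuous_intros\<close>)
  from borel_measurable_continuous_onI[OF this] show ?thesis by (simp add: borel_prod case_prod_unfold)
qed

text \<open>This dominates the time average of \<open>|increment f s z|^q\<close> and, unlike that
  average, satisfies Harnack's inequality in \<open>z\<close>. The interval has length
  \<open>2*t0\<close> to make room for \<open>s + \<sigma>\<close> with both times at most
  \<open>t0\<close>.\<close>

definition increment_avg :: "ereal \<Rightarrow> (complex \<Rightarrow> complex) \<Rightarrow> real \<Rightarrow> real \<Rightarrow> complex \<Rightarrow> ennreal" where
  "increment_avg p f t0 R z = (\<integral>\<^sup>+s. pint R (\<lambda>t. ennreal (norm (increment f s (of_real R * cis t)) powr qexp p)) z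
      \<partial>uniform_measure lborel {0..2*t0})"

lemma increment_avg_Harnack:
  assumes f: "f holomorphic_on unit_disc" and R: "0 \<le> R" "R < 1" and z: "norm z < R" "norm (w - z) \<le> (R - norm z) / 2"
  shows "increment_avg p f t0 R w \<le> 12 * increment_avg p f t0 R z"
proof -
  note [measurable] = increment_measurable[OF f R]
  interpret C: sigma_finite_measure circ by (rule sigma_finite_circ)
  have m[measurable]: "(\<lambda>s. pint R (\<lambda>t. ennreal (norm (increment f s (of_real R * cis t)) powr qexp p)) z) \<in> borel_measurable borel"
    unfolding pint_def by measurable
  have "increment_avg p f t0 R w \<le> (\<integral>\<^sup>+s. 12 * pint R (\<lambda>t. ennreal (norm (increment f s (of_real R * cis t)) powr qexp p)) z
      \<partial>uniform_measure lborel {0..2*t0})"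
    unfolding increment_avg_def by (intro nn_integral_mono pint_Harnack z) measurable
  also have "\<dots> = 12 * increment_avg p f t0 R z" unfolding increment_avg_def by (intro nn_integral_cmult) measurable
  finally show ?thesis .
qed

text \<open>Averaging over time does not increase the mean, and for each fixed time the
  subordination estimate is used with the identity map, where its constant is 1.\<close>

lemma cmean_increment_avg_le:
  assumes p: "0 < p" and f: "f holomorphic_on unit_disc" and R: "0 \<le> R" "R < 1" and t0: "0 < t0" and r: "0 \<le> r" "r < R"
    and b: "\<And>s. 0 \<le> s \<Longrightarrow> s \<le> 2 * t0 \<Longrightarrow> pmean p R (increment f s) \<le> c"
  shows "cmean p (\<lambda>t. increment_avg p f t0 R (of_real r * cis t)) \<le> c"
  unfolding increment_avg_def
proof (rule cmean_nn_integral_le)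
  note [measurable] = increment_measurable[OF f R]
  interpret C: sigma_finite_measure circ by (rule sigma_finite_circ)
  have e: "emeasure (uniform_measure lborel {0..2*t0}) UNIV = 1"
    using t0 by (subst emeasure_uniform_measure) (auto simp: ennreal_divide_self)
  thus "emeasure (uniform_measure lborel {0..2*t0}) (space (uniform_measure lborel {0..2*t0})) = 1" by simp
  show "AE s in uniform_measure lborel {0..2*t0}. s \<in> {0..2*t0}" by (rule AE_uniform_measureI) auto
  show "finite_measure (uniform_measure lborel {0..2*t0})" by (rule finite_measureI) (simp add: e)
  show "(\<lambda>(t, s). pint R (\<lambda>t. ennreal (norm (increment f s (of_real R * cis t)) powr qexp p)) (of_real r * cis t))
     \<in> borel_measurable (borel \<Otimes>\<^sub>M uniform_measure lborel {0..2*t0})"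
  proof -
    have [measurable]: "(\<lambda>t. of_real r * cis t) \<in> borel_measurable borel"
      by (intro borel_measurable_continuous_onI continuous_intros)
    show ?thesis unfolding pint_def by measurable
  qed
  fix s assume s: "s \<in> {0..2*t0}"
  have "(\<lambda>z. z) holomorphic_on unit_disc" by (intro holomorphic_intros)
  from cmean_pint_compose[OF this r(1) _ _ , of R "\<lambda>t. ennreal (norm (increment f s (of_real R * cis t)) powr qexp p)" p]
  have "cmean p (\<lambda>t. pint R (\<lambda>t. ennreal (norm (increment f s (of_real R * cis t)) powr qexp p)) (of_real r * cis t)) \<le>
      pmean p R (increment f s)" using R r unfolding pmean_def by simp
  also have "\<dots> \<le> c" using s by (intro b) auto
  finally show "cmean p (\<lambda>t. pint R (\<lambda>t. ennreal (norm (increment f s (of_real R * cis t)) powr qexp p)) (of_real r * cis t)) \<le> c" .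
qed

text \<open>1152 = 8 * 144, from the pigeonhole and from Harnack. The pigeonhole is applied to the
  Poisson integrals at the single point \<open>z\<close>, so \<open>s\<close> depends on \<sigma>
  only; Harnack then carries both bounds to the whole disc around \<open>z\<close>. The hypothesis
  \<open>1 - norm z \<le> t0 * norm (P z)\<close> puts every admissible \<sigma> below
  \<open>t0\<close>.\<close>

lemma deriv_le_increment_avg:
  assumes p: "0 < p" and f: "f holomorphic_on unit_disc" and z: "norm z < 1" "(1 + norm b) / 2 \<le> norm z"
    and t0: "0 < t0" "1 - norm z \<le> t0 * norm (P z)" and R: "R < 1" "1 - R \<le> (1 - norm z) / 8"
    and W: "increment_avg p f t0 R z \<le> ennreal W" "0 \<le> W"
  shows "norm (deriv f z) * (1 - norm z) \<le> derivC * (1152 * W) powr (1 / qexp p)"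
proof (rule deriv_le_oscillation[OF f z])
  have q: "qexp p > 0" by (rule qexp_pos[OF p])
  have Pz: "0 < norm (P z)" using P_ne[OF z(1)] by simp
  have zR: "norm z < R" using R z by (auto simp: field_simps)
  have R0: "0 \<le> R" using zR norm_ge_zero[of z] by linarith
  note [measurable] = increment_measurable[OF f R0 R(1)]
  interpret C: sigma_finite_measure circ by (rule sigma_finite_circ)
  define h where "h s = pint R (\<lambda>t. ennreal (norm (increment f s (of_real R * cis t)) powr qexp p)) z" for s
  have hm: "h \<in> borel_measurable borel" unfolding h_def pint_def by measurable
  fix \<sigma> assume \<sigma>: "0 \<le> \<sigma>" "\<sigma> \<le> (1 - norm z) / (96 * norm (P z))"
  have "0 \<le> t0 * norm (P z)" using t0 Pz by simp
  hence "1 - norm z \<le> t0 * (96 * norm (P z))" using t0(2) by simp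
  hence "(1 - norm z) / (96 * norm (P z)) \<le> t0" using Pz by (subst pos_divide_le_eq) auto
  hence "\<sigma> \<le> t0" using \<sigma> by linarith
  then obtain s where s: "s \<in> {0..t0}" "h s + h (s + \<sigma>) \<le> 8 * (\<integral>\<^sup>+s. h s \<partial>uniform_measure lborel {0..2*t0})"
    using pigeonhole_shift[OF hm t0(1) \<sigma>(1)] by blast
  have "8 * (\<integral>\<^sup>+s. h s \<partial>uniform_measure lborel {0..2*t0}) \<le> 8 * ennreal W"
    using W(1) unfolding increment_avg_def h_def by (rule mult_left_mono) simp
  also have "\<dots> = ennreal (8 * W)" using W(2) by (simp add: ennreal_mult)
  finally have hs: "h s + h (s + \<sigma>) \<le> ennreal (8 * W)" using s(2) by (rule order_trans[rotated])
  have bound: "norm (increment f u w) \<le> (1152 * W) powr (1 / qexp p)" if u: "h u \<le> ennreal (8 * W)" and w: "norm (w - z) \<le> (1 - norm z) / 2" for u w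
  proof -
    note [measurable] = measurable_circle[OF holomorphic_on_imp_continuous_on[OF increment_hol[OF f, of u]] R0 R(1)]
    have m: "(\<lambda>t. ennreal (norm (increment f u (of_real R * cis t)) powr qexp p)) \<in> borel_measurable borel" by measurable
    have "ennreal (norm (increment f u w) powr qexp p) \<le> pint R (\<lambda>t. ennreal (norm (increment f u (of_real R * cis t)) powr qexp p)) w"
    proof (rule norm_powr_le_pint[OF _ _ pint_Harnack2(2)[OF z(1) R w m] q])
      show "continuous_on (cball 0 R) (increment f u)"
        by (rule holomorphic_on_imp_continuous_on[OF holomorphic_on_subset[OF increment_hol[OF f]]]) (use R in auto)
      show "increment f u holomorphic_on ball 0 R"
        by (rule holomorphic_on_subset[OF increment_hol[OF f]]) (use R in auto)
    qed measurable
    also have "\<dots> \<le> 144 * h u" unfolding h_def by (rule pint_Harnack2(1)[OF z(1) R w m])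
    also have "\<dots> \<le> 144 * ennreal (8 * W)" using u by (rule mult_left_mono) simp
    also have "\<dots> = ennreal (1152 * W)" using W(2) by (simp add: ennreal_mult[symmetric] flip: ennreal_numeral)
    finally have "norm (increment f u w) powr qexp p \<le> 1152 * W" using W(2) by (subst (asm) ennreal_le_iff) auto
    hence "(norm (increment f u w) powr qexp p) powr (1 / qexp p) \<le> (1152 * W) powr (1 / qexp p)"
      using q by (intro powr_mono2) auto
    thus ?thesis using powr_powr_inverse'[OF q] by simp
  qed
  have "h s \<le> ennreal (8 * W)" "h (s + \<sigma>) \<le> ennreal (8 * W)"
    using hs by (meson add_increasing2 add_increasing order_refl order_trans zero_le)+
  from bound[OF this(1)] bound[OF this(2)] show "\<exists>s\<ge>0. \<forall>w. norm (w - z) \<le> (1 - norm z) / 2 \<longrightarrow>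
        norm (f (phi s w) - f w) \<le> (1152 * W) powr (1 / qexp p) \<and> norm (f (phi (s + \<sigma>) w) - f w) \<le> (1152 * W) powr (1 / qexp p)"
    using s(1) \<sigma>(1) unfolding increment_def by (intro exI[of _ s]) (auto simp: max_def)
qed simp

end

lemma ennreal_mult_le_imp:
  assumes "0 < x" "0 \<le> y" "ennreal x * L \<le> ennreal y" shows "L \<le> ennreal (y / x)"
proof (cases L)
  case (real l)
  hence "ennreal (x * l) \<le> ennreal y" using assms by (simp add: ennreal_mult)
  hence "x * l \<le> y" using assms by (subst (asm) ennreal_le_iff) auto
  thus ?thesis using real assms by (simp add: field_simps ennreal_leI)
next
  case top
  thus ?thesis using assms by (simp add: ennreal_mult_top top_unique)
qed

lemma ennreal_combination2:
  assumes "0 \<le> x" "0 \<le> l" "0 \<le> k" "0 \<le> y"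
  shows "ennreal x * (ennreal l * A + ennreal k * ennreal y) = ennreal (x * l) * A + ennreal (x * (k * y))"
  using assms by (simp add: ennreal_mult distrib_left mult.assoc)

context interior_semigroup_P
begin

lemma increment_avg_measurable:
  assumes f: "f holomorphic_on unit_disc" and R: "0 \<le> R" "R < 1" and t0: "0 < t0"
  shows "(\<lambda>t. increment_avg p f t0 R (of_real r * cis t)) \<in> borel_measurable borel"
proof -
  note [measurable] = increment_measurable[OF f R]
  interpret C: sigma_finite_measure circ by (rule sigma_finite_circ)
  have "emeasure (uniform_measure lborel {0..2*t0}) UNIV \<noteq> \<infinity>"
    using t0 by (subst emeasure_uniform_measure) (auto simp: ennreal_divide_self)
  hence "finite_measure (uniform_measure lborel {0..2*t0})" by (intro finite_measureI) simp
  then interpret U: sigma_finite_measure "uniform_measure lborel {0..2*t0}" by (simp add: finite_measure_def)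
  have [measurable]: "(\<lambda>t. of_real r * cis t) \<in> borel_measurable borel"
    by (intro borel_measurable_continuous_onI continuous_intros)
  show ?thesis unfolding increment_avg_def pint_def by measurable
qed

text \<open>Along each ray the values of \<open>f\<close> at radii 1 - 4/3 \<delta> and 1 - \<delta>
  differ by the length of the segment times the derivative bound, and that bound is governed by
  \<open>increment_avg\<close> at the outer end point alone. Taking q-th powers and circular means
  yields a contracting recursion for the weighted means.\<close>

theorem strong_cont_subset_H_zero:
  assumes p: "0 < p" and \<alpha>: "0 < \<alpha>"
    and LB: "\<And>e. 0 < e \<Longrightarrow> \<exists>r<1. \<forall>z. r < norm z \<and> norm z < 1 \<longrightarrow> 1 - norm z \<le> e * norm (P z)"
  shows "strong_cont_space phi p \<alpha> \<subseteq> H_zero p \<alpha>"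
proof
  fix f assume fs: "f \<in> strong_cont_space phi p \<alpha>"
  hence "f \<in> H_inf p \<alpha>" by (simp add: strong_cont_space_def)
  then obtain B0 where f: "f holomorphic_on unit_disc" and B0: "0 \<le> B0" "\<And>r. 0 \<le> r \<Longrightarrow> r < 1 \<Longrightarrow> wmean p \<alpha> r f \<le> ennreal B0"
    unfolding H_inf_iff[OF p] by auto
  have fc: "continuous_on unit_disc f" using f by (rule holomorphic_on_imp_continuous_on)
  have q: "qexp p > 0" by (rule qexp_pos[OF p])
  define a where "a = \<alpha> * qexp p"
  have a: "0 < a" using \<alpha> q by (simp add: a_def)
  \<comment> \<open>Passing from 1 - 4/3 \<delta> to 1 - \<delta> multiplies the weight by (3/4)^a.
    Half of this gain is spent on the triangle inequality, so \<mu> is (3/4)^(a/2).\<close>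
  define l where "l = (4/3::real) powr (a / 2)"
  have l: "1 < l" using a by (simp add: l_def)
  obtain C0 where C0: "0 \<le> C0" "\<And>x y. 0 \<le> x \<Longrightarrow> 0 \<le> y \<Longrightarrow> (x + y) powr qexp p \<le> l * x powr qexp p + C0 * y powr qexp p"
    using powr_add_le_weighted[OF q l] by blast
  \<comment> \<open>13824 = 12 * 1152, the 12 coming from one Harnack step along the ray.
    \<open>C0 + 1\<close> keeps \<open>K1\<close> positive, so the pointwise bound also covers an
    infinite average.\<close>
  define K1 where "K1 = (C0 + 1) * (derivC powr qexp p * 13824)"
  have K1: "0 < K1" using C0 derivC_pos by (simp add: K1_def)
  define \<mu> where "\<mu> = l * (3/4) powr a"
  have \<mu>: "0 \<le> \<mu>" "\<mu> < 1"
  proof -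
    show "0 \<le> \<mu>" using l by (simp add: \<mu>_def)
    have "(3/4::real) powr a = (3/4) powr (a/2) * (3/4) powr (a/2)" by (simp flip: powr_add)
    hence "\<mu> = ((4/3) powr (a/2) * (3/4) powr (a/2)) * (3/4) powr (a/2)" by (simp add: \<mu>_def l_def)
    also have "(4/3) powr (a/2) * (3/4::real) powr (a/2) = (4/3 * (3/4)) powr (a/2)" by (subst powr_mult) auto
    finally have "\<mu> = (3/4) powr (a/2)" by simp
    moreover have "(3/4::real) powr (a/2) < 1 powr (a/2)" using a by (intro powr_less_mono2) auto
    ultimately show "\<mu> < 1" by simp
  qed
  have "\<exists>r0<1. \<forall>r. r0 < r \<and> 0 \<le> r \<and> r < 1 \<longrightarrow> wmean p \<alpha> r f \<le> ennreal e" if e: "0 < e" for e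
  proof -
    define c where "c = e * (1 - \<mu>) / 2"
    have c: "0 < c" "2 * c / (1 - \<mu>) = e" using e \<mu> by (auto simp: c_def)
    \<comment> \<open>\<open>8 powr a\<close> is the quotient of the weights at 1 - \<delta> and at
      1 - \<delta>/8, the radius of the circle carrying the increments.\<close>
    define \<epsilon> where "\<epsilon> = c / (K1 * 8 powr a)"
    have \<epsilon>: "0 < \<epsilon>" "K1 * 8 powr a * \<epsilon> = c" using c K1 by (auto simp: \<epsilon>_def)
    from fs[unfolded strong_cont_iff[OF p], THEN conjunct2, rule_format, OF \<epsilon>(1)] obtain d where d: "0 < d" "\<And>t r. 0 < t \<Longrightarrow> t < d \<Longrightarrow> r \<in> {0..<1} \<Longrightarrow> wmean p \<alpha> r (\<lambda>z. f (phi t z) - f z) \<le> ennreal \<epsilon>"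
      by meson
    define t0 where "t0 = d / 4"
    have t0: "0 < t0" "2 * t0 < d" using d by (auto simp: t0_def)
    have NF: "wmean p \<alpha> R (increment f s) \<le> ennreal \<epsilon>" if "0 \<le> s" "s \<le> 2 * t0" "0 \<le> R" "R < 1" for s R
    proof (cases "s = 0")
      case True
      have "wmean p \<alpha> R (increment f s) \<le> ennreal (0 powr qexp p)"
        by (rule wmean_le_sup) (use True p \<alpha> that phi_0 in \<open>auto simp: increment_def\<close>)
      thus ?thesis by simp
    next
      case False
      hence "wmean p \<alpha> R (\<lambda>z. f (phi s z) - f z) \<le> ennreal \<epsilon>" using that t0 by (intro d) auto
      moreover have "increment f s = (\<lambda>z. f (phi s z) - f z)" using that by (auto simp: increment_def)
      ultimately show ?thesis by simp
    qed
    obtain r1 where r1: "r1 < 1" "\<And>z. r1 < norm z \<Longrightarrow> norm z < 1 \<Longrightarrow> 1 - norm z \<le> t0 * norm (P z)"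
      using LB[OF t0(1)] by blast
    define m where "m = max r1 ((1 + norm b) / 2)"
    have m: "m < 1" "r1 \<le> m" "(1 + norm b) / 2 \<le> m" "0 \<le> m"
      using r1 b_disc by (auto simp: m_def le_max_iff_disj)
    \<comment> \<open>With this choice even the inner radius 1 - 4/3 \<delta> exceeds
      \<open>m\<close>, so the whole radial segment lies where the estimates for \<open>P\<close>
      and \<open>G\<close> hold.\<close>
    define d0 where "d0 = (1 - m) / 2"
    have d0: "0 < d0" "4/3 * d0 < 1 - m" using m by (auto simp: d0_def)
    have main: "wmean p \<alpha> (1 - \<delta>) f \<le> ennreal \<mu> * wmean p \<alpha> (1 - 4/3 * \<delta>) f + ennreal c" if \<delta>: "0 < \<delta>" "\<delta> \<le> d0" for \<delta>
    proof -
      define r where "r = 1 - \<delta>"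
      define r' where "r' = 1 - 4/3 * \<delta>"
      define R where "R = 1 - \<delta> / 8"
      have r': "m < r'" "0 \<le> r'" "r' < r" "r < 1" "0 \<le> r" using \<delta> d0 m unfolding r'_def r_def by auto
      have R: "0 \<le> R" "R < 1" "r < R" using r' \<delta> unfolding R_def r_def by auto
      have pt: "ennreal (norm (f (of_real r * cis t)) powr qexp p) \<le>
          ennreal l * ennreal (norm (f (of_real r' * cis t)) powr qexp p) + ennreal K1 * increment_avg p f t0 R (of_real r * cis t)" for t
      proof (cases "increment_avg p f t0 R (of_real r * cis t)")
        case top
        thus ?thesis using K1 by (simp add: ennreal_mult_top)
      next
        case (real W0)
        define z1 where "z1 = of_real r * cis t"
        define z' where "z' = of_real r' * cis t"
        define D where "D = derivC * (13824 * W0) powr (1 / qexp p)"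
        have D: "0 \<le> D" using derivC_pos by (simp add: D_def)
        have seg: "\<exists>\<rho>. z = of_real \<rho> * cis t \<and> r' \<le> \<rho> \<and> \<rho> \<le> r" if "z \<in> closed_segment z' z1" for z
        proof -
          from that obtain u where u: "0 \<le> u" "u \<le> 1" "z = (1 - u) *\<^sub>R z' + u *\<^sub>R z1"
            unfolding closed_segment_def by auto
          have "z = of_real ((1 - u) * r' + u * r) * cis t"
            unfolding u z'_def z1_def by (simp add: scaleR_conv_of_real algebra_simps)
          moreover have "r' \<le> (1 - u) * r' + u * r"
            using mult_left_mono[of r' r u] u r' by (simp add: algebra_simps)
          moreover have "(1 - u) * r' + u * r \<le> r"
            using mult_left_mono[of r' r "1 - u"] u r' by (simp add: algebra_simps)
          ultimately show ?thesis by blast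
        qed
        have db: "norm (deriv f z) \<le> D / \<delta>" and z1': "norm z < 1" if "z \<in> closed_segment z' z1" for z
        proof -
          obtain \<rho> where \<rho>: "z = of_real \<rho> * cis t" "r' \<le> \<rho>" "\<rho> \<le> r" using seg[OF \<open>z \<in> closed_segment z' z1\<close>] by blast
          have "norm z = \<bar>\<rho>\<bar>" unfolding \<rho>(1) by (simp add: norm_mult)
          hence nz: "norm z = \<rho>" using \<rho>(2) r'(2) by simp
          show z1: "norm z < 1" using nz \<rho> r' by simp
          have nz1: "norm z1 = r" using r' by (simp add: z1_def norm_mult)
          have "z - z1 = of_real (\<rho> - r) * cis t" by (simp add: \<rho> z1_def algebra_simps)
          hence "norm (z - z1) = \<bar>\<rho> - r\<bar>" by (simp only: norm_mult norm_of_real norm_cis mult_1_right)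
          hence "norm (z - z1) = r - \<rho>" using \<rho>(3) by linarith
          \<comment> \<open>The segment has length \<delta>/3, and half of R - r is 7/16
            \<delta>.\<close>
          also have "\<dots> \<le> (R - norm z1) / 2" using \<rho> \<delta> unfolding nz1 R_def r_def r'_def by simp
          finally have "increment_avg p f t0 R z \<le> 12 * increment_avg p f t0 R z1"
            using R nz1 by (intro increment_avg_Harnack f) auto
          also have "\<dots> = ennreal (12 * W0)" using real unfolding z1_def by (simp add: ennreal_mult)
          finally have Wz: "increment_avg p f t0 R z \<le> ennreal (12 * W0)" .
          have "norm (deriv f z) * (1 - norm z) \<le> derivC * (1152 * (12 * W0)) powr (1 / qexp p)"
          proof (rule deriv_le_increment_avg[OF p f z1 _ t0(1) _ R(2) _ Wz])
            show "(1 + norm b) / 2 \<le> norm z" using m r' \<rho> nz by simp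
            show "1 - norm z \<le> t0 * norm (P z)" by (rule r1(2)) (use m r' \<rho> nz z1 in auto)
            show "1 - R \<le> (1 - norm z) / 8" using nz \<rho> unfolding R_def r_def by simp
          qed (use real in auto)
          hence "norm (deriv f z) * (1 - norm z) \<le> D" by (simp add: D_def mult.assoc)
          moreover have "norm (deriv f z) * \<delta> \<le> norm (deriv f z) * (1 - norm z)"
            using nz \<rho> unfolding r_def by (intro mult_left_mono) auto
          ultimately have "norm (deriv f z) * \<delta> \<le> D" by linarith
          thus "norm (deriv f z) \<le> D / \<delta>" using \<delta> by (simp add: pos_le_divide_eq)
        qed
        have "norm (f z1 - f z') \<le> D / \<delta> * norm (z1 - z')"
        proof (rule field_differentiable_bound[where S = "closed_segment z' z1" and f' = "deriv f"])
          fix z assume z: "z \<in> closed_segment z' z1"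
          show "(f has_field_derivative deriv f z) (at z within closed_segment z' z1)"
            using holomorphic_derivI[OF f open_ball] z1'[OF z] by (simp add: has_field_derivative_at_within)
          show "norm (deriv f z) \<le> D / \<delta>" by (rule db[OF z])
        qed auto
        also have "norm (z1 - z') \<le> \<delta>"
        proof -
          have "z1 - z' = of_real (r - r') * cis t" by (simp add: z1_def z'_def algebra_simps)
          hence "norm (z1 - z') = \<bar>r - r'\<bar>" by (simp only: norm_mult norm_of_real norm_cis mult_1_right)
          hence "norm (z1 - z') = r - r'" using r'(3) by linarith
          thus ?thesis using \<delta> by (simp add: r_def r'_def)
        qed
        hence "D / \<delta> * norm (z1 - z') \<le> D" using D \<delta> mult_left_mono[of "norm (z1 - z')" \<delta> "D / \<delta>"] by simp
        finally have "norm (f z1) \<le> norm (f z') + D"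
          using norm_triangle_ineq2[of "f z1" "f z'"] by linarith
        hence "norm (f z1) powr qexp p \<le> (norm (f z') + D) powr qexp p" using q by (intro powr_mono2) auto
        also have "\<dots> \<le> l * norm (f z') powr qexp p + C0 * D powr qexp p" by (intro C0 D) auto
        also have "D powr qexp p = derivC powr qexp p * (13824 * W0)"
          using derivC_pos real q unfolding D_def by (subst powr_mult) (auto simp: powr_powr)
        also have "C0 * (derivC powr qexp p * (13824 * W0)) \<le> K1 * W0"
        proof -
          have "0 \<le> derivC powr qexp p * (13824 * W0)" using real by simp
          hence "C0 * (derivC powr qexp p * (13824 * W0)) \<le> (C0 + 1) * (derivC powr qexp p * (13824 * W0))"
            by (intro mult_right_mono) auto
          thus ?thesis by (simp add: K1_def mult_ac)
        qed
        finally have "ennreal (norm (f z1) powr qexp p) \<le> ennreal (l * norm (f z') powr qexp p + K1 * W0)"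
          by (intro ennreal_leI) simp
        also have "\<dots> = ennreal l * ennreal (norm (f z') powr qexp p) + ennreal K1 * ennreal W0"
          using l K1 real by (simp add: ennreal_mult)
        finally show ?thesis unfolding z1_def z'_def using real by simp
      qed
      note [measurable] = increment_avg_measurable[OF f R(1,2) t0(1), of p r] measurable_circle[OF fc r'(2)]
      have r'1: "r' < 1" using r' by simp
      have "pmean p r f \<le> cmean p (\<lambda>t. ennreal l * ennreal (norm (f (of_real r' * cis t)) powr qexp p) + ennreal K1 * increment_avg p f t0 R (of_real r * cis t))"
        unfolding pmean_def by (intro cmean_mono pt)
      also have "\<dots> \<le> cmean p (\<lambda>t. ennreal l * ennreal (norm (f (of_real r' * cis t)) powr qexp p)) + cmean p (\<lambda>t. ennreal K1 * increment_avg p f t0 R (of_real r * cis t))"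
        by (rule cmean_add_le) (use r'1 in measurable)
      also have "\<dots> = ennreal l * pmean p r' f + ennreal K1 * cmean p (\<lambda>t. increment_avg p f t0 R (of_real r * cis t))"
        unfolding pmean_def using r'1 by (subst (1 2) cmean_cmult) auto
      also have "\<dots> \<le> ennreal l * pmean p r' f + ennreal K1 * ennreal (\<epsilon> / (1 - R) powr a)"
      proof (intro add_left_mono mult_left_mono cmean_increment_avg_le[OF p f R(1,2) t0(1) r'(5) R(3)])
        fix s assume s: "0 \<le> s" "s \<le> 2 * t0"
        show "pmean p R (increment f s) \<le> ennreal (\<epsilon> / (1 - R) powr a)"
          by (rule ennreal_mult_le_imp) (use NF[OF s R(1,2)] R \<epsilon> in \<open>auto simp: wmean_def a_def\<close>)
      qed auto
      finally have L: "pmean p r f \<le> ennreal l * pmean p r' f + ennreal K1 * ennreal (\<epsilon> / (1 - R) powr a)" .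
      have "wmean p \<alpha> r f = ennreal (\<delta> powr a) * pmean p r f" by (simp add: wmean_def r_def a_def)
      also have "\<dots> \<le> ennreal (\<delta> powr a) * (ennreal l * pmean p r' f + ennreal K1 * ennreal (\<epsilon> / (1 - R) powr a))"
        by (intro mult_left_mono L) auto
      also have "\<dots> = ennreal (\<delta> powr a * l) * pmean p r' f + ennreal (\<delta> powr a * (K1 * (\<epsilon> / (1 - R) powr a)))"
        by (rule ennreal_combination2) (use l K1 \<epsilon> in auto)
      also have "\<delta> powr a * l = \<mu> * (1 - r') powr a"
      proof -
        have "(1 - r') powr a = (4/3 * \<delta>) powr a" by (simp add: r'_def)
        hence "(3/4) powr a * (1 - r') powr a = (3/4 * (4/3 * \<delta>)) powr a" using \<delta> by (simp only: powr_mult)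
        thus ?thesis by (simp add: \<mu>_def mult.assoc)
      qed
      also have "ennreal (\<mu> * (1 - r') powr a) * pmean p r' f = ennreal \<mu> * wmean p \<alpha> r' f"
        using \<mu> by (simp add: wmean_def a_def ennreal_mult mult.assoc)
      also have "\<delta> powr a * (K1 * (\<epsilon> / (1 - R) powr a)) = c"
      proof -
        have "\<delta> = 8 * (1 - R)" by (simp add: R_def)
        hence "\<delta> powr a = 8 powr a * (1 - R) powr a" using R by (metis powr_mult)
        moreover have "(1 - R) powr a \<noteq> 0" using R by simp
        ultimately have "\<delta> powr a * (K1 * (\<epsilon> / (1 - R) powr a)) = K1 * 8 powr a * \<epsilon>" by simp
        thus ?thesis using \<epsilon> by simp
      qed
      finally show ?thesis by (simp add: r_def r'_def)
    qed
    define X where "X \<delta> = ((1 - (1 - \<delta>)) powr \<alpha> * Mp p (1 - \<delta>) f) powr qexp p" for \<delta>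
    have NX: "wmean p \<alpha> (1 - \<delta>) f = ennreal (X \<delta>)" if "0 < \<delta>" "\<delta> \<le> 1" for \<delta>
      unfolding X_def by (rule wmean_eq[OF p fc]) (use that in auto)
    have X0: "0 \<le> X \<delta>" for \<delta> by (simp add: X_def)
    have d01: "4/3 * d0 \<le> 1" using d0 m by simp
    obtain d1 where d1: "0 < d1" "\<And>\<delta>. 0 < \<delta> \<Longrightarrow> \<delta> \<le> d1 \<Longrightarrow> X \<delta> \<le> 2 * c / (1 - \<mu>)"
    proof (rule geometric_recursion[of d0 X \<mu> c B0])
      fix \<delta> assume \<delta>: "0 < \<delta>" "\<delta> \<le> d0"
      have "ennreal (X \<delta>) \<le> ennreal \<mu> * ennreal (X (4/3 * \<delta>)) + ennreal c"
        using main[OF \<delta>] NX[of \<delta>] NX[of "4/3 * \<delta>"] \<delta> d01 by simp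
      also have "\<dots> = ennreal (\<mu> * X (4/3 * \<delta>) + c)" using \<mu> X0 c by (simp add: ennreal_mult)
      finally show "X \<delta> \<le> \<mu> * X (4/3 * \<delta>) + c" using \<mu> X0 c by (subst (asm) ennreal_le_iff) auto
    next
      fix \<delta> assume \<delta>: "0 < \<delta>" "\<delta> \<le> 4/3 * d0"
      hence "ennreal (X \<delta>) \<le> ennreal B0" using B0(2)[of "1 - \<delta>"] NX[of \<delta>] d01 by simp
      thus "X \<delta> \<le> B0" using B0 by (subst (asm) ennreal_le_iff) auto
    qed (use \<mu> B0 c d0 in auto)
    show ?thesis
    proof (intro exI[of _ "1 - min d1 1"] conjI allI impI)
      fix r assume r: "1 - min d1 1 < r \<and> 0 \<le> r \<and> r < 1"
      hence "1 - r \<le> d1" by linarith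
      hence "X (1 - r) \<le> e" using d1(2)[of "1 - r"] c r by simp
      thus "wmean p \<alpha> r f \<le> ennreal e" using NX[of "1 - r"] r by (simp add: ennreal_leI)
    qed (use d1 in auto)
  qed
  thus "f \<in> H_zero p \<alpha>" unfolding H_zero_iff[OF p \<alpha>] using f by blast
qed

end

section \<open>Lacunary sums and kernels\<close>

lemma geometric_sum_below:
  fixes u :: "nat \<Rightarrow> real"
  assumes "\<And>n. 0 \<le> u n" "\<And>n. u n \<le> t * u (Suc n)" "0 \<le> t" "t < 1"
  shows "(\<Sum>n<N. u n) \<le> t / (1 - t) * u N"
proof (induction N)
  case 0
  show ?case using assms by simp
next
  case (Suc N)
  have "(\<Sum>n<Suc N. u n) \<le> t / (1 - t) * u N + u N" using Suc by simp
  also have "\<dots> = u N / (1 - t)" using assms(4) by (simp add: field_simps)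
  also have "\<dots> \<le> (t * u (Suc N)) / (1 - t)" using assms by (intro divide_right_mono) auto
  finally show ?case by simp
qed

lemma geometric_sum_above:
  fixes u :: "nat \<Rightarrow> real"
  assumes "\<And>n. 0 \<le> u n" "\<And>n. u (Suc n) \<le> t * u n" "t < 1"
  shows "(\<Sum>k<N. u (m + k)) \<le> u m / (1 - t)"
proof -
  have "(\<Sum>k<N. u (m + k)) \<le> (u m - u (m + N)) / (1 - t)"
  proof (induction N)
    case (Suc N)
    have "u (m + N) * (1 - t) \<le> u (m + N) - u (m + Suc N)" using assms(2)[of "m + N"] by (simp add: algebra_simps)
    hence "u (m + N) \<le> (u (m + N) - u (m + Suc N)) / (1 - t)" using assms(3) by (subst pos_le_divide_eq) auto
    hence "(\<Sum>k<Suc N. u (m + k)) \<le> (u m - u (m + N)) / (1 - t) + (u (m + N) - u (m + Suc N)) / (1 - t)"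
      using Suc by simp
    thus ?case by (simp add: diff_divide_distrib)
  qed simp
  also have "\<dots> \<le> u m / (1 - t)" using assms by (intro divide_right_mono) auto
  finally show ?thesis .
qed

lemma sum_lessThan_split: "(\<Sum>n<m + k. g n) = (\<Sum>n<m. g n) + (\<Sum>j<k. g (m + j))" for g :: "nat \<Rightarrow> real"
  by (induction k) auto

locale lacunary =
  fixes d :: "nat \<Rightarrow> real" and \<theta> :: real
  assumes d_pos: "\<And>n. 0 < d n" and d_dec: "\<And>n. d (Suc n) \<le> \<theta> * d n" and \<theta>: "0 < \<theta>" "\<theta> < 1"
begin

lemma theta_powr: "0 < \<beta> \<Longrightarrow> 0 < \<theta> powr \<beta> \<and> \<theta> powr \<beta> < 1"
  using \<theta> powr_less_mono2[of \<beta> \<theta> 1] by simp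

lemma up: "0 < \<beta> \<Longrightarrow> 0 < x \<Longrightarrow> (x / d n) powr \<beta> \<le> \<theta> powr \<beta> * (x / d (Suc n)) powr \<beta>"
proof -
  assume *: "0 < \<beta>" "0 < x"
  have "x * d (Suc n) \<le> x * (\<theta> * d n)" using d_dec[of n] * by simp
  hence "x / d n \<le> \<theta> * (x / d (Suc n))"
    using d_pos[of n] d_pos[of "Suc n"] by (simp add: field_simps)
  hence "(x / d n) powr \<beta> \<le> (\<theta> * (x / d (Suc n))) powr \<beta>"
    using * d_pos[of n] by (intro powr_mono2) auto
  thus ?thesis using \<theta> d_pos[of "Suc n"] * by (simp only: powr_mult)
qed

lemma down: "0 < \<beta> \<Longrightarrow> 0 < x \<Longrightarrow> (d (Suc n) / x) powr \<beta> \<le> \<theta> powr \<beta> * (d n / x) powr \<beta>"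
proof -
  assume *: "0 < \<beta>" "0 < x"
  have "d (Suc n) / x \<le> \<theta> * (d n / x)" using divide_right_mono[OF d_dec[of n], of x] * by simp
  hence "(d (Suc n) / x) powr \<beta> \<le> (\<theta> * (d n / x)) powr \<beta>"
    using * d_pos[of "Suc n"] by (intro powr_mono2) auto
  thus ?thesis using \<theta> d_pos[of n] * by (simp only: powr_mult)
qed

text \<open>Equal to 1 when \<open>d n = x\<close> and geometrically small in the number of indices
  separating \<open>n\<close> from that scale; it measures how far the n-th kernel is felt at
  distance \<open>x\<close> from the circle.\<close>

definition ratio :: "real \<Rightarrow> nat \<Rightarrow> real" where
  "ratio x n = min (d n / x) (x / d n)"

lemma ratio_pos: "0 < x \<Longrightarrow> 0 < ratio x n"
  using d_pos[of n] by (simp add: ratio_def)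

text \<open>Split at the first index with \<open>d n \<le> x\<close>. On either side the terms form
  a geometric series whose largest term is at most 1.\<close>

lemma ratio_sum:
  assumes \<beta>: "0 < \<beta>" and x: "0 < x"
  shows "(\<Sum>n<N. ratio x n powr \<beta>) \<le> 2 / (1 - \<theta> powr \<beta>)"
proof -
  let ?t = "\<theta> powr \<beta>"
  have t: "0 < ?t" "?t < 1" using theta_powr[OF \<beta>] by auto
  obtain n0 where n0: "n0 \<le> N" "\<And>n. n < n0 \<Longrightarrow> x < d n" "n0 < N \<Longrightarrow> d n0 \<le> x"
  proof (cases "\<exists>n<N. d n \<le> x")
    case True
    define n0 where "n0 = (LEAST n. d n \<le> x)"
    have 1: "d n0 \<le> x" "n0 < N" unfolding n0_def using True
      by (meson LeastI, meson Least_le le_less_trans)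
    have "x < d n" if "n < n0" for n using not_less_Least[OF that[unfolded n0_def]] by simp
    thus thesis using that[of n0] 1 by simp
  next
    case False
    thus thesis using that[of N] by (simp add: not_le)
  qed
  have 1: "(\<Sum>n<n0. ratio x n powr \<beta>) \<le> 1 / (1 - ?t)"
  proof (cases n0)
    case 0 thus ?thesis using t by simp
  next
    case (Suc j)
    have "(\<Sum>n<n0. ratio x n powr \<beta>) \<le> (\<Sum>n<n0. (x / d n) powr \<beta>)"
      by (intro sum_mono powr_mono2) (use \<beta> ratio_pos[OF x] in \<open>auto simp: less_imp_le ratio_def\<close>)
    also have "\<dots> = (\<Sum>n<j. (x / d n) powr \<beta>) + (x / d j) powr \<beta>" by (simp add: Suc)
    also have "\<dots> \<le> ?t / (1 - ?t) * (x / d j) powr \<beta> + (x / d j) powr \<beta>"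
      by (intro add_right_mono geometric_sum_below up \<beta> x) (use t in auto)
    also have "\<dots> = (x / d j) powr \<beta> / (1 - ?t)" using t by (simp add: field_simps)
    also have "\<dots> \<le> 1 / (1 - ?t)"
    proof (rule divide_right_mono)
      have "x < d j" using n0(2)[of j] Suc by simp
      hence "(x / d j) powr \<beta> \<le> 1 powr \<beta>" using x \<beta> by (intro powr_mono2) auto
      thus "(x / d j) powr \<beta> \<le> 1" by simp
    qed (use t in simp)
    finally show ?thesis .
  qed
  obtain k where k: "N = n0 + k" using n0(1) le_Suc_ex by blast
  have 2: "(\<Sum>j<k. ratio x (n0 + j) powr \<beta>) \<le> 1 / (1 - ?t)"
  proof (cases k)
    case 0 thus ?thesis using t by simp
  next
    case (Suc l)
    have "(\<Sum>j<k. ratio x (n0 + j) powr \<beta>) \<le> (\<Sum>j<k. (d (n0 + j) / x) powr \<beta>)"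
      by (intro sum_mono powr_mono2) (use \<beta> ratio_pos[OF x] in \<open>auto simp: less_imp_le ratio_def\<close>)
    also have "\<dots> \<le> (d n0 / x) powr \<beta> / (1 - ?t)"
      by (rule geometric_sum_above[where u = "\<lambda>n. (d n / x) powr \<beta>"]) (use t down[OF \<beta> x] in auto)
    also have "\<dots> \<le> 1 / (1 - ?t)"
    proof (rule divide_right_mono)
      have "d n0 \<le> x" using n0(3) k Suc by simp
      hence "(d n0 / x) powr \<beta> \<le> 1 powr \<beta>" using x \<beta> d_pos[of n0] by (intro powr_mono2) auto
      thus "(d n0 / x) powr \<beta> \<le> 1" by simp
    qed (use t in simp)
    finally show ?thesis .
  qed
  show ?thesis using 1 2 unfolding k sum_lessThan_split by simp
qed

lemma ratio_summable:
  assumes "0 < \<beta>" "0 < x"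
  shows "summable (\<lambda>n. ratio x n powr \<beta>)" "(\<Sum>n. ratio x n powr \<beta>) \<le> 2 / (1 - \<theta> powr \<beta>)"
proof -
  show s: "summable (\<lambda>n. ratio x n powr \<beta>)"
    by (rule summableI_nonneg_bounded[OF _ ratio_sum[OF assms]]) simp
  show "(\<Sum>n. ratio x n powr \<beta>) \<le> 2 / (1 - \<theta> powr \<beta>)"
    by (rule suminf_le_const[OF s]) (rule ratio_sum[OF assms])
qed

text \<open>Without the diagonal term both geometric series start at \<theta>^\<beta>, so the sum
  becomes small with \<theta>. At a peak this makes all other kernels negligible.\<close>

lemma ratio_sum_off_diagonal:
  assumes \<beta>: "0 < \<beta>"
  shows "(\<Sum>m<N. if m = n then 0 else ratio (d n) m powr \<beta>) \<le> 2 * (\<theta> powr \<beta> / (1 - \<theta> powr \<beta>))"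
proof -
  let ?t = "\<theta> powr \<beta>"
  have t: "0 < ?t" "?t < 1" using theta_powr[OF \<beta>] by auto
  let ?g = "\<lambda>m. if m = n then 0 else ratio (d n) m powr \<beta>"
  have "(\<Sum>m<N. ?g m) \<le> (\<Sum>m<n + Suc N. ?g m)" by (intro sum_mono2) auto
  also have "\<dots> = (\<Sum>m<n. ?g m) + (\<Sum>j<Suc N. ?g (n + j))" by (rule sum_lessThan_split)
  also have "(\<Sum>j<Suc N. ?g (n + j)) = (\<Sum>j<N. ?g (Suc n + j))" by (subst sum.lessThan_Suc_shift) simp
  also have "(\<Sum>m<n. ?g m) \<le> ?t / (1 - ?t)"
  proof -
    have "(\<Sum>m<n. ?g m) \<le> (\<Sum>m<n. (d n / d m) powr \<beta>)"
      by (intro sum_mono) (auto intro!: powr_mono2 simp: \<beta> less_imp_le ratio_def d_pos)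
    also have "\<dots> \<le> ?t / (1 - ?t) * (d n / d n) powr \<beta>"
      by (intro geometric_sum_below up \<beta> d_pos) (use t in auto)
    finally show ?thesis using d_pos[of n] by simp
  qed
  also have "(\<Sum>j<N. ?g (Suc n + j)) \<le> ?t / (1 - ?t)"
  proof -
    have "(\<Sum>j<N. ?g (Suc n + j)) \<le> (\<Sum>j<N. (d (Suc n + j) / d n) powr \<beta>)"
      by (intro sum_mono) (auto intro!: powr_mono2 simp: \<beta> less_imp_le ratio_def d_pos)
    also have "\<dots> \<le> (d (Suc n) / d n) powr \<beta> / (1 - ?t)"
      by (rule geometric_sum_above[where u = "\<lambda>m. (d m / d n) powr \<beta>"]) (use t down[OF \<beta> d_pos] in auto)
    also have "\<dots> \<le> ?t / (1 - ?t)"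
      using down[OF \<beta> d_pos[of n], of n] t d_pos[of n] by (intro divide_right_mono) auto
    finally show ?thesis .
  qed
  finally show ?thesis by simp
qed

end

text \<open>A triangle inequality for every q > 0. With S the sum on the right, each
  \<open>u n\<close> is at most \<open>w n\<close> times S^(1/q), and summing over n gives the
  claim; summable weights are the price.\<close>

lemma suminf_powr_weighted:
  assumes u: "\<And>n::nat. 0 \<le> u n" "summable u" and w: "\<And>n. 0 < w n" "summable w" and q: "0 < q"
  shows "ennreal ((\<Sum>n. u n) powr q) \<le> ennreal ((\<Sum>n. w n) powr q) * (\<Sum>n. ennreal ((u n / w n) powr q))"
proof -
  have wp: "0 < (\<Sum>n. w n)" using w by (intro suminf_pos) auto
  show ?thesis
  proof (cases "(\<Sum>n. ennreal ((u n / w n) powr q))")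
    case top
    thus ?thesis using wp by (simp add: ennreal_mult_top)
  next
    case (real s)
    have "u n \<le> w n * s powr (1/q)" for n
    proof -
      have "ennreal ((u n / w n) powr q) \<le> (\<Sum>n. ennreal ((u n / w n) powr q))"
      proof -
        have "sum (\<lambda>n. ennreal ((u n / w n) powr q)) {n} \<le> (\<Sum>n. ennreal ((u n / w n) powr q))"
          by (rule sum_le_suminf) auto
        thus ?thesis by simp
      qed
      hence "(u n / w n) powr q \<le> s" using real by (simp add: ennreal_le_iff)
      hence "((u n / w n) powr q) powr (1/q) \<le> s powr (1/q)" using q by (intro powr_mono2) auto
      hence "u n / w n \<le> s powr (1/q)" using powr_powr_inverse'[OF q, of "u n / w n"] u w by (simp add: less_imp_le)
      thus ?thesis using w(1)[of n] by (simp add: field_simps)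
    qed
    hence "(\<Sum>n. u n) \<le> (\<Sum>n. w n * s powr (1/q))"
      by (intro suminf_le u summable_mult2 w)
    also have "\<dots> = (\<Sum>n. w n) * s powr (1/q)" using w(2) by (rule suminf_mult2[symmetric])
    finally have "(\<Sum>n. u n) powr q \<le> ((\<Sum>n. w n) * s powr (1/q)) powr q"
      using q suminf_nonneg[OF u(2,1)] by (intro powr_mono2) auto
    also have "\<dots> = (\<Sum>n. w n) powr q * s"
      using wp q real powr_powr_inverse[OF q, of s] by (subst powr_mult) auto
    finally have "ennreal ((\<Sum>n. u n) powr q) \<le> ennreal ((\<Sum>n. w n) powr q * s)" by (rule ennreal_leI)
    thus ?thesis using real by (simp add: ennreal_mult)
  qed
qed

text \<open>Distributing the power of the maximum m gives
  \<open>(x / m) powr A * (d / m) powr B\<close>. One base is 1, the other is the smaller of the two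
  quotients, and lowering its exponent to \<gamma> only enlarges the power.\<close>

lemma kernel_exponent_bound:
  fixes x d A B \<gamma> :: real
  assumes "0 < x" "0 < d" "0 \<le> \<gamma>" "\<gamma> \<le> A" "\<gamma> \<le> B"
  shows "x powr A * d powr B * max d x powr (- (A + B)) \<le> min (d / x) (x / d) powr \<gamma>"
proof -
  define m where "m = max d x"
  have m: "0 < m" using assms by (simp add: m_def)
  have "x powr A * d powr B * m powr (- (A + B)) = (x / m) powr A * (d / m) powr B"
  proof -
    have "m powr (- (A + B)) = inverse (m powr A) * inverse (m powr B)"
      by (simp only: powr_minus powr_add inverse_mult_distrib)
    thus ?thesis using m by (simp add: divide_inverse powr_mult inverse_powr)
  qed
  also have "\<dots> \<le> min (d / x) (x / d) powr \<gamma>"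
  proof (cases "d \<le> x")
    case True
    hence "m = x" by (simp add: m_def)
    moreover have "d / x \<le> x / d" using True assms by (simp add: frac_le)
    moreover have "(d / x) powr B \<le> (d / x) powr \<gamma>"
      using True assms by (intro powr_mono') auto
    ultimately show ?thesis using assms by simp
  next
    case False
    hence "m = d" by (simp add: m_def)
    moreover have "x / d \<le> d / x" using False assms by (simp add: frac_le)
    moreover have "(x / d) powr A \<le> (x / d) powr \<gamma>"
      using False assms by (intro powr_mono') auto
    ultimately show ?thesis using assms by (simp add: min_absorb2)
  qed
  finally show ?thesis unfolding m_def .
qed

section \<open>Means of the kernels composed with the flow\<close>

context interior_semigroup
begin

lemma kernel_denominator_lower:
  assumes t: "0 \<le> t" and r: "0 \<le> r" "r < 1" and a: "norm a < 1" and z: "norm z \<le> r"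
  shows "cb / 2 * max (1 - norm a) (1 - r) \<le> 1 - norm a * norm (phi t z)"
proof -
  have w: "norm (phi t z) < 1 - cb / 2 * (1 - r)" by (rule compose_radius[OF t r z])
  have w1: "norm (phi t z) < 1" by (rule phi_disc[OF t]) (use z r in simp)
  have "norm a * norm (phi t z) \<le> norm a" using w1 by (simp add: mult_left_le)
  moreover have "cb / 2 * (1 - norm a) \<le> 1 * (1 - norm a)" using cb_half a by (intro mult_right_mono) auto
  moreover have "norm a * norm (phi t z) \<le> 1 * norm (phi t z)" using a by (intro mult_right_mono) auto
  ultimately show ?thesis using w by (auto simp: max_def)
qed

text \<open>For finite \<open>p\<close>, the point \<open>1 / cnj a\<close> lies on the circle of
  radius \<open>R = 1 / norm a\<close>, and the Poisson kernel of that circle at this point has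
  \<open>|1 - cnj a * v|^2\<close> as denominator. Its mean along the moved circle is its value at
  \<open>phi t 0\<close>, at most \<open>2 / cb\<close>. Averaging thus gains one power over the
  pointwise bound; for the supremum nothing is gained and \<open>eexp p\<close> is 0.\<close>

lemma kernel_mean:
  assumes p: "0 < p" and t: "0 \<le> t" and r: "0 \<le> r" "r < 1" and a: "norm a < 1" "a \<noteq> 0"
    and s: "0 \<le> s" "p \<noteq> \<infinity> \<Longrightarrow> 2 \<le> s * qexp p"
  shows "cmean p (\<lambda>\<theta>. ennreal (norm (1 - cnj a * phi t (of_real r * cis \<theta>)) powr (- (s * qexp p)))) \<le>
     ennreal ((2 / cb) powr (s * qexp p) * max (1 - norm a) (1 - r) powr (- ((s - eexp p) * qexp p)))"
proof -
  define m where "m = max (1 - norm a) (1 - r)"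
  define \<mu> where "\<mu> = cb / 2 * m"
  have m: "0 < m" using r by (simp add: m_def)
  have \<mu>: "0 < \<mu>" using m cb_pos by (simp add: \<mu>_def)
  have q: "qexp p > 0" by (rule qexp_pos[OF p])
  define w where "w \<theta> = phi t (of_real r * cis \<theta>)" for \<theta>
  have wlow: "\<mu> \<le> 1 - norm a * norm (w \<theta>)" for \<theta>
    unfolding \<mu>_def m_def w_def by (rule kernel_denominator_lower[OF t r a(1)]) (use r in \<open>simp add: norm_mult\<close>)
  hence low: "\<mu> \<le> norm (1 - cnj a * w \<theta>)" for \<theta>
    using one_minus_cnj_mult_lower[of a "w \<theta>"] order_trans by blast
  have w1: "norm (w \<theta>) < 1" for \<theta> unfolding w_def using phi_disc[OF t] r by (simp add: norm_mult)
  have \<mu>pow: "\<mu> powr (- x) = (2 / cb) powr x * m powr (- x)" for x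
  proof -
    have "\<mu> powr (- x) = (cb / 2) powr (- x) * m powr (- x)" unfolding \<mu>_def by (rule powr_mult)
    also have "(cb / 2) powr (- x) = (2 / cb) powr x" using cb_pos by (simp add: powr_minus powr_divide)
    finally show ?thesis .
  qed
  show ?thesis
  proof (cases "p = \<infinity>")
    case True
    have "cmean p (\<lambda>\<theta>. ennreal (norm (1 - cnj a * w \<theta>) powr (- (s * qexp p)))) \<le> ennreal (\<mu> powr (- (s * qexp p)))"
      by (intro cmean_bound ennreal_leI powr_mono2') (use low \<mu> s q in auto)
    thus ?thesis using True unfolding \<mu>pow w_def m_def by (simp add: eexp_def)
  next
    case False
    define x where "x = s * qexp p"
    have x: "2 \<le> x" using s(2)[OF False] by (simp add: x_def)
    define R where "R = 1 / norm a"
    have R: "1 < R" using a by (simp add: R_def)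
    define ph where "ph = Arg (1 / cnj a)"
    have u: "of_real R * cis ph = 1 / cnj a"
      using rcis_cmod_Arg[of "1 / cnj a"] a by (simp add: rcis_def ph_def R_def norm_divide)
    have pk: "poisson R v ph = (1 - (norm a * norm v)\<^sup>2) / (norm (1 - cnj a * v))\<^sup>2" for v
    proof -
      have "1 / cnj a - v = (1 - cnj a * v) / cnj a" using a by (simp add: field_simps)
      hence "(norm (of_real R * cis ph - v))\<^sup>2 = (norm (1 - cnj a * v))\<^sup>2 / (norm a)\<^sup>2"
        unfolding u by (simp add: norm_divide power_divide)
      moreover have "R\<^sup>2 - (norm v)\<^sup>2 = (1 - (norm a * norm v)\<^sup>2) / (norm a)\<^sup>2"
        using a by (simp add: R_def field_simps power_mult_distrib)
      ultimately show ?thesis using a by (simp add: poisson_def)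
    qed
    have pt: "norm (1 - cnj a * w \<theta>) powr (- x) \<le> \<mu> powr (- (x - 1)) * poisson R (w \<theta>) ph" for \<theta>
    proof -
      let ?X = "norm (1 - cnj a * w \<theta>)"
      have X: "0 < ?X" using low[of \<theta>] \<mu> by linarith
      have "norm a * norm (w \<theta>) < 1" using wlow[of \<theta>] \<mu> by linarith
      hence "(norm a * norm (w \<theta>))\<^sup>2 \<le> norm a * norm (w \<theta>)"
        unfolding power2_eq_square by (intro mult_left_le) auto
      hence "\<mu> \<le> 1 - (norm a * norm (w \<theta>))\<^sup>2" using wlow[of \<theta>] by linarith
      hence 1: "\<mu> / ?X\<^sup>2 \<le> poisson R (w \<theta>) ph" unfolding pk by (intro divide_right_mono) auto
      \<comment> \<open>Two powers go into the Poisson kernel, the remaining x - 2 are estimated by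
        \<mu>. The numerator of the kernel is at least \<mu> as well, which returns one
        power.\<close>
      have "?X powr (- x) = ?X powr (- (x - 2)) * ?X powr (- 2)" by (simp flip: powr_add)
      also have "\<dots> \<le> \<mu> powr (- (x - 2)) * ?X powr (- 2)"
        using low[of \<theta>] \<mu> x by (intro mult_right_mono powr_mono2') auto
      also have "\<mu> powr (- (x - 2)) = \<mu> powr (- (x - 1)) * \<mu>"
      proof -
        have "\<mu> powr (- (x - 1)) * \<mu> powr 1 = \<mu> powr (- (x - 2))"
          unfolding powr_add[symmetric] by simp
        thus ?thesis using \<mu> by simp
      qed
      also have "?X powr (- 2) = 1 / ?X\<^sup>2" using X by (simp add: powr_minus_divide)
      also have "\<mu> powr (- (x - 1)) * \<mu> * (1 / ?X\<^sup>2) \<le> \<mu> powr (- (x - 1)) * poisson R (w \<theta>) ph"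
        using mult_left_mono[OF 1, of "\<mu> powr (- (x - 1))"] by (simp add: mult.assoc)
      finally show ?thesis .
    qed
    have cw: "continuous_on A w" for A
      unfolding w_def by (rule continuous_circle[OF holomorphic_on_imp_continuous_on[OF phi_hol[OF t]] r])
    have wR: "norm (w \<theta>) < R" for \<theta> using w1[of \<theta>] R by linarith
    have cp: "continuous_on A (\<lambda>\<theta>. poisson R (w \<theta>) ph)" for A
      unfolding poisson_def using circle_ne[OF wR] by (intro continuous_intros cw) auto
    hence [measurable]: "(\<lambda>\<theta>. poisson R (w \<theta>) ph) \<in> borel_measurable borel"
      by (rule borel_measurable_continuous_onI)
    have "cmean p (\<lambda>\<theta>. ennreal (norm (1 - cnj a * w \<theta>) powr (- x))) \<le>
        cmean p (\<lambda>\<theta>. ennreal (\<mu> powr (- (x - 1))) * ennreal (poisson R (w \<theta>) ph))"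
      using pt poisson_nonneg[OF wR] by (intro cmean_mono) (simp add: ennreal_mult[symmetric] ennreal_leI)
    also have "\<dots> = ennreal (\<mu> powr (- (x - 1))) * (\<integral>\<^sup>+\<theta>. ennreal (poisson R (w \<theta>) ph) \<partial>circ)"
      using False by (subst cmean_cmult) (auto simp: cmean_def)
    also have "(\<integral>\<^sup>+\<theta>. ennreal (poisson R (w \<theta>) ph) \<partial>circ) = ennreal (integral {0..2*pi} (\<lambda>\<theta>. poisson R (w \<theta>) ph) / (2*pi))"
      by (rule nn_integral_circ) (use cp poisson_nonneg[OF wR] in auto)
    also have "integral {0..2*pi} (\<lambda>\<theta>. poisson R (w \<theta>) ph) = 2 * pi * poisson R (phi t 0) ph"
    proof (rule integral_unique, unfold w_def, rule poisson_compose_mean[OF phi_hol[OF t] r])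
      show "norm (phi t z) < R" if "norm z \<le> r" for z using phi_disc[OF t, of z] that r R by simp
    qed
    also have "2 * pi * poisson R (phi t 0) ph / (2 * pi) \<le> 2 / cb"
    proof -
      define y where "y = norm (phi t 0)"
      have y: "0 \<le> y" "y \<le> 1 - cb" using phi_boundary_distance[OF t, of 0] by (auto simp: y_def)
      have "poisson R (phi t 0) ph \<le> (R + y) / (R - y)"
        unfolding y_def by (rule poisson_le) (use y R cb_pos in \<open>auto simp: y_def\<close>)
      also have "\<dots> = 1 + 2 * y / (R - y)" using y R cb_pos by (simp add: field_simps)
      also have "\<dots> \<le> 1 + 2 * y / (1 - y)" using y R cb_pos by (intro add_left_mono divide_left_mono) auto
      also have "\<dots> = (1 + y) / (1 - y)" using y cb_pos by (simp add: field_simps)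
      also have "\<dots> \<le> 2 / cb" using y cb_pos by (intro frac_le) auto
      finally show ?thesis by simp
    qed
    hence "ennreal (\<mu> powr (- (x - 1))) * ennreal (2 * pi * poisson R (phi t 0) ph / (2 * pi)) \<le>
        ennreal (\<mu> powr (- (x - 1))) * ennreal (2 / cb)"
      by (intro mult_left_mono ennreal_leI) auto
    also have "\<dots> = ennreal (\<mu> powr (- (x - 1)) * (2 / cb))" using cb_pos by (intro ennreal_mult[symmetric]) auto
    also have "\<mu> powr (- (x - 1)) * (2 / cb) = (2 / cb) powr x * m powr (- (x - 1))"
    proof -
      have "(2 / cb) powr (x - 1) * (2 / cb) = (2 / cb) powr (x - 1) * (2 / cb) powr 1" using cb_pos by simp
      also have "\<dots> = (2 / cb) powr x" unfolding powr_add[symmetric] by simp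
      finally show ?thesis unfolding \<mu>pow by (simp add: mult_ac)
    qed
    also have "x - 1 = (s - eexp p) * qexp p" using eexp_qexp[OF p] False by (simp add: x_def left_diff_distrib)
    finally show ?thesis unfolding w_def m_def x_def .
  qed
qed

end

context interior_semigroup_P
begin

text \<open>Points at bounded hyperbolic distance from a move hyperbolically slowly when \<open>|P a|\<close> is at most
  a multiple of \<open>1 - |a|\<close>. The hypothesis on z or phi t z says that its hyperbolic distance to a is bounded.\<close>

lemma kernel_near:
  assumes C0: "0 < C0" and M: "1 \<le> M" and e: "0 < e"
  obtains \<delta> where "0 < \<delta>"
    "\<And>a t z. norm a < 1 \<Longrightarrow> norm (P a) \<le> C0 * (1 - norm a) \<Longrightarrow> 0 \<le> t \<Longrightarrow> t < \<delta> \<Longrightarrow> norm z < 1 \<Longrightarrow>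
      (norm (1 - cnj a * z))\<^sup>2 \<le> M * ((1 - norm a) * (1 - norm z)) \<or>
      (norm (1 - cnj a * phi t z))\<^sup>2 \<le> M * ((1 - norm a) * (1 - norm (phi t z))) \<Longrightarrow>
      norm (1 / (1 - cnj a * phi t z) ^ K - 1 / (1 - cnj a * z) ^ K) \<le>
        e * (norm (1 / (1 - cnj a * phi t z) ^ K) + norm (1 / (1 - cnj a * z) ^ K))"
proof -
  have "isCont (\<lambda>u::complex. u ^ K) 1" by (intro continuous_intros)
  then obtain \<eta> where \<eta>: "0 < \<eta>" "\<And>u::complex. norm (u - 1) < \<eta> \<Longrightarrow> norm (u ^ K - 1) < e"
    using e unfolding continuous_at_eps_delta dist_norm by (metis power_one)
  \<comment> \<open>The constant with \<open>norm (P w) \<le> V * (1 - norm w)\<close> at points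
    near \<open>a\<close>: Harnack gives 4 M, the comparison of \<open>1 - norm a\<close> with
    \<open>1 - norm w\<close> gives another M, and \<open>C0\<close> is the bound at
    \<open>a\<close>.\<close>
  define V where "V = 4 * M\<^sup>2 * C0"
  have V: "0 < V" using C0 M by (simp add: V_def)
  \<comment> \<open>The entry 1/96 makes the displacement estimates applicable and keeps the
    denominators comparable; \<eta>/48 keeps their quotient within \<eta> of 1, where K-th powers
    vary by less than \<open>e\<close>.\<close>
  define \<delta> where "\<delta> = min (1/96) (\<eta>/48) / V"
  have \<delta>: "0 < \<delta>" using \<eta> V by (simp add: \<delta>_def)
  have Vt: "48 * (V * t) < 1" "24 * (V * t) < \<eta>" "12 * (V * t) \<le> 1/2" if "0 \<le> t" "t < \<delta>" for t
  proof -
    have "V * t < min (1/96) (\<eta>/48)" using that V by (simp add: \<delta>_def pos_less_divide_eq mult.commute)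
    thus "48 * (V * t) < 1" "24 * (V * t) < \<eta>" "12 * (V * t) \<le> 1/2" using \<eta>(1) by auto
  qed
  have PV: "norm (P w) \<le> V * (1 - norm w)"
    if a: "norm a < 1" "norm (P a) \<le> C0 * (1 - norm a)" and w: "norm w < 1"
      and near: "(norm (1 - cnj a * w))\<^sup>2 \<le> M * ((1 - norm a) * (1 - norm w))" for a w
  proof -
    define \<rho> where "\<rho> = norm ((w - a) / (1 - cnj a * w))"
    have X: "0 < (norm (1 - cnj a * w))\<^sup>2" using one_minus_cnj_mult_ne[OF a(1) w] by simp
    have "(1 - norm a) * (1 - norm w) \<le> (1 - (norm a)\<^sup>2) * (1 - (norm w)\<^sup>2)"
    proof -
      have "(norm a)\<^sup>2 \<le> norm a" "(norm w)\<^sup>2 \<le> norm w" using a w by (auto simp: power2_eq_square mult_left_le)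
      thus ?thesis using a w by (intro mult_mono) auto
    qed
    moreover have "(norm (1 - cnj a * w))\<^sup>2 / M \<le> (1 - norm a) * (1 - norm w)"
      using near M by (simp add: divide_le_eq mult.commute)
    ultimately have "(norm (1 - cnj a * w))\<^sup>2 / M \<le> (1 - (norm a)\<^sup>2) * (1 - (norm w)\<^sup>2)" by linarith
    hence "1 / M \<le> (1 - (norm a)\<^sup>2) * (1 - (norm w)\<^sup>2) / (norm (1 - cnj a * w))\<^sup>2"
      using X by (simp add: pos_le_divide_eq)
    hence "\<rho>\<^sup>2 \<le> 1 - 1 / M" using one_minus_norm_Moebius[OF a(1) w] by (simp add: \<rho>_def)
    \<comment> \<open>Completing the square removes the root from the bound for \<rho>.\<close>
    also have "\<dots> \<le> (1 - 1 / (2 * M))\<^sup>2" by (simp add: power2_eq_square algebra_simps)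
    finally have "\<rho>\<^sup>2 \<le> (1 - 1 / (2 * M))\<^sup>2" .
    moreover have "0 \<le> 1 - 1 / (2 * M)" using M by simp
    ultimately have \<rho>: "\<rho> \<le> 1 - 1 / (2 * M)" by (rule power2_le_imp_le)
    have "(1 - (1 - 1 / (2 * M))) * norm (P w) \<le> (1 + (1 - 1 / (2 * M))) * norm (P a)"
      by (rule Harnack_Re_nonneg[OF P_hol P_Re a(1) w]) (use \<rho> M in \<open>auto simp: \<rho>_def\<close>)
    also have "\<dots> \<le> 2 * norm (P a)" using M by (intro mult_right_mono) auto
    finally have "norm (P w) \<le> 4 * M * norm (P a)" using M by (simp add: field_simps)
    also have "\<dots> \<le> 4 * M * (C0 * (1 - norm a))" using a M by (intro mult_left_mono) auto
    also have "1 - norm a \<le> M * (1 - norm w)"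
    proof -
      have "norm a * norm w \<le> norm a" using w by (simp add: mult_left_le)
      hence "1 - norm a \<le> norm (1 - cnj a * w)" using one_minus_cnj_mult_lower[of a w] by linarith
      hence "(1 - norm a)\<^sup>2 \<le> (norm (1 - cnj a * w))\<^sup>2" using a by (intro power_mono) auto
      hence "(1 - norm a) * (1 - norm a) \<le> (1 - norm a) * (M * (1 - norm w))"
        using near by (simp add: power2_eq_square mult_ac)
      thus ?thesis using a by simp
    qed
    hence "4 * M * (C0 * (1 - norm a)) \<le> 4 * M * (C0 * (M * (1 - norm w)))"
      using M C0 by (intro mult_left_mono) auto
    also have "\<dots> = V * (1 - norm w)" by (simp add: V_def power2_eq_square mult_ac)
    finally show ?thesis .
  qed
  have kern: "norm (1 / (1 - cnj a * w') ^ K - 1 / (1 - cnj a * w) ^ K) \<le> e * norm (1 / (1 - cnj a * w) ^ K)"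
    if a: "norm a < 1" and w: "norm w < 1" "norm w' < 1" and t: "0 \<le> t" "t < \<delta>"
      and dw: "norm (w' - w) \<le> 12 * (V * (1 - norm w)) * t" for a w w' t
  proof -
    define x where "x = 1 - cnj a * w"
    define x' where "x' = 1 - cnj a * w'"
    have x: "x \<noteq> 0" "x' \<noteq> 0" unfolding x_def x'_def using one_minus_cnj_mult_ne a w by auto
    have xl: "1 - norm w \<le> norm x"
      using one_minus_cnj_mult_lower[of a w] mult_right_mono[of "norm a" 1 "norm w"] a unfolding x_def by simp
    have "x - x' = cnj a * (w' - w)" by (simp add: x_def x'_def algebra_simps)
    hence "norm (x - x') \<le> norm (w' - w)" using a by (simp add: norm_mult mult_left_le_one_le)
    also have "\<dots> \<le> 12 * (V * t) * (1 - norm w)" using dw by (simp add: mult_ac)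
    also have "\<dots> \<le> 12 * (V * t) * norm x" using xl V t by (intro mult_left_mono) auto
    finally have dx: "norm (x - x') \<le> 12 * (V * t) * norm x" .
    also have "\<dots> \<le> 1/2 * norm x" using Vt(3)[OF t] by (intro mult_right_mono) auto
    finally have x2: "norm x \<le> 2 * norm x'" using norm_triangle_ineq2[of x x'] by linarith
    have "norm (x / x' - 1) = norm (x - x') / norm x'" using x by (simp add: norm_divide diff_divide_distrib flip: norm_divide)
    also have "\<dots> \<le> (12 * (V * t) * (2 * norm x')) / norm x'"
    proof (rule divide_right_mono)
      have "12 * (V * t) * norm x \<le> 12 * (V * t) * (2 * norm x')" using x2 V t by (intro mult_left_mono) auto
      thus "norm (x - x') \<le> 12 * (V * t) * (2 * norm x')" using dx by linarith
    qed simp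
    also have "\<dots> = 24 * (V * t)" using x by simp
    also have "\<dots> < \<eta>" using Vt(2)[OF t] .
    finally have "norm ((x / x') ^ K - 1) < e" by (rule \<eta>(2))
    moreover have "1 / x' ^ K - 1 / x ^ K = ((x / x') ^ K - 1) * (1 / x ^ K)" using x by (simp add: field_simps)
    ultimately show ?thesis unfolding x_def[symmetric] x'_def[symmetric] norm_mult
      by (metis less_imp_le mult_right_mono norm_ge_zero norm_mult)
  qed
  show thesis
  proof (rule that[OF \<delta>])
    fix a t z
    assume a: "norm a < 1" "norm (P a) \<le> C0 * (1 - norm a)" and t: "0 \<le> t" "t < \<delta>" and z: "norm z < 1"
      and near: "(norm (1 - cnj a * z))\<^sup>2 \<le> M * ((1 - norm a) * (1 - norm z)) \<or>
      (norm (1 - cnj a * phi t z))\<^sup>2 \<le> M * ((1 - norm a) * (1 - norm (phi t z)))"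
    have w: "norm (phi t z) < 1" by (rule phi_disc[OF t(1) z])
    have small: "48 * norm (P v) * t < 1 - norm v" "12 * norm (P v) * t \<le> 12 * (V * (1 - norm v)) * t"
      if "norm v < 1" "norm (P v) \<le> V * (1 - norm v)" for v
    proof -
      show le: "12 * norm (P v) * t \<le> 12 * (V * (1 - norm v)) * t" using that t by (intro mult_right_mono mult_left_mono) auto
      have "48 * norm (P v) * t = 4 * (12 * norm (P v) * t)" by simp
      also have "\<dots> \<le> 4 * (12 * (V * (1 - norm v)) * t)" by (rule mult_left_mono[OF le]) simp
      also have "\<dots> = 48 * (V * t) * (1 - norm v)" by (simp add: algebra_simps)
      also have "\<dots> < 1 * (1 - norm v)" using Vt(1)[OF t] that by (intro mult_strict_right_mono) auto
      finally show "48 * norm (P v) * t < 1 - norm v" by simp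
    qed
    let ?k = "\<lambda>v. 1 / (1 - cnj a * v) ^ K"
    from near have "norm (?k (phi t z) - ?k z) \<le> e * norm (?k z) \<or> norm (?k z - ?k (phi t z)) \<le> e * norm (?k (phi t z))"
    proof
      assume n: "(norm (1 - cnj a * z))\<^sup>2 \<le> M * ((1 - norm a) * (1 - norm z))"
      note pv = PV[OF a z n]
      have "norm (phi t z - z) \<le> 12 * norm (P z) * t"
        by (rule displacement_forward(1)[OF z _ t(1) small(1)[OF z pv]]) (use z in simp)
      hence "norm (phi t z - z) \<le> 12 * (V * (1 - norm z)) * t" using small(2)[OF z pv] by linarith
      from kern[OF a(1) z w t this] show ?thesis by blast
    next
      assume n: "(norm (1 - cnj a * phi t z))\<^sup>2 \<le> M * ((1 - norm a) * (1 - norm (phi t z)))"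
      note pv = PV[OF a w n]
      have "norm (phi t z - z) \<le> 12 * norm (P (phi t z)) * t"
        by (rule displacement_backward[OF z t(1) small(1)[OF w pv]])
      hence "norm (z - phi t z) \<le> 12 * (V * (1 - norm (phi t z))) * t"
        using small(2)[OF w pv] by (simp add: norm_minus_commute)
      from kern[OF a(1) w z t this] show ?thesis by blast
    qed
    thus "norm (?k (phi t z) - ?k z) \<le> e * (norm (?k (phi t z)) + norm (?k z))"
    proof
      assume "norm (?k (phi t z) - ?k z) \<le> e * norm (?k z)"
      also have "\<dots> \<le> e * (norm (?k (phi t z)) + norm (?k z))" using e by (intro mult_left_mono) auto
      finally show ?thesis .
    next
      assume "norm (?k z - ?k (phi t z)) \<le> e * norm (?k (phi t z))"
      also have "\<dots> \<le> e * (norm (?k (phi t z)) + norm (?k z))" using e by (intro mult_left_mono) auto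
      finally show ?thesis by (simp add: norm_minus_commute)
    qed
  qed
qed

end

text \<open>\<open>aP\<close> says that the flow is hyperbolically slow at the peaks. The size of
  \<open>K\<close> makes means of the kernels to the power \<open>K\<close> and
  \<open>K - \<alpha>\<close> computable by \<open>kernel_mean\<close> and leaves room for the decay
  in \<open>ratio\<close>. The smallness of \<theta> relative to \<open>K\<close> makes the diagonal
  term dominate at each peak.\<close>

locale peaks = interior_semigroup_P phi G b P + lacunary "\<lambda>n. 1 - norm (a n)" \<theta>
  for phi :: "real \<Rightarrow> complex \<Rightarrow> complex" and G b P and a :: "nat \<Rightarrow> complex" and \<theta> :: real +
  fixes p :: ereal and \<alpha> C0 :: real and K :: nat
  assumes p: "0 < p" and \<alpha>: "0 < \<alpha>" and C0: "0 < C0" and a0: "\<And>n. a n \<noteq> 0"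
    and aP: "\<And>n. norm (P (a n)) \<le> C0 * (1 - norm (a n))"
    and K: "2 * \<alpha> + 2 * eexp p + 1 \<le> real K" and \<theta>K: "\<theta> powr \<alpha> \<le> (1/2) ^ K / 16"
begin

definition d where "d n = 1 - norm (a n)"

text \<open>The exponent for which \<open>ker n\<close> has size about \<open>d n\<close> to the
  power - (\<alpha> + 1/p) at \<open>a n\<close>, the fastest growth that
  \<open>point_evaluation\<close> permits.\<close>

definition \<kappa> where "\<kappa> = real K - \<alpha> - eexp p"

definition ker where "ker n z = of_real (d n powr \<kappa>) / (1 - cnj (a n) * z) ^ K"

text \<open>The second summand dominates \<open>ker n\<close> away from \<open>a n\<close>, with a constant that is small far away from it.\<close>

definition majorant where
  "majorant n w = d n powr \<kappa> * norm (1 - cnj (a n) * w) powr (- real K) +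
     (1 - norm w) powr (- (\<alpha> / 2)) * d n powr (\<kappa> - \<alpha> / 2) * norm (1 - cnj (a n) * w) powr (- (real K - \<alpha>))"

lemma a1: "norm (a n) < 1" and d0: "0 < d n" and d1: "d n \<le> 1"
  using d_pos[of n] by (auto simp: d_def)

lemma q: "0 < qexp p" and e: "0 \<le> eexp p" and kap: "\<alpha> \<le> \<kappa>" "\<alpha> / 2 \<le> \<kappa> - \<alpha> / 2" "1 \<le> \<kappa>"
  using qexp_pos[OF p] eexp_nonneg[OF p] K \<alpha> by (auto simp: \<kappa>_def)

lemma den_ne: "norm z < 1 \<Longrightarrow> 1 - cnj (a n) * z \<noteq> 0"
  by (rule one_minus_cnj_mult_ne[OF a1])

lemma norm_ker: "norm z < 1 \<Longrightarrow> norm (ker n z) = d n powr \<kappa> * norm (1 - cnj (a n) * z) powr (- real K)"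
  using den_ne[of z n] by (simp add: ker_def norm_divide norm_power powr_minus_divide powr_realpow)

lemma majorant_nonneg: "0 \<le> majorant n w"
  by (simp add: majorant_def)

lemma norm_ker_le_majorant: "norm z < 1 \<Longrightarrow> norm (ker n z) \<le> majorant n z"
  unfolding norm_ker majorant_def by simp

lemma ker_hol: "ker n holomorphic_on unit_disc"
  unfolding ker_def using den_ne by (intro holomorphic_intros) auto

definition ratio' where "ratio' r n = ratio (1 - r) n"

lemma ratio'_eq: "ratio' r n = min (d n / (1 - r)) ((1 - r) / d n)"
  by (simp add: ratio'_def ratio_def d_def)

lemma kernel_mean_powr:
  assumes t: "0 \<le> t" and r: "0 \<le> r" "r < 1" and s: "0 \<le> s" "p \<noteq> \<infinity> \<Longrightarrow> 2 \<le> s * qexp p" and c: "0 \<le> c"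
  shows "cmean p (\<lambda>\<phi>. ennreal ((c * norm (1 - cnj (a n) * phi t (of_real r * cis \<phi>)) powr (- s)) powr qexp p)) \<le>
     ennreal ((c * (2 / cb) powr s * max (d n) (1 - r) powr (- (s - eexp p))) powr qexp p)"
proof -
  have w: "continuous_on UNIV (\<lambda>\<phi>. phi t (of_real r * cis \<phi>))"
    by (rule continuous_circle[OF holomorphic_on_imp_continuous_on[OF phi_hol[OF t]] r])
  have [measurable]: "(\<lambda>\<phi>. norm (1 - cnj (a n) * phi t (of_real r * cis \<phi>))) \<in> borel_measurable borel"
    by (intro borel_measurable_continuous_onI continuous_intros w)
  have "cmean p (\<lambda>\<phi>. ennreal ((c * norm (1 - cnj (a n) * phi t (of_real r * cis \<phi>)) powr (- s)) powr qexp p)) =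
     cmean p (\<lambda>\<phi>. ennreal (c powr qexp p) * ennreal (norm (1 - cnj (a n) * phi t (of_real r * cis \<phi>)) powr (- (s * qexp p))))"
    by (simp add: powr_mult powr_powr ennreal_mult)
  also have "\<dots> = ennreal (c powr qexp p) * cmean p (\<lambda>\<phi>. ennreal (norm (1 - cnj (a n) * phi t (of_real r * cis \<phi>)) powr (- (s * qexp p))))"
    by (rule cmean_cmult) measurable
  also have "\<dots> \<le> ennreal (c powr qexp p) * ennreal ((2 / cb) powr (s * qexp p) * max (d n) (1 - r) powr (- ((s - eexp p) * qexp p)))"
    unfolding d_def by (intro mult_left_mono kernel_mean p t r a1 a0 s) auto
  also have "\<dots> = ennreal (c powr qexp p * ((2 / cb) powr (s * qexp p) * max (d n) (1 - r) powr (- ((s - eexp p) * qexp p))))"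
    by (intro ennreal_mult[symmetric]) auto
  also have "c powr qexp p * ((2 / cb) powr (s * qexp p) * max (d n) (1 - r) powr (- ((s - eexp p) * qexp p))) =
     (c * (2 / cb) powr s * max (d n) (1 - r) powr (- (s - eexp p))) powr qexp p"
    by (simp only: powr_mult powr_powr mult_minus_left mult.assoc)
  finally show ?thesis .
qed

definition C1 where "C1 = (2 / cb) powr real K + cb powr (- (\<alpha> / 2)) * (2 / cb) powr (real K - \<alpha>)"

lemma C1_pos: "0 < C1"
  using cb_pos unfolding C1_def by (intro add_pos_pos mult_pos_pos) auto

lemma majorant_circle_measurable:
  assumes t: "0 \<le> t" and r: "0 \<le> r" "r < 1"
  shows "(\<lambda>\<phi>. majorant n (phi t (of_real r * cis \<phi>))) \<in> borel_measurable borel"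
proof -
  have w: "continuous_on UNIV (\<lambda>\<phi>. phi t (of_real r * cis \<phi>))"
    by (rule continuous_circle[OF holomorphic_on_imp_continuous_on[OF phi_hol[OF t]] r])
  hence [measurable]: "(\<lambda>\<phi>. phi t (of_real r * cis \<phi>)) \<in> borel_measurable borel"
    by (rule borel_measurable_continuous_onI)
  show ?thesis unfolding majorant_def by measurable
qed

text \<open>The n-th majorant matters only on circles whose distance to the boundary is comparable
  to \<open>d n\<close>. \<open>kernel_exponent_bound\<close> is used with the exponents (\<alpha>,
  \<kappa>) and (\<alpha>/2, \<kappa> - \<alpha>/2) for the two summands; \<alpha>/2 is the decay
  common to both.\<close>

lemma majorant_mean:
  assumes t: "0 \<le> t" and r: "0 \<le> r" "r < 1"
  shows "cmean p (\<lambda>\<phi>. ennreal (majorant n (phi t (of_real r * cis \<phi>)) powr qexp p)) \<le>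
    ennreal (2 * 2 powr qexp p * (C1 * (ratio' r n powr (\<alpha> / 2) * (1 - r) powr (- \<alpha>))) powr qexp p)"
proof -
  define x where "x = 1 - r"
  have x: "0 < x" using r by (simp add: x_def)
  define m where "m = max (d n) x"
  define E where "E = (C1 * (ratio' r n powr (\<alpha> / 2) * x powr (- \<alpha>))) powr qexp p"
  have E0: "0 \<le> E" by (simp add: E_def)
  let ?w = "\<lambda>\<phi>. phi t (of_real r * cis \<phi>)"
  let ?X = "\<lambda>\<phi>. norm (1 - cnj (a n) * ?w \<phi>)"
  define c2 where "c2 = (cb * x) powr (- (\<alpha> / 2)) * d n powr (\<kappa> - \<alpha> / 2)"
  have w: "continuous_on UNIV ?w"
    by (rule continuous_circle[OF holomorphic_on_imp_continuous_on[OF phi_hol[OF t]] r])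
  hence [measurable]: "?w \<in> borel_measurable borel" by (rule borel_measurable_continuous_onI)
  have qe: "p \<noteq> \<infinity> \<Longrightarrow> eexp p * qexp p = 1" using eexp_qexp[OF p] by simp
  have s1: "p \<noteq> \<infinity> \<Longrightarrow> 2 \<le> s * qexp p" if "2 * eexp p \<le> s" for s
  proof -
    assume "p \<noteq> \<infinity>"
    have "2 * eexp p * qexp p \<le> s * qexp p" by (rule mult_right_mono) (use that q in auto)
    thus ?thesis using qe[OF \<open>p \<noteq> \<infinity>\<close>] by (simp only: mult.assoc mult_1_right)
  qed
  have U: "cmean p (\<lambda>\<phi>. ennreal ((d n powr \<kappa> * ?X \<phi> powr (- real K)) powr qexp p)) \<le> ennreal E"
  proof -
    have "cmean p (\<lambda>\<phi>. ennreal ((d n powr \<kappa> * ?X \<phi> powr (- real K)) powr qexp p)) \<le>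
        ennreal ((d n powr \<kappa> * (2 / cb) powr real K * m powr (- (real K - eexp p))) powr qexp p)"
      unfolding m_def x_def by (rule kernel_mean_powr[OF t r]) (use s1[of "real K"] K \<alpha> e in auto)
    also have "\<dots> \<le> ennreal E" unfolding E_def
    proof (intro ennreal_leI powr_mono2)
      have "x powr \<alpha> * d n powr \<kappa> * m powr (- (\<alpha> + \<kappa>)) \<le> ratio' r n powr (\<alpha> / 2)"
        unfolding ratio'_eq m_def x_def[symmetric] by (rule kernel_exponent_bound) (use x d0 \<alpha> kap in auto)
      hence "x powr (- \<alpha>) * (x powr \<alpha> * d n powr \<kappa> * m powr (- (\<alpha> + \<kappa>))) \<le> x powr (- \<alpha>) * ratio' r n powr (\<alpha> / 2)"
        by (intro mult_left_mono) auto
      moreover have "x powr (- \<alpha>) * x powr \<alpha> = 1" using x by (simp flip: powr_add)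
      ultimately have 1: "d n powr \<kappa> * m powr (- (\<alpha> + \<kappa>)) \<le> ratio' r n powr (\<alpha> / 2) * x powr (- \<alpha>)"
        by (simp add: mult.assoc[symmetric]) (simp add: mult_ac)
      have "real K - eexp p = \<alpha> + \<kappa>" by (simp add: \<kappa>_def)
      hence "d n powr \<kappa> * (2 / cb) powr real K * m powr (- (real K - eexp p)) = (2 / cb) powr real K * (d n powr \<kappa> * m powr (- (\<alpha> + \<kappa>)))"
        by simp
      also have "\<dots> \<le> C1 * (ratio' r n powr (\<alpha> / 2) * x powr (- \<alpha>))"
        by (rule mult_mono[OF _ 1]) (use C1_pos in \<open>auto simp: C1_def\<close>)
      finally show "d n powr \<kappa> * (2 / cb) powr real K * m powr (- (real K - eexp p)) \<le> C1 * (ratio' r n powr (\<alpha> / 2) * x powr (- \<alpha>))" .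
    qed (use q in auto)
    finally show ?thesis .
  qed
  have V: "cmean p (\<lambda>\<phi>. ennreal ((c2 * ?X \<phi> powr (- (real K - \<alpha>))) powr qexp p)) \<le> ennreal E"
  proof -
    have "cmean p (\<lambda>\<phi>. ennreal ((c2 * ?X \<phi> powr (- (real K - \<alpha>))) powr qexp p)) \<le>
        ennreal ((c2 * (2 / cb) powr (real K - \<alpha>) * m powr (- (real K - \<alpha> - eexp p))) powr qexp p)"
      unfolding m_def x_def by (rule kernel_mean_powr[OF t r]) (use s1[of "real K - \<alpha>"] K \<alpha> e in \<open>auto simp: c2_def\<close>)
    also have "\<dots> \<le> ennreal E" unfolding E_def
    proof (intro ennreal_leI powr_mono2)
      have "x powr (\<alpha>/2) * d n powr (\<kappa> - \<alpha>/2) * m powr (- (\<alpha>/2 + (\<kappa> - \<alpha>/2))) \<le> ratio' r n powr (\<alpha> / 2)"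
        unfolding ratio'_eq m_def x_def[symmetric] by (rule kernel_exponent_bound) (use x d0 \<alpha> kap in auto)
      hence "x powr (- \<alpha>) * (x powr (\<alpha>/2) * d n powr (\<kappa> - \<alpha>/2) * m powr (- \<kappa>)) \<le> x powr (- \<alpha>) * ratio' r n powr (\<alpha> / 2)"
        by (intro mult_left_mono) auto
      moreover have "x powr (- \<alpha>) * x powr (\<alpha>/2) = x powr (- (\<alpha>/2))" by (simp flip: powr_add)
      ultimately have 1: "x powr (- (\<alpha>/2)) * d n powr (\<kappa> - \<alpha>/2) * m powr (- \<kappa>) \<le> ratio' r n powr (\<alpha> / 2) * x powr (- \<alpha>)"
        by (simp add: mult.assoc[symmetric]) (simp add: mult_ac)
      have "c2 * (2 / cb) powr (real K - \<alpha>) * m powr (- (real K - \<alpha> - eexp p)) =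
         (cb powr (- (\<alpha> / 2)) * (2 / cb) powr (real K - \<alpha>)) * (x powr (- (\<alpha>/2)) * d n powr (\<kappa> - \<alpha>/2) * m powr (- \<kappa>))"
        unfolding \<kappa>_def[symmetric] c2_def powr_mult by (simp add: mult_ac)
      also have "\<dots> \<le> C1 * (ratio' r n powr (\<alpha> / 2) * x powr (- \<alpha>))"
        by (rule mult_mono[OF _ 1]) (use C1_pos in \<open>auto simp: C1_def\<close>)
      finally show "c2 * (2 / cb) powr (real K - \<alpha>) * m powr (- (real K - \<alpha> - eexp p)) \<le> C1 * (ratio' r n powr (\<alpha> / 2) * x powr (- \<alpha>))" .
    qed (use q in \<open>auto simp: c2_def\<close>)
    finally show ?thesis .
  qed
  have "cmean p (\<lambda>\<phi>. ennreal (majorant n (?w \<phi>) powr qexp p)) \<le>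
     cmean p (\<lambda>\<phi>. ennreal (2 powr qexp p) * (ennreal ((d n powr \<kappa> * ?X \<phi> powr (- real K)) powr qexp p) +
        ennreal ((c2 * ?X \<phi> powr (- (real K - \<alpha>))) powr qexp p)))"
  proof (rule cmean_mono)
    fix \<phi> :: real
    let ?u = "d n powr \<kappa> * ?X \<phi> powr (- real K)" and ?v = "c2 * ?X \<phi> powr (- (real K - \<alpha>))"
    have z: "norm (of_real r * cis \<phi>) = r" using r by (simp add: norm_mult)
    \<comment> \<open>The weight in the second summand is taken at the moved point; the bound on the
      boundary distance replaces it by a constant on the circle.\<close>
    have "cb * x \<le> 1 - norm (?w \<phi>)" using phi_boundary_distance[OF t, of "of_real r * cis \<phi>"] z r by (simp add: x_def)
    hence "(1 - norm (?w \<phi>)) powr (- (\<alpha> / 2)) \<le> (cb * x) powr (- (\<alpha> / 2))"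
      using cb_pos x \<alpha> by (intro powr_mono2') auto
    hence "majorant n (?w \<phi>) \<le> ?u + ?v" unfolding majorant_def c2_def by (intro add_left_mono mult_right_mono) auto
    hence "majorant n (?w \<phi>) powr qexp p \<le> (?u + ?v) powr qexp p"
      using q majorant_nonneg by (intro powr_mono2) auto
    also have "\<dots> \<le> 2 powr qexp p * (?u powr qexp p + ?v powr qexp p)"
      by (rule powr_add_le) (use q in \<open>auto simp: c2_def\<close>)
    finally have "ennreal (majorant n (?w \<phi>) powr qexp p) \<le> ennreal (2 powr qexp p * (?u powr qexp p + ?v powr qexp p))"
      by (rule ennreal_leI)
    also have "\<dots> = ennreal (2 powr qexp p) * (ennreal (?u powr qexp p) + ennreal (?v powr qexp p))"
      by (subst ennreal_mult) auto
    finally show "ennreal (majorant n (?w \<phi>) powr qexp p) \<le> ennreal (2 powr qexp p) * (ennreal (?u powr qexp p) + ennreal (?v powr qexp p))" .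
  qed
  also have "\<dots> = ennreal (2 powr qexp p) * cmean p (\<lambda>\<phi>. ennreal ((d n powr \<kappa> * ?X \<phi> powr (- real K)) powr qexp p) +
        ennreal ((c2 * ?X \<phi> powr (- (real K - \<alpha>))) powr qexp p))"
    by (rule cmean_cmult) measurable
  also have "\<dots> \<le> ennreal (2 powr qexp p) * (ennreal E + ennreal E)"
  proof (rule mult_left_mono)
    have mU: "(\<lambda>\<phi>. ennreal ((d n powr \<kappa> * ?X \<phi> powr (- real K)) powr qexp p)) \<in> borel_measurable borel" by measurable
    have mV: "(\<lambda>\<phi>. ennreal ((c2 * ?X \<phi> powr (- (real K - \<alpha>))) powr qexp p)) \<in> borel_measurable borel" by measurable
    show "cmean p (\<lambda>\<phi>. ennreal ((d n powr \<kappa> * ?X \<phi> powr (- real K)) powr qexp p) +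
        ennreal ((c2 * ?X \<phi> powr (- (real K - \<alpha>))) powr qexp p)) \<le> ennreal E + ennreal E"
      by (rule order_trans[OF cmean_add_le[OF mU mV] add_mono[OF U V]])
  qed simp
  also have "\<dots> = ennreal (2 * 2 powr qexp p * E)"
    using E0 by (subst ennreal_plus[symmetric]) (auto simp: ennreal_mult[symmetric] mult_ac)
  finally show ?thesis unfolding E_def x_def .
qed

text \<open>If \<open>z\<close> or \<open>phi t z\<close> is hyperbolically near the peak,
  \<open>kernel_near\<close> applies. Otherwise each of the two kernel values is itself at most
  \<epsilon> times its majorant. The resulting time bound does not depend on
  \<open>n\<close>.\<close>

lemma ker_difference:
  assumes ep: "0 < \<epsilon>"
  obtains \<delta> where "0 < \<delta>" "\<And>n t z. 0 \<le> t \<Longrightarrow> t < \<delta> \<Longrightarrow> norm z < 1 \<Longrightarrow>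
    norm (ker n (phi t z) - ker n z) \<le> \<epsilon> * (majorant n (phi t z) + majorant n z)"
proof -
  \<comment> \<open>Chosen so that \<open>M powr (- (\<alpha> / 2)) \<le> \<epsilon>\<close>, the
    factor gained at points far from the peak.\<close>
  define M where "M = max 1 (\<epsilon> powr (- (2 / \<alpha>)))"
  have M: "1 \<le> M" by (simp add: M_def)
  have Me: "M powr (- (\<alpha> / 2)) \<le> \<epsilon>"
  proof -
    have "M powr (- (\<alpha> / 2)) \<le> (\<epsilon> powr (- (2 / \<alpha>))) powr (- (\<alpha> / 2))"
      using ep \<alpha> by (intro powr_mono2') (auto simp: M_def)
    also have "\<dots> = \<epsilon>" using ep \<alpha> by (simp add: powr_powr)
    finally show ?thesis .
  qed
  obtain \<delta> where \<delta>: "0 < \<delta>"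
    "\<And>a t z. norm a < 1 \<Longrightarrow> norm (P a) \<le> C0 * (1 - norm a) \<Longrightarrow> 0 \<le> t \<Longrightarrow> t < \<delta> \<Longrightarrow> norm z < 1 \<Longrightarrow>
      (norm (1 - cnj a * z))\<^sup>2 \<le> M * ((1 - norm a) * (1 - norm z)) \<or>
      (norm (1 - cnj a * phi t z))\<^sup>2 \<le> M * ((1 - norm a) * (1 - norm (phi t z))) \<Longrightarrow>
      norm (1 / (1 - cnj a * phi t z) ^ K - 1 / (1 - cnj a * z) ^ K) \<le>
        \<epsilon> * (norm (1 / (1 - cnj a * phi t z) ^ K) + norm (1 / (1 - cnj a * z) ^ K))"
    by (rule kernel_near[OF C0 M ep, where K = K]) (rule that, assumption, blast)
  have far: "norm (ker n w) \<le> \<epsilon> * majorant n w"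
    if w: "norm w < 1" and f: "\<not> (norm (1 - cnj (a n) * w))\<^sup>2 \<le> M * ((1 - norm (a n)) * (1 - norm w))" for n w
  proof -
    let ?X = "norm (1 - cnj (a n) * w)"
    have X: "0 < ?X" using den_ne[OF w] by simp
    have dy: "0 < d n * (1 - norm w)" using d0 w by simp
    have "?X powr (- \<alpha>) = (?X powr 2) powr (- (\<alpha> / 2))" by (simp only: powr_powr) simp
    also have "?X powr 2 = ?X\<^sup>2" using X by simp
    also have "(?X\<^sup>2) powr (- (\<alpha> / 2)) \<le> (M * (d n * (1 - norm w))) powr (- (\<alpha> / 2))"
      using f M dy \<alpha> unfolding d_def by (intro powr_mono2') auto
    also have "\<dots> = M powr (- (\<alpha> / 2)) * (d n powr (- (\<alpha> / 2)) * (1 - norm w) powr (- (\<alpha> / 2)))"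
      by (simp add: powr_mult)
    also have "\<dots> \<le> \<epsilon> * (d n powr (- (\<alpha> / 2)) * (1 - norm w) powr (- (\<alpha> / 2)))"
      by (intro mult_right_mono Me) auto
    finally have 1: "?X powr (- \<alpha>) \<le> \<epsilon> * (d n powr (- (\<alpha> / 2)) * (1 - norm w) powr (- (\<alpha> / 2)))" .
    have "norm (ker n w) = d n powr \<kappa> * ?X powr (- (real K - \<alpha>)) * ?X powr (- \<alpha>)"
      unfolding norm_ker[OF w] by (simp add: mult.assoc flip: powr_add)
    also have "\<dots> \<le> d n powr \<kappa> * ?X powr (- (real K - \<alpha>)) * (\<epsilon> * (d n powr (- (\<alpha> / 2)) * (1 - norm w) powr (- (\<alpha> / 2))))"
      by (intro mult_left_mono 1) auto
    also have "\<dots> = \<epsilon> * ((1 - norm w) powr (- (\<alpha> / 2)) * (d n powr \<kappa> * d n powr (- (\<alpha> / 2))) * ?X powr (- (real K - \<alpha>)))"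
      by (simp only: mult_ac)
    also have "d n powr \<kappa> * d n powr (- (\<alpha> / 2)) = d n powr (\<kappa> - \<alpha> / 2)" unfolding powr_add[symmetric] by simp
    also have "\<epsilon> * ((1 - norm w) powr (- (\<alpha> / 2)) * d n powr (\<kappa> - \<alpha> / 2) * ?X powr (- (real K - \<alpha>))) \<le> \<epsilon> * majorant n w"
      unfolding majorant_def using ep by (intro mult_left_mono) auto
    finally show ?thesis .
  qed
  show thesis
  proof (rule that[OF \<delta>(1)])
    fix n t and z :: complex assume t: "0 \<le> t" "t < \<delta>" and z: "norm z < 1"
    have w: "norm (phi t z) < 1" by (rule phi_disc[OF t(1) z])
    let ?near = "\<lambda>w. (norm (1 - cnj (a n) * w))\<^sup>2 \<le> M * ((1 - norm (a n)) * (1 - norm w))"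
    show "norm (ker n (phi t z) - ker n z) \<le> \<epsilon> * (majorant n (phi t z) + majorant n z)"
    proof (cases "?near z \<or> ?near (phi t z)")
      case True
      let ?k = "\<lambda>v. 1 / (1 - cnj (a n) * v) ^ K"
      have kk: "ker n v = of_real (d n powr \<kappa>) * ?k v" for v by (simp add: ker_def)
      have "norm (ker n (phi t z) - ker n z) = d n powr \<kappa> * norm (?k (phi t z) - ?k z)"
        unfolding kk right_diff_distrib[symmetric] by (simp add: norm_mult)
      also have "\<dots> \<le> d n powr \<kappa> * (\<epsilon> * (norm (?k (phi t z)) + norm (?k z)))"
        by (intro mult_left_mono \<delta>(2) a1 aP t z True) auto
      also have "\<dots> = \<epsilon> * (norm (ker n (phi t z)) + norm (ker n z))"
        unfolding kk norm_mult by (simp add: algebra_simps)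
      also have "\<dots> \<le> \<epsilon> * (majorant n (phi t z) + majorant n z)"
        using ep by (intro mult_left_mono add_mono norm_ker_le_majorant w z) auto
      finally show ?thesis .
    next
      case False
      have "norm (ker n (phi t z) - ker n z) \<le> norm (ker n (phi t z)) + norm (ker n z)" by (rule norm_triangle_ineq4)
      also have "\<dots> \<le> \<epsilon> * majorant n (phi t z) + \<epsilon> * majorant n z"
        using False by (intro add_mono far w z) auto
      finally show ?thesis by (simp add: distrib_left)
    qed
  qed
qed

text \<open>The first factors bound the mean of one summand through its two majorants; the last two
  come from the weights and from the sum that remains in
  \<open>suminf_powr_weighted\<close>.\<close>

definition CS where
  "CS = 2 powr qexp p * (2 * (2 * 2 powr qexp p * C1 powr qexp p)) *
     ((2 / (1 - \<theta> powr (\<alpha> / 4))) powr qexp p * (2 / (1 - \<theta> powr (\<alpha> / 4 * qexp p))))"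

lemma CS_nonneg: "0 \<le> CS"
  unfolding CS_def using theta_powr[of "\<alpha> / 4"] theta_powr[of "\<alpha> / 4 * qexp p"] \<alpha> q by simp

text \<open>The common estimate behind boundedness and strong continuity of the sums.
  \<open>suminf_powr_weighted\<close> moves the q-th power inside the series, and lacunarity makes
  the sum of the means bounded uniformly in \<open>r\<close>.\<close>

lemma sum_mean:
  assumes t: "0 \<le> t" and r: "0 \<le> r" "r < 1" and ep: "0 \<le> \<epsilon>"
    and v: "\<And>n \<phi>. 0 \<le> v n \<phi>" "\<And>n \<phi>. v n \<phi> \<le> \<epsilon> * (majorant n (phi t (of_real r * cis \<phi>)) + majorant n (of_real r * cis \<phi>))"
    and vs: "\<And>\<phi>. summable (\<lambda>n. v n \<phi>)" and vm [measurable]: "\<And>n. v n \<in> borel_measurable borel"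
  shows "cmean p (\<lambda>\<phi>. ennreal ((\<Sum>n. v n \<phi>) powr qexp p)) \<le> ennreal (CS * \<epsilon> powr qexp p * (1 - r) powr (- (\<alpha> * qexp p)))"
proof -
  define x where "x = 1 - r"
  have x: "0 < x" using r by (simp add: x_def)
  define B where "B = 2 powr qexp p * (2 * (2 * 2 powr qexp p * C1 powr qexp p)) * \<epsilon> powr qexp p * x powr (- (\<alpha> * qexp p))"
  have B0: "0 \<le> B" by (simp add: B_def)
  have rp: "0 < ratio' r n" for n unfolding ratio'_def using ratio_pos x by (simp add: x_def)
  have Lv: "cmean p (\<lambda>\<phi>. ennreal (v n \<phi> powr qexp p)) \<le> ennreal (B * ratio' r n powr (\<alpha> / 2 * qexp p))" for n
  proof -
    define E where "E = 2 * 2 powr qexp p * (C1 * (ratio' r n powr (\<alpha> / 2) * x powr (- \<alpha>))) powr qexp p"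
    have E0: "0 \<le> E" by (simp add: E_def)
    let ?m1 = "\<lambda>\<phi>. majorant n (phi t (of_real r * cis \<phi>))" and ?m2 = "\<lambda>\<phi>. majorant n (phi 0 (of_real r * cis \<phi>))"
    have m0: "?m2 \<in> borel_measurable borel" by (rule majorant_circle_measurable[OF order_refl r])
    have m1: "(\<lambda>\<phi>. ennreal (?m1 \<phi> powr qexp p)) \<in> borel_measurable borel"
      by (intro measurable_compose[OF majorant_circle_measurable[OF t r]]) measurable
    have m2: "(\<lambda>\<phi>. ennreal (?m2 \<phi> powr qexp p)) \<in> borel_measurable borel"
      by (intro measurable_compose[OF m0]) measurable
    have "cmean p (\<lambda>\<phi>. ennreal (v n \<phi> powr qexp p)) \<le>
       cmean p (\<lambda>\<phi>. ennreal (\<epsilon> powr qexp p * 2 powr qexp p) * (ennreal (?m1 \<phi> powr qexp p) + ennreal (?m2 \<phi> powr qexp p)))"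
    proof (rule cmean_mono)
      fix \<phi> :: real
      have "phi 0 (of_real r * cis \<phi>) = of_real r * cis \<phi>" using r by (intro phi_0) (simp add: norm_mult)
      hence "v n \<phi> \<le> \<epsilon> * (?m1 \<phi> + ?m2 \<phi>)" using v(2)[of n \<phi>] by simp
      hence "v n \<phi> powr qexp p \<le> (\<epsilon> * (?m1 \<phi> + ?m2 \<phi>)) powr qexp p" using q v(1) by (intro powr_mono2) auto
      also have "\<dots> = \<epsilon> powr qexp p * (?m1 \<phi> + ?m2 \<phi>) powr qexp p" by (rule powr_mult)
      also have "\<dots> \<le> \<epsilon> powr qexp p * (2 powr qexp p * (?m1 \<phi> powr qexp p + ?m2 \<phi> powr qexp p))"
        by (intro mult_left_mono powr_add_le majorant_nonneg q) auto
      finally have "ennreal (v n \<phi> powr qexp p) \<le> ennreal (\<epsilon> powr qexp p * (2 powr qexp p * (?m1 \<phi> powr qexp p + ?m2 \<phi> powr qexp p)))"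
        by (rule ennreal_leI)
      also have "\<dots> = ennreal (\<epsilon> powr qexp p * 2 powr qexp p) * (ennreal (?m1 \<phi> powr qexp p) + ennreal (?m2 \<phi> powr qexp p))"
        unfolding mult.assoc[symmetric] by (subst ennreal_mult) auto
      finally show "ennreal (v n \<phi> powr qexp p) \<le> ennreal (\<epsilon> powr qexp p * 2 powr qexp p) * (ennreal (?m1 \<phi> powr qexp p) + ennreal (?m2 \<phi> powr qexp p))" .
    qed
    also have "\<dots> = ennreal (\<epsilon> powr qexp p * 2 powr qexp p) * cmean p (\<lambda>\<phi>. ennreal (?m1 \<phi> powr qexp p) + ennreal (?m2 \<phi> powr qexp p))"
      by (intro cmean_cmult borel_measurable_add m1 m2)
    also have "\<dots> \<le> ennreal (\<epsilon> powr qexp p * 2 powr qexp p) * (ennreal E + ennreal E)"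
      unfolding E_def x_def
      by (rule mult_left_mono[OF order_trans[OF cmean_add_le[OF m1 m2]
            add_mono[OF majorant_mean[OF t r] majorant_mean[OF order_refl r]]]]) simp
    also have "\<dots> = ennreal (\<epsilon> powr qexp p * 2 powr qexp p * (2 * E))"
      using E0 by (subst ennreal_plus[symmetric]) (auto simp: ennreal_mult[symmetric])
    also have "\<epsilon> powr qexp p * 2 powr qexp p * (2 * E) = B * ratio' r n powr (\<alpha> / 2 * qexp p)"
      unfolding E_def B_def powr_mult powr_powr by (simp add: mult_ac)
    finally show ?thesis .
  qed
  \<comment> \<open>Half of the decay exponent \<alpha>/2 is used for summable weights, the other
    half still makes the series of means converge.\<close>
  define w where "w n = ratio' r n powr (\<alpha> / 4)" for n
  have w0: "0 < w n" for n using rp[of n] by (simp add: w_def)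
  have ws: "summable w" "(\<Sum>n. w n) \<le> 2 / (1 - \<theta> powr (\<alpha> / 4))"
    using ratio_summable[of "\<alpha> / 4" "1 - r"] \<alpha> x unfolding w_def ratio'_def x_def by auto
  define A where "A = 2 / (1 - \<theta> powr (\<alpha> / 4))"
  define A' where "A' = 2 / (1 - \<theta> powr (\<alpha> / 4 * qexp p))"
  have A'0: "0 \<le> A'" using theta_powr[of "\<alpha> / 4 * qexp p"] \<alpha> q by (simp add: A'_def)
  have wq: "summable (\<lambda>n. ratio' r n powr (\<alpha> / 4 * qexp p))" "(\<Sum>n. ratio' r n powr (\<alpha> / 4 * qexp p)) \<le> A'"
    using ratio_summable[of "\<alpha> / 4 * qexp p" "1 - r"] \<alpha> x q unfolding A'_def ratio'_def x_def by auto
  have Lw: "cmean p (\<lambda>\<phi>. ennreal ((v n \<phi> / w n) powr qexp p)) \<le> ennreal (B * ratio' r n powr (\<alpha> / 4 * qexp p))" for n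
  proof -
    have "cmean p (\<lambda>\<phi>. ennreal ((v n \<phi> / w n) powr qexp p)) = cmean p (\<lambda>\<phi>. ennreal (w n powr (- qexp p)) * ennreal (v n \<phi> powr qexp p))"
      using w0[of n] by (simp add: divide_inverse powr_mult inverse_powr powr_minus ennreal_mult mult.commute)
    also have "\<dots> = ennreal (w n powr (- qexp p)) * cmean p (\<lambda>\<phi>. ennreal (v n \<phi> powr qexp p))"
      by (rule cmean_cmult) measurable
    also have "\<dots> \<le> ennreal (w n powr (- qexp p)) * ennreal (B * ratio' r n powr (\<alpha> / 2 * qexp p))"
      by (intro mult_left_mono Lv) auto
    also have "\<dots> = ennreal (w n powr (- qexp p) * (B * ratio' r n powr (\<alpha> / 2 * qexp p)))"
      using B0 by (intro ennreal_mult[symmetric]) auto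
    also have "w n powr (- qexp p) * (B * ratio' r n powr (\<alpha> / 2 * qexp p)) =
        B * (ratio' r n powr (- (\<alpha> / 4 * qexp p)) * ratio' r n powr (\<alpha> / 2 * qexp p))"
      unfolding w_def powr_powr by simp
    also have "ratio' r n powr (- (\<alpha> / 4 * qexp p)) * ratio' r n powr (\<alpha> / 2 * qexp p) = ratio' r n powr (\<alpha> / 4 * qexp p)"
      unfolding powr_add[symmetric] by (rule arg_cong[where f = "\<lambda>y. _ powr y"]) (simp add: field_simps)
    finally show ?thesis .
  qed
  have "cmean p (\<lambda>\<phi>. ennreal ((\<Sum>n. v n \<phi>) powr qexp p)) \<le>
      cmean p (\<lambda>\<phi>. ennreal ((\<Sum>n. w n) powr qexp p) * (\<Sum>n. ennreal ((v n \<phi> / w n) powr qexp p)))"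
    by (intro cmean_mono suminf_powr_weighted v vs w0 ws q)
  also have "\<dots> = ennreal ((\<Sum>n. w n) powr qexp p) * cmean p (\<lambda>\<phi>. \<Sum>n. ennreal ((v n \<phi> / w n) powr qexp p))"
    by (rule cmean_cmult) measurable
  also have "\<dots> \<le> ennreal (A powr qexp p) * (\<Sum>n. ennreal (B * ratio' r n powr (\<alpha> / 4 * qexp p)))"
  proof (rule mult_mono)
    show "ennreal ((\<Sum>n. w n) powr qexp p) \<le> ennreal (A powr qexp p)"
      using ws q suminf_nonneg[OF ws(1)] w0 by (intro ennreal_leI powr_mono2) (auto simp: A_def less_imp_le)
    have "cmean p (\<lambda>\<phi>. \<Sum>n. ennreal ((v n \<phi> / w n) powr qexp p)) \<le> (\<Sum>n. cmean p (\<lambda>\<phi>. ennreal ((v n \<phi> / w n) powr qexp p)))"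
      by (rule cmean_suminf_le) measurable
    also have "\<dots> \<le> (\<Sum>n. ennreal (B * ratio' r n powr (\<alpha> / 4 * qexp p)))"
      by (intro suminf_le Lw) auto
    finally show "cmean p (\<lambda>\<phi>. \<Sum>n. ennreal ((v n \<phi> / w n) powr qexp p)) \<le> (\<Sum>n. ennreal (B * ratio' r n powr (\<alpha> / 4 * qexp p)))" .
  qed auto
  also have "(\<Sum>n. ennreal (B * ratio' r n powr (\<alpha> / 4 * qexp p))) = ennreal (\<Sum>n. B * ratio' r n powr (\<alpha> / 4 * qexp p))"
    using B0 by (intro suminf_ennreal2 summable_mult wq) auto
  also have "(\<Sum>n. B * ratio' r n powr (\<alpha> / 4 * qexp p)) = B * (\<Sum>n. ratio' r n powr (\<alpha> / 4 * qexp p))"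
    by (rule suminf_mult[OF wq(1)])
  also have "ennreal (A powr qexp p) * ennreal (B * (\<Sum>n. ratio' r n powr (\<alpha> / 4 * qexp p))) \<le> ennreal (A powr qexp p) * ennreal (B * A')"
    using B0 wq by (intro mult_left_mono ennreal_leI) auto
  also have "\<dots> = ennreal (A powr qexp p * (B * A'))" using B0 A'0 by (intro ennreal_mult[symmetric]) auto
  also have "A powr qexp p * (B * A') = CS * \<epsilon> powr qexp p * (1 - r) powr (- (\<alpha> * qexp p))"
    unfolding B_def CS_def A_def A'_def x_def by (simp only: mult_ac)
  finally show ?thesis .
qed

end

section \<open>The copy of the bounded sequences\<close>

lemma linf_norm_ge: "x \<in> linf \<Longrightarrow> norm (x n) \<le> linf_norm x"
  unfolding linf_def linf_norm_def
  by (intro cSUP_upper) (auto simp: bounded_iff bdd_above_def)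

lemma linf_norm_nonneg: "x \<in> linf \<Longrightarrow> 0 \<le> linf_norm x"
  using linf_norm_ge[of x 0] norm_ge_zero[of "x 0"] by linarith

lemma linf_norm_least: "(\<And>n. norm (x n) \<le> B) \<Longrightarrow> linf_norm x \<le> B"
  unfolding linf_norm_def by (intro cSUP_least) auto

lemma linfI: "(\<And>n. norm (x n) \<le> B) \<Longrightarrow> x \<in> linf"
  unfolding linf_def bounded_iff by auto

lemma linf_combination: "x \<in> linf \<Longrightarrow> y \<in> linf \<Longrightarrow> (\<lambda>n. c * x n + y n) \<in> linf"
  by (rule linfI[of _ "norm c * linf_norm x + linf_norm y"])
     (metis add_mono linf_norm_ge mult_left_mono norm_ge_zero norm_mult norm_triangle_mono)

context peaks
begin

lemma d_geometric: "d n \<le> \<theta> ^ n"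
proof (induction n)
  case (Suc n)
  have "d (Suc n) \<le> \<theta> * d n" using d_dec[of n] by (simp add: d_def)
  also have "\<dots> \<le> \<theta> * \<theta> ^ n" using Suc \<theta> by (intro mult_left_mono) auto
  finally show ?case by simp
qed (use d1[of 0] in simp)

text \<open>On smaller discs the coefficient alone decides:
  \<open>d n powr \<kappa> \<le> d n\<close> because \<kappa> is at least 1 and \<open>d n\<close>
  at most 1.\<close>

lemma norm_ker_le:
  assumes z: "norm z \<le> \<rho>" "\<rho> < 1" shows "norm (ker n z) \<le> \<theta> ^ n * (1 / (1 - \<rho>) ^ K)"
proof -
  have "norm (a n) * norm z \<le> 1 * \<rho>" using a1[of n] z by (intro mult_mono) auto
  hence "1 - \<rho> \<le> norm (1 - cnj (a n) * z)" using one_minus_cnj_mult_lower[of "a n" z] by linarith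
  hence 1: "(1 - \<rho>) ^ K \<le> norm (1 - cnj (a n) * z) ^ K" using z by (intro power_mono) auto
  have "d n powr \<kappa> \<le> d n powr 1" using d0[of n] d1[of n] kap by (intro powr_mono') auto
  hence 2: "d n powr \<kappa> \<le> \<theta> ^ n" using d_geometric[of n] d0[of n] by simp
  have "norm (ker n z) = d n powr \<kappa> / norm (1 - cnj (a n) * z) ^ K" by (simp add: ker_def norm_divide norm_power)
  also have "\<dots> \<le> \<theta> ^ n / (1 - \<rho>) ^ K" using 1 2 z \<theta> by (intro frac_le) auto
  finally show ?thesis by simp
qed

lemma summable_geometric_bound: "summable (\<lambda>n. B * (\<theta> ^ n * C))"
  using \<theta> by (intro summable_mult summable_mult2 summable_geometric) auto

lemma summable_ker:
  assumes z: "norm z < 1" and X: "\<forall>n. norm (x n) \<le> X"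
  shows "summable (\<lambda>n. norm (x n * ker n z))"
proof (rule summable_comparison_test'[OF summable_geometric_bound[of X "1 / (1 - norm z) ^ K"]])
  have "0 \<le> X" using spec[OF X, of 0] norm_ge_zero order_trans by blast
  thus "norm (norm (x n * ker n z)) \<le> X * (\<theta> ^ n * (1 / (1 - norm z) ^ K))" for n
    unfolding real_norm_def norm_mult abs_mult abs_norm_cancel
    by (intro mult_mono X[rule_format] norm_ker_le[OF order_refl z]) auto
qed

text \<open>The value 0 off the disc makes the map linear as an identity of functions on the whole
  plane, as \<open>contains_closed_linf\<close> demands.\<close>

definition peak_sum :: "(nat \<Rightarrow> complex) \<Rightarrow> complex \<Rightarrow> complex" where
  "peak_sum x z = (if norm z < 1 then (\<Sum>n. x n * ker n z) else 0)"

lemma peak_sum_hol: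
  assumes X: "\<forall>n. norm (x n) \<le> X" shows "peak_sum x holomorphic_on unit_disc"
proof -
  have X0: "0 \<le> X" using spec[OF X, of 0] norm_ge_zero order_trans by blast
  have "(\<lambda>z. \<Sum>n. x n * ker n z) holomorphic_on unit_disc"
  proof (rule holomorphic_uniform_sequence[OF open_ball])
    show "(\<lambda>z. \<Sum>i<n. x i * ker i z) holomorphic_on unit_disc" for n
      by (intro holomorphic_intros ker_hol)
    fix w :: complex assume w: "w \<in> unit_disc"
    define \<rho> where "\<rho> = (1 + norm w) / 2"
    have \<rho>: "\<rho> < 1" "norm w < \<rho>" using w by (auto simp: \<rho>_def)
    have sub: "norm z \<le> \<rho>" if "z \<in> cball w (\<rho> - norm w)" for z
      using that norm_triangle_ineq[of w "z - w"] by (simp add: dist_norm norm_minus_commute)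
    have "uniform_limit (cball w (\<rho> - norm w)) (\<lambda>n z. \<Sum>i<n. x i * ker i z) (\<lambda>z. \<Sum>n. x n * ker n z) sequentially"
    proof (rule Weierstrass_m_test[OF _ summable_geometric_bound[of X "1 / (1 - \<rho>) ^ K"]])
      fix n z assume "z \<in> cball w (\<rho> - norm w)"
      thus "norm (x n * ker n z) \<le> X * (\<theta> ^ n * (1 / (1 - \<rho>) ^ K))"
        unfolding norm_mult by (intro mult_mono X[rule_format] norm_ker_le sub \<rho> X0) auto
    qed
    moreover have "cball w (\<rho> - norm w) \<subseteq> unit_disc" using sub \<rho> by force
    ultimately show "\<exists>d>0. cball w d \<subseteq> unit_disc \<and> uniform_limit (cball w d) (\<lambda>n z. \<Sum>i<n. x i * ker i z) (\<lambda>z. \<Sum>n. x n * ker n z) sequentially"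
      using \<rho> by (intro exI[of _ "\<rho> - norm w"]) auto
  qed
  thus ?thesis by (rule holomorphic_transform) (simp add: peak_sum_def)
qed

lemma peak_sum_combination:
  assumes x: "\<forall>n. norm (x n) \<le> X" and y: "\<forall>n. norm (y n) \<le> Y"
  shows "peak_sum (\<lambda>n. c * x n + y n) = (\<lambda>z. c * peak_sum x z + peak_sum y z)"
proof
  fix z
  show "peak_sum (\<lambda>n. c * x n + y n) z = c * peak_sum x z + peak_sum y z"
  proof (cases "norm z < 1")
    case True
    have s: "summable (\<lambda>n. x n * ker n z)" "summable (\<lambda>n. y n * ker n z)"
      by (rule summable_norm_cancel, rule summable_ker[OF True], fact)+
    have "(\<Sum>n. (c * x n + y n) * ker n z) = (\<Sum>n. c * (x n * ker n z) + y n * ker n z)"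
      by (simp add: algebra_simps)
    also have "\<dots> = (\<Sum>n. c * (x n * ker n z)) + (\<Sum>n. y n * ker n z)"
      by (intro suminf_add[symmetric] summable_mult s)
    also have "(\<Sum>n. c * (x n * ker n z)) = c * (\<Sum>n. x n * ker n z)" by (rule suminf_mult[OF s(1)])
    finally show ?thesis using True by (simp add: peak_sum_def)
  qed (simp add: peak_sum_def)
qed

text \<open>Used with t = 0 for the norm bound of \<open>peak_sum\<close> and with small \<epsilon>
  for its strong continuity.\<close>

lemma wmean_le_of_sum:
  assumes t: "0 \<le> t" and r: "0 \<le> r" "r < 1" and ep: "0 \<le> \<epsilon>"
    and v: "\<And>n z. norm z = r \<Longrightarrow> norm (v n z) \<le> \<epsilon> * (majorant n (phi t z) + majorant n z)"
    and vs: "\<And>z. norm z = r \<Longrightarrow> summable (\<lambda>n. norm (v n z))" and vc: "\<And>n. continuous_on unit_disc (v n)"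
    and h: "\<And>z. norm z = r \<Longrightarrow> h z = (\<Sum>n. v n z)"
  shows "wmean p \<alpha> r h \<le> ennreal (CS * \<epsilon> powr qexp p)"
proof -
  have z: "norm (of_real r * cis \<phi>) = r" for \<phi> :: real using r by (simp add: norm_mult)
  have "pmean p r h \<le> cmean p (\<lambda>\<phi>. ennreal ((\<Sum>n. norm (v n (of_real r * cis \<phi>))) powr qexp p))"
    unfolding pmean_def h[OF z] using q by (intro cmean_mono ennreal_leI powr_mono2 summable_norm vs z) auto
  also have "\<dots> \<le> ennreal (CS * \<epsilon> powr qexp p * (1 - r) powr (- (\<alpha> * qexp p)))"
  proof (rule sum_mean[OF t r ep])
    fix n
    show "(\<lambda>\<phi>. norm (v n (of_real r * cis \<phi>))) \<in> borel_measurable borel"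
      by (rule measurable_compose[OF measurable_circle[OF vc r] borel_measurable_norm])
  qed (use v vs z in auto)
  finally have "wmean p \<alpha> r h \<le> ennreal ((1 - r) powr (\<alpha> * qexp p)) * ennreal (CS * \<epsilon> powr qexp p * (1 - r) powr (- (\<alpha> * qexp p)))"
    unfolding wmean_def by (rule mult_left_mono) simp
  also have "\<dots> = ennreal ((1 - r) powr (\<alpha> * qexp p) * (CS * \<epsilon> powr qexp p * (1 - r) powr (- (\<alpha> * qexp p))))"
    using CS_nonneg by (intro ennreal_mult[symmetric]) auto
  also have "(1 - r) powr (\<alpha> * qexp p) * (CS * \<epsilon> powr qexp p * (1 - r) powr (- (\<alpha> * qexp p))) = CS * \<epsilon> powr qexp p"
    using r by (simp add: powr_minus field_simps)
  finally show ?thesis .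
qed

lemma wmean_peak_sum_le:
  assumes X: "\<forall>n. norm (x n) \<le> X" and r: "0 \<le> r" "r < 1"
  shows "wmean p \<alpha> r (peak_sum x) \<le> ennreal (CS * X powr qexp p)"
proof (rule wmean_le_of_sum[OF order_refl r, where v = "\<lambda>n z. x n * ker n z"])
  show X0: "0 \<le> X" using spec[OF X, of 0] norm_ge_zero order_trans by blast
  fix n and z :: complex assume z: "norm z = r"
  have "norm (x n * ker n z) \<le> X * majorant n z"
    unfolding norm_mult by (intro mult_mono X[rule_format] norm_ker_le_majorant X0) (use z r in auto)
  also have "\<dots> \<le> X * (majorant n (phi 0 z) + majorant n z)"
    using X0 majorant_nonneg by (intro mult_left_mono) auto
  finally show "norm (x n * ker n z) \<le> X * (majorant n (phi 0 z) + majorant n z)" .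
next
  show "continuous_on unit_disc (\<lambda>z. x n * ker n z)" for n
    by (intro continuous_intros holomorphic_on_imp_continuous_on ker_hol)
qed (use summable_ker[OF _ X] r in \<open>auto simp: peak_sum_def\<close>)

text \<open>\<open>ker_difference\<close> holds with one time bound for all kernels, so bounded
  coefficients only multiply \<epsilon> by \<open>X\<close>.\<close>

lemma peak_sum_strong:
  assumes X: "\<forall>n. norm (x n) \<le> X" shows "peak_sum x \<in> strong_cont_space phi p \<alpha>"
  unfolding strong_cont_iff[OF p]
proof (intro conjI allI impI)
  have X0: "0 \<le> X" using spec[OF X, of 0] norm_ge_zero order_trans by blast
  have hol: "peak_sum x holomorphic_on unit_disc" by (rule peak_sum_hol[OF X])
  show "peak_sum x \<in> H_inf p \<alpha>" unfolding H_inf_iff[OF p]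
    using hol wmean_peak_sum_le[OF X] CS_nonneg by (auto intro!: exI[of _ "CS * X powr qexp p"])
  fix e :: real assume e: "0 < e"
  \<comment> \<open>Solved from \<open>CS * (X * \<epsilon>) powr qexp p \<le> e\<close>; adding 1
    to \<open>CS\<close> and to \<open>X\<close> avoids division by zero.\<close>
  define \<epsilon> where "\<epsilon> = (e / (CS + 1)) powr (1 / qexp p) / (X + 1)"
  have c1: "0 < CS + 1" using CS_nonneg by simp
  have \<epsilon>: "0 < \<epsilon>" using e c1 X0 by (simp add: \<epsilon>_def)
  have le: "CS * (X * \<epsilon>) powr qexp p \<le> e"
  proof -
    have "X * \<epsilon> \<le> (X + 1) * \<epsilon>" using \<epsilon> by (intro mult_right_mono) auto
    also have "\<dots> = (e / (CS + 1)) powr (1 / qexp p)" using X0 by (simp add: \<epsilon>_def)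
    finally have "(X * \<epsilon>) powr qexp p \<le> ((e / (CS + 1)) powr (1 / qexp p)) powr qexp p"
      using X0 \<epsilon> q by (intro powr_mono2) auto
    also have "\<dots> = e / (CS + 1)" by (rule powr_powr_inverse) (use q e c1 in auto)
    finally have "CS * (X * \<epsilon>) powr qexp p \<le> CS * (e / (CS + 1))" by (rule mult_left_mono[OF _ CS_nonneg])
    also have "\<dots> \<le> (CS + 1) * (e / (CS + 1))" using e c1 by (intro mult_right_mono) auto
    finally show ?thesis using c1 by simp
  qed
  obtain \<delta> where \<delta>: "0 < \<delta>" "\<And>n t z. 0 \<le> t \<Longrightarrow> t < \<delta> \<Longrightarrow> norm z < 1 \<Longrightarrow>
    norm (ker n (phi t z) - ker n z) \<le> \<epsilon> * (majorant n (phi t z) + majorant n z)"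
    using ker_difference[OF \<epsilon>] by blast
  have "wmean p \<alpha> r (\<lambda>z. peak_sum x (phi t z) - peak_sum x z) \<le> ennreal e" if t: "0 < t" "t < \<delta>" and r: "r \<in> {0..<1}" for t r
  proof -
    have t0: "0 \<le> t" using t by simp
    have "wmean p \<alpha> r (\<lambda>z. peak_sum x (phi t z) - peak_sum x z) \<le> ennreal (CS * (X * \<epsilon>) powr qexp p)"
    proof (rule wmean_le_of_sum[OF t0, where v = "\<lambda>n z. x n * (ker n (phi t z) - ker n z)"])
      fix n and z :: complex assume z: "norm z = r"
      hence z1: "norm z < 1" using r by simp
      have w1: "norm (phi t z) < 1" by (rule phi_disc[OF t0 z1])
      have "norm (x n * (ker n (phi t z) - ker n z)) \<le> X * (\<epsilon> * (majorant n (phi t z) + majorant n z))"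
        unfolding norm_mult by (intro mult_mono X[rule_format] \<delta>(2) t0 t z1 X0) auto
      thus "norm (x n * (ker n (phi t z) - ker n z)) \<le> X * \<epsilon> * (majorant n (phi t z) + majorant n z)"
        by (simp add: mult.assoc)
    next
      fix z :: complex assume z: "norm z = r"
      hence z1: "norm z < 1" using r by simp
      have w1: "norm (phi t z) < 1" by (rule phi_disc[OF t0 z1])
      note s = summable_ker[OF w1 X] summable_ker[OF z1 X]
      show "summable (\<lambda>n. norm (x n * (ker n (phi t z) - ker n z)))"
      proof (rule summable_comparison_test'[OF summable_add[OF s]])
        show "norm (norm (x n * (ker n (phi t z) - ker n z))) \<le> norm (x n * ker n (phi t z)) + norm (x n * ker n z)" for n
          using norm_triangle_ineq4[of "x n * ker n (phi t z)" "x n * ker n z"] by (simp add: right_diff_distrib)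
      qed
      have "(\<Sum>n. x n * ker n (phi t z)) - (\<Sum>n. x n * ker n z) = (\<Sum>n. x n * ker n (phi t z) - x n * ker n z)"
        by (rule suminf_diff[OF summable_norm_cancel[OF s(1)] summable_norm_cancel[OF s(2)]])
      thus "peak_sum x (phi t z) - peak_sum x z = (\<Sum>n. x n * (ker n (phi t z) - ker n z))"
        using z1 w1 by (simp add: peak_sum_def right_diff_distrib)
    next
      show "continuous_on unit_disc (\<lambda>z. x n * (ker n (phi t z) - ker n z))" for n
        by (intro holomorphic_on_imp_continuous_on holomorphic_intros phi_compose_hol[OF ker_hol t0] ker_hol)
    qed (use r X0 \<epsilon> in auto)
    also have "\<dots> \<le> ennreal e" by (rule ennreal_leI[OF le])
    finally show ?thesis .
  qed
  thus "\<exists>d>0. \<forall>t. 0 < t \<and> t < d \<longrightarrow> (\<forall>r\<in>{0..<1}. wmean p \<alpha> r (\<lambda>z. peak_sum x (phi t z) - peak_sum x z) \<le> ennreal e)"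
    using \<delta>(1) by blast
qed

definition Cpt where "Cpt = (4 * 2 powr (\<alpha> * qexp p)) powr (1 / qexp p)"

lemma Cpt_pos: "0 < Cpt"
  by (simp add: Cpt_def)

lemma pointwise_bound:
  assumes f: "f holomorphic_on unit_disc" and w: "norm w < 1" and c: "0 \<le> c"
    and N: "wmean p \<alpha> ((1 + norm w) / 2) f \<le> ennreal (c powr qexp p)"
  shows "norm (f w) * (1 - norm w) powr (\<alpha> + eexp p) \<le> Cpt * c"
proof -
  have "ennreal ((norm (f w) * (1 - norm w) powr (\<alpha> + eexp p)) powr qexp p) \<le>
     ennreal (4 * 2 powr (\<alpha> * qexp p)) * wmean p \<alpha> ((1 + norm w) / 2) f"
    by (rule point_evaluation[OF p f w])
  also have "\<dots> \<le> ennreal (4 * 2 powr (\<alpha> * qexp p)) * ennreal (c powr qexp p)"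
    by (rule mult_left_mono[OF N]) simp
  also have "\<dots> = ennreal ((4 * 2 powr (\<alpha> * qexp p)) * c powr qexp p)"
    by (rule ennreal_mult[symmetric]) auto
  also have "(4 * 2 powr (\<alpha> * qexp p)) * c powr qexp p = (Cpt * c) powr qexp p"
  proof -
    have "Cpt powr qexp p = 4 * 2 powr (\<alpha> * qexp p)" unfolding Cpt_def by (rule powr_powr_inverse[OF q]) simp
    thus ?thesis by (simp only: powr_mult)
  qed
  finally have "(norm (f w) * (1 - norm w) powr (\<alpha> + eexp p)) powr qexp p \<le> (Cpt * c) powr qexp p"
    by (subst (asm) ennreal_le_iff) auto
  thus ?thesis using powr_le_iff[OF q, of "norm (f w) * (1 - norm w) powr (\<alpha> + eexp p)" "Cpt * c"] Cpt_pos c by simp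
qed

text \<open>After scaling, the diagonal term at \<open>a n\<close> is at least (1/2)^K times
  \<open>norm (x n)\<close>, since \<open>1 - cnj (a n) * a n\<close> has modulus at most
  \<open>2 * d n\<close>. The other terms add up to at most 4 \<theta>^\<alpha> X, which
  \<open>\<theta>K\<close> bounds by X (1/2)^K / 4.\<close>

lemma peak_sum_lower:
  assumes X: "\<forall>n. norm (x n) \<le> X"
  shows "(1/2) ^ K * (norm (x n) - X / 4) \<le> norm (peak_sum x (a n)) * d n powr (\<alpha> + eexp p)"
proof -
  have X0: "0 \<le> X" using spec[OF X, of 0] norm_ge_zero order_trans by blast
  define \<beta> where "\<beta> = \<alpha> + eexp p"
  have \<beta>K: "\<beta> + \<kappa> = real K" by (simp add: \<beta>_def \<kappa>_def)
  define g where "g m = (if m = n then 0 else x m * ker m (a n))" for m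
  note s = summable_ker[OF a1[of n] X]
  have gs: "summable (\<lambda>m. norm (g m))"
    by (rule summable_comparison_test'[OF s]) (simp add: g_def)
  have "(\<lambda>m. (if m = n then x m * ker m (a n) else 0) + g m) sums (x n * ker n (a n) + (\<Sum>m. g m))"
    by (rule sums_add[OF sums_single summable_sums[OF summable_norm_cancel[OF gs]]])
  moreover have "(if m = n then x m * ker m (a n) else 0) + g m = x m * ker m (a n)" for m
    by (simp add: g_def)
  ultimately have "peak_sum x (a n) = x n * ker n (a n) + (\<Sum>m. g m)"
    using a1[of n] by (simp add: peak_sum_def sums_iff)
  hence 1: "norm (x n * ker n (a n)) - norm (\<Sum>m. g m) \<le> norm (peak_sum x (a n))"
    using norm_triangle_ineq2[of "x n * ker n (a n)" "- (\<Sum>m. g m)"] by simp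
  have gm: "d n powr \<beta> * norm (g m) \<le> X * (if m = n then 0 else ratio (1 - norm (a n)) m powr \<alpha>)" for m
  proof (cases "m = n")
    case False
    have "norm (a m) * norm (a n) \<le> norm (a m) * 1" "norm (a m) * norm (a n) \<le> 1 * norm (a n)"
      using a1[of n] a1[of m] by (intro mult_mono; simp)+
    hence "max (d m) (d n) \<le> norm (1 - cnj (a m) * a n)"
      using one_minus_cnj_mult_lower[of "a m" "a n"] by (simp add: d_def)
    hence "norm (1 - cnj (a m) * a n) powr (- real K) \<le> max (d m) (d n) powr (- real K)"
      using d0[of m] by (intro powr_mono2') auto
    hence "norm (ker m (a n)) \<le> d m powr \<kappa> * max (d m) (d n) powr (- real K)"
      unfolding norm_ker[OF a1] by (intro mult_left_mono) auto
    hence "d n powr \<beta> * norm (ker m (a n)) \<le> d n powr \<beta> * (d m powr \<kappa> * max (d m) (d n) powr (- real K))"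
      by (intro mult_left_mono) auto
    also have "\<dots> = d n powr \<beta> * d m powr \<kappa> * max (d m) (d n) powr (- (\<beta> + \<kappa>))"
      unfolding \<beta>K by simp
    also have "\<dots> \<le> min (d m / d n) (d n / d m) powr \<alpha>"
      by (rule kernel_exponent_bound) (use d0 \<alpha> kap e in \<open>auto simp: \<beta>_def\<close>)
    also have "\<dots> = ratio (1 - norm (a n)) m powr \<alpha>" by (simp add: ratio_def d_def)
    finally have "norm (x m) * (d n powr \<beta> * norm (ker m (a n))) \<le> X * ratio (1 - norm (a n)) m powr \<alpha>"
      by (intro mult_mono X[rule_format] X0) auto
    thus ?thesis using False by (simp add: g_def norm_mult mult_ac)
  qed (simp add: g_def)
  have 2: "d n powr \<beta> * norm (\<Sum>m. g m) \<le> X * ((1/2) ^ K / 4)"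
  proof -
    have t: "0 < \<theta> powr \<alpha>" "\<theta> powr \<alpha> \<le> 1/2"
    proof -
      show "0 < \<theta> powr \<alpha>" using \<theta> by simp
      have "(1/2::real) ^ K \<le> 1" by (simp add: power_le_one)
      thus "\<theta> powr \<alpha> \<le> 1/2" using \<theta>K by linarith
    qed
    have "d n powr \<beta> * norm (\<Sum>m. g m) \<le> d n powr \<beta> * (\<Sum>m. norm (g m))"
      by (intro mult_left_mono summable_norm gs) auto
    also have "\<dots> = (\<Sum>m. d n powr \<beta> * norm (g m))" by (rule suminf_mult[OF gs, symmetric])
    also have "\<dots> \<le> X * (2 * (\<theta> powr \<alpha> / (1 - \<theta> powr \<alpha>)))"
    proof (rule suminf_le_const[OF summable_mult[OF gs]])
      fix N
      have "(\<Sum>m<N. d n powr \<beta> * norm (g m)) \<le> (\<Sum>m<N. X * (if m = n then 0 else ratio (1 - norm (a n)) m powr \<alpha>))"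
        by (intro sum_mono gm)
      also have "\<dots> = X * (\<Sum>m<N. if m = n then 0 else ratio (1 - norm (a n)) m powr \<alpha>)"
        by (rule sum_distrib_left[symmetric])
      also have "\<dots> \<le> X * (2 * (\<theta> powr \<alpha> / (1 - \<theta> powr \<alpha>)))"
        by (intro mult_left_mono ratio_sum_off_diagonal \<alpha> X0)
      finally show "(\<Sum>m<N. d n powr \<beta> * norm (g m)) \<le> X * (2 * (\<theta> powr \<alpha> / (1 - \<theta> powr \<alpha>)))" .
    qed
    also have "\<dots> \<le> X * ((1/2) ^ K / 4)"
    proof (intro mult_left_mono X0)
      have "\<theta> powr \<alpha> / (1 - \<theta> powr \<alpha>) \<le> \<theta> powr \<alpha> / (1/2)" using t by (intro divide_left_mono) auto
      thus "2 * (\<theta> powr \<alpha> / (1 - \<theta> powr \<alpha>)) \<le> (1/2) ^ K / 4" using \<theta>K by simp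
    qed
    finally show ?thesis .
  qed
  have 3: "(1/2) ^ K * norm (x n) \<le> d n powr \<beta> * norm (x n * ker n (a n))"
  proof -
    have "1 - cnj (a n) * a n = of_real (1 - (norm (a n))\<^sup>2)"
      using complex_norm_square[of "a n"] by (simp add: mult.commute)
    hence "norm (1 - cnj (a n) * a n) = \<bar>1 - (norm (a n))\<^sup>2\<bar>" by (simp only: norm_of_real)
    also have "\<dots> = (1 + norm (a n)) * d n"
    proof -
      have "(norm (a n))\<^sup>2 \<le> 1" using a1[of n] by (simp add: power_le_one)
      hence "\<bar>1 - (norm (a n))\<^sup>2\<bar> = 1 - (norm (a n))\<^sup>2" by simp
      thus ?thesis by (simp add: d_def power2_eq_square algebra_simps)
    qed
    also have "\<dots> \<le> 2 * d n" using a1[of n] d0[of n] by (intro mult_right_mono) auto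
    finally have "norm (1 - cnj (a n) * a n) \<le> 2 * d n" .
    hence "(2 * d n) powr (- real K) \<le> norm (1 - cnj (a n) * a n) powr (- real K)"
      using den_ne[OF a1, of n n] by (intro powr_mono2') auto
    hence "d n powr (real K) * (2 * d n) powr (- real K) \<le> d n powr (real K) * norm (1 - cnj (a n) * a n) powr (- real K)"
      by (intro mult_left_mono) auto
    moreover have "d n powr (real K) * (2 * d n) powr (- real K) = (1/2) ^ K"
      using d0[of n] by (simp add: powr_minus powr_mult powr_realpow power_divide field_simps)
    moreover have "d n powr (real K) = d n powr \<beta> * d n powr \<kappa>" unfolding \<beta>K[symmetric] by (rule powr_add)
    ultimately have "(1/2) ^ K \<le> d n powr \<beta> * norm (ker n (a n))"
      unfolding norm_ker[OF a1] by (simp add: mult.assoc)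
    hence "(1/2) ^ K * norm (x n) \<le> d n powr \<beta> * norm (ker n (a n)) * norm (x n)" by (rule mult_right_mono) simp
    thus ?thesis by (simp add: norm_mult mult_ac)
  qed
  have "d n powr \<beta> * (norm (x n * ker n (a n)) - norm (\<Sum>m. g m)) \<le> d n powr \<beta> * norm (peak_sum x (a n))"
    by (intro mult_left_mono 1) auto
  moreover have "(1/2) ^ K * (norm (x n) - X / 4) \<le> d n powr \<beta> * (norm (x n * ker n (a n)) - norm (\<Sum>m. g m))"
    using 2 3 by (simp add: algebra_simps)
  ultimately show ?thesis unfolding \<beta>_def by (simp add: mult.commute)
qed

definition Clow where "Clow = 2 * 2 ^ K * Cpt"

lemma Clow_pos: "0 < Clow"
  using Cpt_pos by (simp add: Clow_def)

text \<open>Point evaluation at the peaks bounds every coefficient by \<open>X / 4\<close> plus a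
  multiple of \<open>c\<close>; taking the supremum over \<open>n\<close>, the first part is
  absorbed.\<close>

lemma linf_norm_le:
  assumes x: "x \<in> linf" and c: "0 \<le> c" and N: "\<And>r. 0 \<le> r \<Longrightarrow> r < 1 \<Longrightarrow> wmean p \<alpha> r (peak_sum x) \<le> ennreal (c powr qexp p)"
  shows "linf_norm x \<le> Clow * c"
proof -
  define X where "X = linf_norm x"
  have X: "\<forall>n. norm (x n) \<le> X" unfolding X_def by (intro allI linf_norm_ge[OF x])
  have "norm (x n) \<le> X / 4 + 2 ^ K * (Cpt * c)" for n
  proof -
    have "norm (peak_sum x (a n)) * d n powr (\<alpha> + eexp p) \<le> Cpt * c"
      unfolding d_def by (rule pointwise_bound[OF peak_sum_hol[OF X] a1 c N]) (use a1[of n] in auto)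
    with peak_sum_lower[OF X, of n] have "(1/2) ^ K * (norm (x n) - X / 4) \<le> Cpt * c" by linarith
    hence "2 ^ K * ((1/2) ^ K * (norm (x n) - X / 4)) \<le> 2 ^ K * (Cpt * c)" by (rule mult_left_mono) simp
    moreover have "2 ^ K * ((1/2) ^ K * (norm (x n) - X / 4)) = norm (x n) - X / 4"
      by (simp add: power_divide)
    ultimately show ?thesis by linarith
  qed
  hence "X \<le> X / 4 + 2 ^ K * (Cpt * c)" unfolding X_def by (rule linf_norm_least)
  moreover have "0 \<le> 2 ^ K * (Cpt * c)" using Cpt_pos c by simp
  ultimately have "X \<le> 2 * (2 ^ K * (Cpt * c))" by linarith
  thus ?thesis by (simp add: X_def Clow_def mult.assoc)
qed

text \<open>At the peaks the scaled values stay above 3/4 of (1/2)^K, whereas vanishing weighted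
  means would push them down to a quarter of (1/2)^K near the boundary.\<close>

lemma peak_sum_one_not_H_zero: "peak_sum (\<lambda>_. 1) \<notin> H_zero p \<alpha>"
proof
  assume "peak_sum (\<lambda>_. 1) \<in> H_zero p \<alpha>"
  define c where "c = (1/2) ^ K / (4 * Cpt)"
  have c: "0 < c" using Cpt_pos by (simp add: c_def)
  hence "0 < c powr qexp p" by simp
  with \<open>peak_sum (\<lambda>_. 1) \<in> H_zero p \<alpha>\<close> obtain r0 where r0: "r0 < 1"
    "\<And>r. r0 < r \<Longrightarrow> 0 \<le> r \<Longrightarrow> r < 1 \<Longrightarrow> wmean p \<alpha> r (peak_sum (\<lambda>_. 1)) \<le> ennreal (c powr qexp p)"
    unfolding H_zero_iff[OF p \<alpha>] by meson
  have "(\<lambda>n. \<theta> ^ n) \<longlonglongrightarrow> 0" using \<theta> by (intro LIMSEQ_realpow_zero) auto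
  hence "eventually (\<lambda>n. \<theta> ^ n < 1 - r0) sequentially" using r0(1) by (intro order_tendstoD) auto
  then obtain n where n: "\<theta> ^ n < 1 - r0" by (auto simp: eventually_sequentially)
  hence "r0 < norm (a n)" using d_geometric[of n] by (simp add: d_def)
  hence rn: "r0 < (1 + norm (a n)) / 2" "(1 + norm (a n)) / 2 < 1" using a1[of n] by auto
  have X: "\<forall>m::nat. norm ((\<lambda>_. 1 :: complex) m) \<le> 1" by simp
  have "norm (peak_sum (\<lambda>_. 1) (a n)) * d n powr (\<alpha> + eexp p) \<le> Cpt * c"
    unfolding d_def by (rule pointwise_bound[OF peak_sum_hol[OF X] a1 less_imp_le[OF c] r0(2)]) (use rn in auto)
  with peak_sum_lower[OF X, of n] have "(1/2) ^ K * (1 - 1 / 4) \<le> Cpt * c" by simp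
  also have "\<dots> = (1/2) ^ K / 4" using Cpt_pos by (simp add: c_def)
  finally show False by simp
qed

end

section \<open>Two-sided norm bounds, closed range and the choice of the peaks\<close>

context peaks
begin

lemma Hnorm_peak_sum_le:
  assumes x: "x \<in> linf"
  shows "Hnorm p \<alpha> (peak_sum x) \<le> ennreal ((CS powr (1 / qexp p) + 1) * linf_norm x)"
proof -
  let ?C = "CS powr (1 / qexp p) + 1"
  have X: "\<forall>n. norm (x n) \<le> linf_norm x" by (intro allI linf_norm_ge[OF x])
  have X0: "0 \<le> linf_norm x" by (rule linf_norm_nonneg[OF x])
  have "CS = (CS powr (1 / qexp p)) powr qexp p" by (rule powr_powr_inverse[OF q CS_nonneg, symmetric])
  also have "\<dots> \<le> ?C powr qexp p" using q by (intro powr_mono2) auto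
  finally have "CS * linf_norm x powr qexp p \<le> ?C powr qexp p * linf_norm x powr qexp p"
    by (rule mult_right_mono) simp
  hence le: "CS * linf_norm x powr qexp p \<le> (?C * linf_norm x) powr qexp p" by (simp only: powr_mult)
  show ?thesis
    by (subst Hnorm_le_iff[OF p holomorphic_on_imp_continuous_on[OF peak_sum_hol[OF X]]])
       (use X0 order_trans[OF wmean_peak_sum_le[OF X] ennreal_leI[OF le]] in \<open>auto simp: add_nonneg_nonneg\<close>)
qed

lemma Hnorm_peak_sum_ge:
  assumes x: "x \<in> linf"
  shows "ennreal (1 / Clow * linf_norm x) \<le> Hnorm p \<alpha> (peak_sum x)"
proof (cases "Hnorm p \<alpha> (peak_sum x)")
  case (real c)
  have X: "\<forall>n. norm (x n) \<le> linf_norm x" by (intro allI linf_norm_ge[OF x])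
  have "Hnorm p \<alpha> (peak_sum x) \<le> ennreal c" using real by simp
  hence "\<forall>r\<in>{0..<1}. wmean p \<alpha> r (peak_sum x) \<le> ennreal (c powr qexp p)"
    by (subst (asm) Hnorm_le_iff[OF p holomorphic_on_imp_continuous_on[OF peak_sum_hol[OF X]] real(1)])
  hence "linf_norm x \<le> Clow * c" by (intro linf_norm_le[OF x real(1)]) auto
  hence "1 / Clow * linf_norm x \<le> c" using Clow_pos by (simp add: field_simps)
  thus ?thesis using real by (simp add: ennreal_leI)
qed simp

text \<open>The lower norm bound makes the coefficient sequences Cauchy in the supremum norm. Their
  limit is a bounded sequence, and continuity of point evaluations identifies its image with
  \<open>g\<close>.\<close>

lemma peak_sum_closed_range:
  assumes s: "\<And>n. s n \<in> linf" and g: "g \<in> H_inf p \<alpha>"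
    and lim: "(\<lambda>n. Hnorm p \<alpha> (\<lambda>z. peak_sum (s n) z - g z)) \<longlonglongrightarrow> 0"
  obtains x where "x \<in> linf" "\<And>z. norm z < 1 \<Longrightarrow> g z = peak_sum x z"
proof -
  have gh: "g holomorphic_on unit_disc" using g by (simp add: H_inf_def)
  have sX: "\<forall>k. norm (s n k) \<le> linf_norm (s n)" for n by (intro allI linf_norm_ge[OF s])
  have Th: "peak_sum (s n) holomorphic_on unit_disc" for n by (rule peak_sum_hol[OF sX])
  have hh: "(\<lambda>z. peak_sum (s n) z - g z) holomorphic_on unit_disc" for n by (intro holomorphic_intros Th gh)
  have N: "\<exists>N. \<forall>n\<ge>N. \<forall>r\<in>{0..<1}. wmean p \<alpha> r (\<lambda>z. peak_sum (s n) z - g z) \<le> ennreal e" if "0 < e" for e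
    using lim that unfolding eventually_sequentially[symmetric]
    by (subst (asm) Hnorm_tendsto_0_iff[OF p]) (auto intro!: always_eventually holomorphic_on_imp_continuous_on[OF hh])
  have Cauchy: "\<exists>N. \<forall>n\<ge>N. \<forall>m\<ge>N. \<forall>k. norm (s n k - s m k) \<le> \<eta>" if \<eta>: "0 < \<eta>" for \<eta>
  proof -
    define c where "c = \<eta> / Clow"
    have c: "0 < c" using \<eta> Clow_pos by (simp add: c_def)
    \<comment> \<open>Two errors \<open>e\<close>, combined by the triangle inequality for q-th
      powers with its factor \<open>2 powr qexp p\<close>, give
      \<open>c powr qexp p\<close>.\<close>
    define e where "e = c powr qexp p / (2 powr qexp p * 2)"
    have e0: "0 < e" using c by (simp add: e_def)
    have e1: "2 powr qexp p * (1 * e + e) = c powr qexp p" by (simp add: e_def)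
    from N[OF e0] obtain N where "\<forall>n\<ge>N. \<forall>r\<in>{0..<1}. wmean p \<alpha> r (\<lambda>z. peak_sum (s n) z - g z) \<le> ennreal e"
      by blast
    hence N: "wmean p \<alpha> r (\<lambda>z. peak_sum (s n) z - g z) \<le> ennreal e" if "n \<ge> N" "0 \<le> r" "r < 1" for n r
      using that by simp
    have "norm (s n k - s m k) \<le> \<eta>" if nm: "n \<ge> N" "m \<ge> N" for n m k
    proof -
      define y where "y = (\<lambda>k. (-1) * s m k + s n k)"
      have y: "y \<in> linf" unfolding y_def by (rule linf_combination[OF s s])
      have Ty: "peak_sum y = (\<lambda>z. (-1) * peak_sum (s m) z + peak_sum (s n) z)"
        unfolding y_def by (rule peak_sum_combination[OF sX sX])
      have "linf_norm y \<le> Clow * c"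
      proof (rule linf_norm_le[OF y])
        fix r :: real assume r: "0 \<le> r" "r < 1"
        have "wmean p \<alpha> r (peak_sum y) \<le> ennreal (2 powr qexp p) * (wmean p \<alpha> r (\<lambda>z. peak_sum (s n) z - g z) + wmean p \<alpha> r (\<lambda>z. peak_sum (s m) z - g z))"
        proof (rule wmean_add_le[OF p holomorphic_on_imp_continuous_on[OF hh] holomorphic_on_imp_continuous_on[OF hh] r])
          fix t :: real
          let ?z = "of_real r * cis t"
          have "peak_sum y ?z = (peak_sum (s n) ?z - g ?z) - (peak_sum (s m) ?z - g ?z)" by (simp add: Ty)
          thus "norm (peak_sum y ?z) \<le> norm (peak_sum (s n) ?z - g ?z) + norm (peak_sum (s m) ?z - g ?z)"
            by (simp only: norm_triangle_ineq4)
        qed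
        also have "\<dots> \<le> ennreal (2 powr qexp p) * (ennreal e + ennreal e)"
          by (intro mult_left_mono add_mono N nm r) auto
        also have "\<dots> = ennreal (2 powr qexp p * (1 * e + e))"
          using e0 by (subst ennreal_combination) auto
        finally show "wmean p \<alpha> r (peak_sum y) \<le> ennreal (c powr qexp p)" unfolding e1 .
      qed (use c in simp)
      also have "\<dots> = \<eta>" using Clow_pos by (simp add: c_def)
      finally have "norm (y k) \<le> \<eta>" using linf_norm_ge[OF y, of k] by linarith
      thus ?thesis by (simp add: y_def)
    qed
    thus ?thesis by blast
  qed
  have "Cauchy (\<lambda>n. s n k)" for k
  proof (rule metric_CauchyI)
    fix e :: real assume "0 < e"
    hence "0 < e / 2" by simp
    from Cauchy[OF this] obtain N where N: "\<forall>n\<ge>N. \<forall>m\<ge>N. \<forall>k. norm (s n k - s m k) \<le> e / 2" by blast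
    have "dist (s m k) (s n k) < e" if "m \<ge> N" "n \<ge> N" for m n
    proof -
      have "norm (s m k - s n k) \<le> e / 2" using N that by blast
      thus ?thesis using \<open>0 < e\<close> by (simp add: dist_norm)
    qed
    thus "\<exists>N. \<forall>m\<ge>N. \<forall>n\<ge>N. dist (s m k) (s n k) < e" by blast
  qed
  hence "\<forall>k. \<exists>l. (\<lambda>n. s n k) \<longlonglongrightarrow> l" by (simp add: Cauchy_convergent_iff convergent_def)
  then obtain x where x: "\<And>k. (\<lambda>n. s n k) \<longlonglongrightarrow> x k" by metis
  have unif: "\<exists>N. \<forall>n\<ge>N. \<forall>k. norm (s n k - x k) \<le> \<eta>" if \<eta>: "0 < \<eta>" for \<eta>
  proof -
    from Cauchy[OF \<eta>] obtain N where N: "\<forall>n\<ge>N. \<forall>m\<ge>N. \<forall>k. norm (s n k - s m k) \<le> \<eta>" by blast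
    have "norm (s n k - x k) \<le> \<eta>" if "n \<ge> N" for n k
    proof (rule Lim_bounded[where M = N])
      show "(\<lambda>m. norm (s n k - s m k)) \<longlonglongrightarrow> norm (s n k - x k)" by (intro tendsto_intros x)
    qed (use N that in auto)
    thus ?thesis by blast
  qed
  obtain N1 where N1: "\<And>k. norm (s N1 k - x k) \<le> 1" using unif[of 1] by auto
  have "norm (x k) \<le> linf_norm (s N1) + 1" for k
    using norm_triangle_ineq4[of "s N1 k" "s N1 k - x k"] N1[of k] spec[OF sX, of N1 k] by simp
  hence xX: "\<forall>k. norm (x k) \<le> linf_norm (s N1) + 1" by blast
  have xl: "x \<in> linf" using xX by (intro linfI) blast
  have "g z = peak_sum x z" if z: "norm z < 1" for z
  proof (rule LIMSEQ_unique)
    define y where "y = (1 - norm z) powr (\<alpha> + eexp p)"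
    have y: "0 < y" using z by (simp add: y_def)
    show "(\<lambda>n. peak_sum (s n) z) \<longlonglongrightarrow> g z"
    proof (rule metric_LIMSEQ_I)
      fix \<eta> :: real assume \<eta>: "0 < \<eta>"
      define c where "c = \<eta> * y / (2 * Cpt)"
      have c: "0 < c" using \<eta> y Cpt_pos by (simp add: c_def)
      hence "0 < c powr qexp p" by simp
      from N[OF this] obtain N where N: "\<forall>n\<ge>N. \<forall>r\<in>{0..<1}. wmean p \<alpha> r (\<lambda>z. peak_sum (s n) z - g z) \<le> ennreal (c powr qexp p)"
        by blast
      have "dist (peak_sum (s n) z) (g z) < \<eta>" if "n \<ge> N" for n
      proof -
        have "norm (peak_sum (s n) z - g z) * y \<le> Cpt * c" unfolding y_def
          by (rule pointwise_bound[OF hh z less_imp_le[OF c]]) (use N that z in auto)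
        also have "\<dots> = \<eta> / 2 * y" using Cpt_pos by (simp add: c_def)
        finally have "norm (peak_sum (s n) z - g z) \<le> \<eta> / 2" using y by (simp only: mult_le_cancel_right_pos)
        thus ?thesis using \<eta> by (simp add: dist_norm)
      qed
      thus "\<exists>N. \<forall>n\<ge>N. dist (peak_sum (s n) z) (g z) < \<eta>" by blast
    qed
    have ks: "summable (\<lambda>k. norm (1 * ker k z))" by (rule summable_ker[OF z, of "\<lambda>_. 1" 1]) simp
    define S where "S = (\<Sum>k. norm (ker k z))"
    have S: "0 \<le> S" unfolding S_def by (rule suminf_nonneg) (use ks in auto)
    show "(\<lambda>n. peak_sum (s n) z) \<longlonglongrightarrow> peak_sum x z"
    proof (rule metric_LIMSEQ_I)
      fix \<eta> :: real assume \<eta>: "0 < \<eta>"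
      define c where "c = \<eta> / (S + 1)"
      have c: "0 < c" using \<eta> S by (simp add: c_def)
      from unif[OF c] obtain N where N: "\<forall>n\<ge>N. \<forall>k. norm (s n k - x k) \<le> c" by blast
      have "dist (peak_sum (s n) z) (peak_sum x z) < \<eta>" if "n \<ge> N" for n
      proof -
        have le: "\<forall>k. norm ((-1) * x k + s n k) \<le> c" using N that by simp
        have "peak_sum (s n) z - peak_sum x z = peak_sum (\<lambda>k. (-1) * x k + s n k) z"
          using peak_sum_combination[OF xX sX[of n], where c = "-1"] by simp
        also have "\<dots> = (\<Sum>k. ((-1) * x k + s n k) * ker k z)" using z by (simp add: peak_sum_def)
        also have "norm \<dots> \<le> (\<Sum>k. norm (((-1) * x k + s n k) * ker k z))"
          by (rule summable_norm[OF summable_ker[OF z le]])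
        also have "\<dots> \<le> (\<Sum>k. c * norm (ker k z))"
        proof (rule suminf_le[OF _ summable_ker[OF z le]])
          show "norm (((-1) * x k + s n k) * ker k z) \<le> c * norm (ker k z)" for k
            unfolding norm_mult by (intro mult_right_mono le[rule_format]) simp
          show "summable (\<lambda>k. c * norm (ker k z))" using ks by (intro summable_mult) simp
        qed
        also have "\<dots> = c * S" unfolding S_def by (rule suminf_mult) (use ks in simp)
        also have "\<dots> < c * (S + 1)" using c by simp
        also have "\<dots> = \<eta>" using S by (simp add: c_def)
        finally show ?thesis by (simp add: dist_norm)
      qed
      thus "\<exists>N. \<forall>n\<ge>N. dist (peak_sum (s n) z) (peak_sum x z) < \<eta>" by blast
    qed
  qed
  thus thesis using that xl by blast
qed

theorem contains_closed_linf_strong: "contains_closed_linf p \<alpha> (strong_cont_space phi p \<alpha>)"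
  unfolding contains_closed_linf_def
proof (intro exI[of _ peak_sum] conjI ballI allI impI)
  fix x assume x: "x \<in> linf"
  have X: "\<forall>n. norm (x n) \<le> linf_norm x" by (intro allI linf_norm_ge[OF x])
  show "peak_sum x \<in> strong_cont_space phi p \<alpha>" by (rule peak_sum_strong[OF X])
  fix y and c :: complex assume y: "y \<in> linf"
  show "peak_sum (\<lambda>n. c * x n + y n) = (\<lambda>z. c * peak_sum x z + peak_sum y z)"
    by (rule peak_sum_combination[OF X]) (use linf_norm_ge[OF y] in blast)
next
  \<comment> \<open>The summand 1 secures the strict positivity that the definition asks of the
    upper constant.\<close>
  have "0 < CS powr (1 / qexp p) + 1" by (intro add_nonneg_pos) auto
  thus "\<exists>c C. 0 < c \<and> 0 < C \<and> (\<forall>x\<in>linf. ennreal (c * linf_norm x) \<le> Hnorm p \<alpha> (peak_sum x) \<and> Hnorm p \<alpha> (peak_sum x) \<le> ennreal (C * linf_norm x))"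
    using Clow_pos Hnorm_peak_sum_le Hnorm_peak_sum_ge
    by (intro exI[of _ "1 / Clow"] exI[of _ "CS powr (1 / qexp p) + 1"]) auto
next
  fix s g assume A: "\<forall>n. s n \<in> linf" "g \<in> H_inf p \<alpha>" "(\<lambda>n. Hnorm p \<alpha> (\<lambda>z. peak_sum (s n) z - g z)) \<longlonglongrightarrow> 0"
  obtain x where x: "x \<in> linf" "\<And>z. norm z < 1 \<Longrightarrow> g z = peak_sum x z"
    by (rule peak_sum_closed_range[OF A(1)[rule_format] A(2,3)]) blast
  show "\<exists>x\<in>linf. \<forall>z\<in>unit_disc. g z = peak_sum x z"
    by (rule bexI[OF _ x(1)]) (simp add: x(2))
qed

end

context interior_semigroup_P
begin

text \<open>Failure of the little Bloch condition supplies points arbitrarily close to the circle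
  with \<open>e * norm (P z) < 1 - norm z\<close>. Once \<open>K\<close> and then \<theta> are
  fixed, each next point is taken far enough out for the lacunary condition.\<close>

lemma obtain_peaks:
  assumes p: "0 < p" and \<alpha>: "0 < \<alpha>" and nb: "g_symbol G b \<notin> little_bloch"
  obtains a \<theta> C0 K where "peaks phi G b P a \<theta> p \<alpha> C0 K"
proof -
  from nb obtain e where e: "0 < e" "\<And>r. r < 1 \<Longrightarrow> \<exists>z. r < norm z \<and> norm z < 1 \<and> e * norm (P z) < 1 - norm z"
    unfolding little_bloch_iff by (auto simp: not_le)
  define K where "K = nat \<lceil>2 * \<alpha> + 2 * eexp p + 1\<rceil>"
  \<comment> \<open>The value for which the requirement on \<open>\<theta> powr \<alpha>\<close> in
    \<open>peaks\<close> is an equality.\<close>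
  define \<theta> where "\<theta> = ((1/2) ^ K / 16) powr (1 / \<alpha>)"
  have \<theta>0: "0 < \<theta>" by (simp add: \<theta>_def)
  have \<theta>\<alpha>: "\<theta> powr \<alpha> = (1/2) ^ K / 16" using \<alpha> by (simp add: \<theta>_def powr_powr)
  have \<theta>1: "\<theta> < 1"
  proof -
    have "(1/2::real) ^ K \<le> 1" by (simp add: power_le_one)
    hence "((1/2) ^ K / 16) powr (1 / \<alpha>) < 1 powr (1 / \<alpha>)" using \<alpha> by (intro powr_less_mono2) auto
    thus ?thesis by (simp add: \<theta>_def)
  qed
  define Q where "Q z \<longleftrightarrow> 0 < norm z \<and> norm z < 1 \<and> e * norm (P z) < 1 - norm z" for z
  have "\<exists>a. \<forall>n::nat. Q (a n) \<and> 1 - norm (a (Suc n)) \<le> \<theta> * (1 - norm (a n))"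
  proof (rule dependent_nat_choice)
    show "\<exists>z. Q z" using e(2)[of 0] by (auto simp: Q_def)
    fix z and n :: nat assume z: "Q z"
    have "0 < \<theta> * (1 - norm z)" "\<theta> * (1 - norm z) < 1"
      using z \<theta>0 \<theta>1 mult_strict_mono[of \<theta> 1 "1 - norm z" 1] by (auto simp: Q_def)
    with e(2)[of "1 - \<theta> * (1 - norm z)"] obtain w where
      "1 - \<theta> * (1 - norm z) < norm w" "norm w < 1" "e * norm (P w) < 1 - norm w" by auto
    with \<open>\<theta> * (1 - norm z) < 1\<close> show "\<exists>w. Q w \<and> 1 - norm w \<le> \<theta> * (1 - norm z)"
      unfolding Q_def by (intro exI[of _ w]) auto
  qed
  then obtain a where a: "\<And>n. Q (a n)" "\<And>n. 1 - norm (a (Suc n)) \<le> \<theta> * (1 - norm (a n))" by blast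
  have "peaks phi G b P a \<theta> p \<alpha> (1 / e) K"
  proof
    fix n
    show "0 < 1 - norm (a n)" "a n \<noteq> 0" using a(1)[of n] by (auto simp: Q_def)
    show "norm (P (a n)) \<le> 1 / e * (1 - norm (a n))" using a(1)[of n] e(1) by (simp add: Q_def field_simps)
    show "2 * \<alpha> + 2 * eexp p + 1 \<le> real K" unfolding K_def by (rule real_nat_ceiling_ge)
  qed (use a \<theta>0 \<theta>1 \<theta>\<alpha> p \<alpha> e in auto)
  thus thesis by (rule that)
qed

end

theorem theorem6p4:
  fixes phi :: "real \<Rightarrow> complex \<Rightarrow> complex" and G :: "complex \<Rightarrow> complex"
    and b :: complex and p :: ereal and \<alpha> :: real
  assumes "0 < p" and "0 < \<alpha>"
    and "analytic_semigroup phi" and "nontrivial_semigroup phi"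
    and "is_generator phi G" and "interior_DW_point phi b"
  shows "(H_zero p \<alpha> = strong_cont_space phi p \<alpha> \<longleftrightarrow> g_symbol G b \<in> little_bloch)
     \<and> (g_symbol G b \<notin> little_bloch \<longrightarrow> contains_closed_linf p \<alpha> (strong_cont_space phi p \<alpha>))"
proof -
  interpret S: interior_semigroup phi G b by unfold_locales fact+
  obtain P where P: "P holomorphic_on unit_disc" "\<And>z. norm z < 1 \<Longrightarrow> 0 \<le> Re (P z)"
    "\<And>z. norm z < 1 \<Longrightarrow> G z = - (z - b) * (1 - cnj b * z) * P z"
    by (rule S.generator_form) blast
  interpret S: interior_semigroup_P phi G b P by unfold_locales (use P in auto)
  show ?thesis
  proof (cases "g_symbol G b \<in> little_bloch")
    case True
    have "strong_cont_space phi p \<alpha> \<subseteq> H_zero p \<alpha>"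
      by (rule S.strong_cont_subset_H_zero[OF assms(1,2)]) (use True S.little_bloch_iff in blast)
    thus ?thesis using True S.H_zero_subset_strong_cont[OF assms(1,2)] by blast
  next
    case False
    obtain a \<theta> C0 K where "peaks phi G b P a \<theta> p \<alpha> C0 K"
      by (rule S.obtain_peaks[OF assms(1,2) False])
    then interpret peaks phi G b P a \<theta> p \<alpha> C0 K .
    have "peak_sum (\<lambda>_. 1) \<in> strong_cont_space phi p \<alpha>" by (rule peak_sum_strong[of _ 1]) simp
    thus ?thesis using False peak_sum_one_not_H_zero contains_closed_linf_strong by blast
  qed
qed

end
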